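(* Assume $\mathrm{ZF}+\mathrm{DC}+\mathrm{AD}$. For any problem $f$ (partial multivalued function between represented spaces), exactly one of the following holds: (1) ${}^1(f)\leq_{\mathrm{W}}^*\mathrm{C}_\mathbb{N}$; (2) $\Pi^0_2\mathrm{ACC}_\mathbb{N}\leq_{\mathrm{W}}^* f$.
   Context: The first-order part is ${}^1(f):=\max_{\leq_{\mathrm{W}}}\{g:\subseteq\mathbb{N}^\mathbb{N}\rightrightarrows\mathbb{N}\mid g\leq_{\mathrm{W}}f\}$ (this maximum exists). $\mathrm{C}_\mathbb{N}$: given an enumeration of the complement of a nonempty set $A\subseteq\mathbb{N}$, output an element of $A$. $\Pi^0_2\mathrm{ACC}_\mathbb{N}$ receives a $\Pi^0_2$ subset $A\subseteq\mathbb{N}$ with $|\mathbb{N}\setminus A|\le1$ and returns some $i\in A$; equivalently: given $p\in\mathbb{N}^\mathbb{N}$, output some $k\in\mathbb{N}$ with $\lim_{n\to\infty}p(n)\neq k$, where the inequality is considered satisfied if the limit does not exist. $g\leq_{\mathrm{W}}h$: computable $H,K$ such that $p\mapsto K(p,G(H(p)))$ realizes $g$ for every realizer $G$ of $h$; $\leq_{\mathrm{W}}^*$: the same with $H,K$ merely continuous. *)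

theory Defs
  imports Main
begin

text \<open>
  HOL has a global choice operator, so the axiom of determinacy is refutable when it is stated
  for HOL's own functions from naturals to naturals.  A theorem of ZF + DC + AD is therefore
  rendered semantically: it is a property of every structure (a type with a binary relation) that
  satisfies the axioms of ZF, DC and AD.  The schemas of ZF range over
  first-order formulas with parameters, not over HOL predicates, so structures without
  choice are not excluded, and by completeness truth in all structures is derivability.
  All mathematical notions below (naturals, Baire space, computability, problems, reducibility)
  are the internal notions of the structure: every quantifier ranges over its elements, and the
  structure may be ill-founded or have nonstandard naturals.
\<close>

datatype fm = Mem nat nat | Eq nat nat | Neg fm | Conj fm fm | Forall nat fm

text \<open>A partial multivalued function between represented spaces: the carriers and
  representations of source and target, and the graph; all five are sets of the structure.\<close>

record 'v problem =
  src :: 'v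
  src_rep :: 'v
  tgt :: 'v
  tgt_rep :: 'v
  graph :: 'v

locale set_structure =
  fixes mem :: "'v \<Rightarrow> 'v \<Rightarrow> bool"  (infix "\<^bold>\<in>" 50)
begin

subsection \<open>ZF\<close>

primrec sat :: "(nat \<Rightarrow> 'v) \<Rightarrow> fm \<Rightarrow> bool" where
  "sat e (Mem i j) \<longleftrightarrow> e i \<^bold>\<in> e j"
| "sat e (Eq i j) \<longleftrightarrow> e i = e j"
| "sat e (Neg \<phi>) \<longleftrightarrow> \<not> sat e \<phi>"
| "sat e (Conj \<phi> \<psi>) \<longleftrightarrow> sat e \<phi> \<and> sat e \<psi>"
| "sat e (Forall i \<phi>) \<longleftrightarrow> (\<forall>x. sat (e(i := x)) \<phi>)"

definition subset :: "'v \<Rightarrow> 'v \<Rightarrow> bool"  (infix "\<^bold>\<subseteq>" 50) where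
  "A \<^bold>\<subseteq> B \<longleftrightarrow> (\<forall>x. x \<^bold>\<in> A \<longrightarrow> x \<^bold>\<in> B)"

definition Extensionality :: bool where
  "Extensionality \<longleftrightarrow> (\<forall>A B. (\<forall>x. x \<^bold>\<in> A \<longleftrightarrow> x \<^bold>\<in> B) \<longrightarrow> A = B)"

definition Foundation :: bool where
  "Foundation \<longleftrightarrow> (\<forall>A. (\<exists>x. x \<^bold>\<in> A) \<longrightarrow> (\<exists>x. x \<^bold>\<in> A \<and> \<not> (\<exists>y. y \<^bold>\<in> x \<and> y \<^bold>\<in> A)))"

definition Pairing :: bool where
  "Pairing \<longleftrightarrow> (\<forall>a b. \<exists>C. \<forall>x. x \<^bold>\<in> C \<longleftrightarrow> x = a \<or> x = b)"

definition Union :: bool where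
  "Union \<longleftrightarrow> (\<forall>A. \<exists>C. \<forall>x. x \<^bold>\<in> C \<longleftrightarrow> (\<exists>y. y \<^bold>\<in> A \<and> x \<^bold>\<in> y))"

definition Powerset :: bool where
  "Powerset \<longleftrightarrow> (\<forall>A. \<exists>C. \<forall>x. x \<^bold>\<in> C \<longleftrightarrow> x \<^bold>\<subseteq> A)"

definition Infinity :: bool where
  "Infinity \<longleftrightarrow> (\<exists>I. (\<exists>z. z \<^bold>\<in> I \<and> (\<forall>x. \<not> x \<^bold>\<in> z)) \<and>
     (\<forall>x. x \<^bold>\<in> I \<longrightarrow> (\<exists>y. y \<^bold>\<in> I \<and> (\<forall>u. u \<^bold>\<in> y \<longleftrightarrow> u \<^bold>\<in> x \<or> u = x))))"

text \<open>In both schemas the environment \<open>e\<close> supplies the parameters.\<close>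

definition Separation :: bool where
  "Separation \<longleftrightarrow> (\<forall>\<phi> e A. \<exists>B. \<forall>x. x \<^bold>\<in> B \<longleftrightarrow> x \<^bold>\<in> A \<and> sat (e(0 := x)) \<phi>)"

definition Replacement :: bool where
  "Replacement \<longleftrightarrow> (\<forall>\<phi> e A.
     (\<forall>x. x \<^bold>\<in> A \<longrightarrow> (\<exists>!y. sat (e(0 := x, 1 := y)) \<phi>)) \<longrightarrow>
     (\<exists>B. \<forall>y. y \<^bold>\<in> B \<longleftrightarrow> (\<exists>x. x \<^bold>\<in> A \<and> sat (e(0 := x, 1 := y)) \<phi>)))"

definition ZF :: bool where
  "ZF \<longleftrightarrow> Extensionality \<and> Foundation \<and> Pairing \<and> Union \<and> Powerset \<and> Infinity
     \<and> Separation \<and> Replacement"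

subsection \<open>Basic set theory\<close>

text \<open>The set with the given extension; meaningful only if there is one.  It is used below only
  for first-order definable extensions that are sets by ZF.\<close>

definition collect :: "('v \<Rightarrow> bool) \<Rightarrow> 'v" where
  "collect P = (THE z. \<forall>x. x \<^bold>\<in> z \<longleftrightarrow> P x)"

definition empty :: 'v  ("\<^bold>0") where
  "\<^bold>0 = collect (\<lambda>x. False)"

definition upair :: "'v \<Rightarrow> 'v \<Rightarrow> 'v" where
  "upair a b = collect (\<lambda>x. x = a \<or> x = b)"

definition opair :: "'v \<Rightarrow> 'v \<Rightarrow> 'v"  ("\<^bold>\<langle>_,/ _\<^bold>\<rangle>") where
  "\<^bold>\<langle>a, b\<^bold>\<rangle> = upair (upair a a) (upair a b)"

definition func :: "'v \<Rightarrow> bool" where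
  "func F \<longleftrightarrow> (\<forall>z. z \<^bold>\<in> F \<longrightarrow> (\<exists>x y. z = \<^bold>\<langle>x, y\<^bold>\<rangle>)) \<and>
     (\<forall>x y y'. \<^bold>\<langle>x, y\<^bold>\<rangle> \<^bold>\<in> F \<and> \<^bold>\<langle>x, y'\<^bold>\<rangle> \<^bold>\<in> F \<longrightarrow> y = y')"

definition in_dom :: "'v \<Rightarrow> 'v \<Rightarrow> bool" where
  "in_dom x F \<longleftrightarrow> (\<exists>y. \<^bold>\<langle>x, y\<^bold>\<rangle> \<^bold>\<in> F)"

definition maps :: "'v \<Rightarrow> 'v \<Rightarrow> 'v \<Rightarrow> bool" where
  "maps F A B \<longleftrightarrow> func F \<and> (\<forall>x. in_dom x F \<longleftrightarrow> x \<^bold>\<in> A) \<and> (\<forall>x y. \<^bold>\<langle>x, y\<^bold>\<rangle> \<^bold>\<in> F \<longrightarrow> y \<^bold>\<in> B)"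

definition partial_maps :: "'v \<Rightarrow> 'v \<Rightarrow> 'v \<Rightarrow> bool" where
  "partial_maps F A B \<longleftrightarrow> func F \<and> (\<forall>x y. \<^bold>\<langle>x, y\<^bold>\<rangle> \<^bold>\<in> F \<longrightarrow> x \<^bold>\<in> A \<and> y \<^bold>\<in> B)"

text \<open>The union of all values at \<open>x\<close>, hence the value at \<open>x\<close> if \<open>F\<close> is a function defined
  there, and a definable total operation in any case.\<close>

definition app :: "'v \<Rightarrow> 'v \<Rightarrow> 'v"  (infixl "\<^bold>\<cdot>" 90) where
  "F \<^bold>\<cdot> x = collect (\<lambda>u. \<exists>y. \<^bold>\<langle>x, y\<^bold>\<rangle> \<^bold>\<in> F \<and> u \<^bold>\<in> y)"

subsection \<open>Natural numbers and Baire space\<close>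

definition succ :: "'v \<Rightarrow> 'v" where
  "succ n = collect (\<lambda>x. x \<^bold>\<in> n \<or> x = n)"

text \<open>The naturals are the von Neumann naturals, so \<open>k \<^bold>\<in> n\<close> expresses \<open>k < n\<close>.\<close>

definition omega :: 'v  ("\<omega>") where
  "\<omega> = collect (\<lambda>n. \<forall>I. \<^bold>0 \<^bold>\<in> I \<and> (\<forall>x. x \<^bold>\<in> I \<longrightarrow> succ x \<^bold>\<in> I) \<longrightarrow> n \<^bold>\<in> I)"

definition nrec :: "'v \<Rightarrow> ('v \<Rightarrow> 'v \<Rightarrow> 'v) \<Rightarrow> 'v \<Rightarrow> 'v" where
  "nrec a h n = (THE y. \<exists>s. func s \<and> (\<forall>k. in_dom k s \<longleftrightarrow> k \<^bold>\<in> succ n) \<and> s \<^bold>\<cdot> \<^bold>0 = a \<and>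
     (\<forall>k. k \<^bold>\<in> n \<longrightarrow> s \<^bold>\<cdot> succ k = h k (s \<^bold>\<cdot> k)) \<and> y = s \<^bold>\<cdot> n)"

definition add :: "'v \<Rightarrow> 'v \<Rightarrow> 'v" where
  "add m n = nrec m (\<lambda>k x. succ x) n"

definition triangle :: "'v \<Rightarrow> 'v" where
  "triangle n = nrec \<^bold>0 (\<lambda>k x. add x (succ k)) n"

text \<open>Cantor pairing\<close>

definition npair :: "'v \<Rightarrow> 'v \<Rightarrow> 'v" where
  "npair m n = add (triangle (add m n)) m"

definition baire :: 'v  ("\<N>") where
  "\<N> = collect (\<lambda>p. maps p \<omega> \<omega>)"

definition finseqs :: 'v where
  "finseqs = collect (\<lambda>s. \<exists>n. n \<^bold>\<in> \<omega> \<and> maps s n \<omega>)"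

definition restr :: "'v \<Rightarrow> 'v \<Rightarrow> 'v"  (infixl "\<^bold>\<restriction>" 85) where
  "p \<^bold>\<restriction> n = collect (\<lambda>z. z \<^bold>\<in> p \<and> (\<exists>k y. k \<^bold>\<in> n \<and> z = \<^bold>\<langle>k, y\<^bold>\<rangle>))"

definition interleave :: "'v \<Rightarrow> 'v \<Rightarrow> 'v" where
  "interleave p q = collect (\<lambda>z. \<exists>n. n \<^bold>\<in> \<omega> \<and>
     (z = \<^bold>\<langle>add n n, p \<^bold>\<cdot> n\<^bold>\<rangle> \<or> z = \<^bold>\<langle>succ (add n n), q \<^bold>\<cdot> n\<^bold>\<rangle>))"

subsection \<open>Dependent choice and determinacy\<close>

definition DC :: bool where
  "DC \<longleftrightarrow> (\<forall>A R. (\<exists>x. x \<^bold>\<in> A) \<and> (\<forall>x. x \<^bold>\<in> A \<longrightarrow> (\<exists>y. y \<^bold>\<in> A \<and> \<^bold>\<langle>x, y\<^bold>\<rangle> \<^bold>\<in> R)) \<longrightarrow>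
     (\<exists>s. maps s \<omega> A \<and> (\<forall>n. n \<^bold>\<in> \<omega> \<longrightarrow> \<^bold>\<langle>s \<^bold>\<cdot> n, s \<^bold>\<cdot> succ n\<^bold>\<rangle> \<^bold>\<in> R)))"

text \<open>In the game with payoff set \<open>A\<close>, player I plays \<open>a(0), a(1), \<dots>\<close> and player II plays
  \<open>b(0), b(1), \<dots>\<close> alternately, I starting; I wins iff the interleaved run is in \<open>A\<close>.
  A strategy maps the finite sequence of the opponent's previous moves to the next move.\<close>

definition wins_I :: "'v \<Rightarrow> 'v \<Rightarrow> bool" where
  "wins_I \<sigma> A \<longleftrightarrow> maps \<sigma> finseqs \<omega> \<and>
     (\<forall>a b. a \<^bold>\<in> \<N> \<and> b \<^bold>\<in> \<N> \<and> (\<forall>n. n \<^bold>\<in> \<omega> \<longrightarrow> a \<^bold>\<cdot> n = \<sigma> \<^bold>\<cdot> (b \<^bold>\<restriction> n)) \<longrightarrow> interleave a b \<^bold>\<in> A)"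

definition wins_II :: "'v \<Rightarrow> 'v \<Rightarrow> bool" where
  "wins_II \<tau> A \<longleftrightarrow> maps \<tau> finseqs \<omega> \<and>
     (\<forall>a b. a \<^bold>\<in> \<N> \<and> b \<^bold>\<in> \<N> \<and> (\<forall>n. n \<^bold>\<in> \<omega> \<longrightarrow> b \<^bold>\<cdot> n = \<tau> \<^bold>\<cdot> (a \<^bold>\<restriction> succ n)) \<longrightarrow>
        \<not> interleave a b \<^bold>\<in> A)"

definition AD :: bool where
  "AD \<longleftrightarrow> (\<forall>A. A \<^bold>\<subseteq> \<N> \<longrightarrow> (\<exists>\<sigma>. wins_I \<sigma> A) \<or> (\<exists>\<tau>. wins_II \<tau> A))"

subsection \<open>Computable and continuous partial functions on Baire space\<close>

text \<open>The partial recursive functionals, that is, partial functions of an oracle \<open>p\<close> and a natural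
  number \<open>n\<close>, are the least class containing the basic functions and the oracle and
  closed under Kleene's schemes, where tuples of arguments are coded by Cantor pairing.
  \<open>val \<Phi> p n m\<close> says that \<open>\<Phi>(p, n)\<close> is defined with value \<open>m\<close>.\<close>

definition val :: "'v \<Rightarrow> 'v \<Rightarrow> 'v \<Rightarrow> 'v \<Rightarrow> bool" where
  "val \<Phi> p n m \<longleftrightarrow> m \<^bold>\<in> \<omega> \<and> \<^bold>\<langle>\<^bold>\<langle>p, n\<^bold>\<rangle>, m\<^bold>\<rangle> \<^bold>\<in> \<Phi>"

definition functional :: "('v \<Rightarrow> 'v \<Rightarrow> 'v \<Rightarrow> bool) \<Rightarrow> 'v" where
  "functional G = collect (\<lambda>z. \<exists>p n m. p \<^bold>\<in> \<N> \<and> n \<^bold>\<in> \<omega> \<and> m \<^bold>\<in> \<omega> \<and> G p n m \<and> z = \<^bold>\<langle>\<^bold>\<langle>p, n\<^bold>\<rangle>, m\<^bold>\<rangle>)"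

definition rf_zero :: 'v where
  "rf_zero = functional (\<lambda>p n m. m = \<^bold>0)"

definition rf_succ :: 'v where
  "rf_succ = functional (\<lambda>p n m. m = succ n)"

definition rf_left :: 'v where
  "rf_left = functional (\<lambda>p n m. \<exists>k. k \<^bold>\<in> \<omega> \<and> n = npair m k)"

definition rf_right :: 'v where
  "rf_right = functional (\<lambda>p n m. \<exists>k. k \<^bold>\<in> \<omega> \<and> n = npair k m)"

definition rf_oracle :: 'v where
  "rf_oracle = functional (\<lambda>p n m. m = p \<^bold>\<cdot> n)"

definition rf_pair :: "'v \<Rightarrow> 'v \<Rightarrow> 'v" where
  "rf_pair \<Phi> \<Psi> = functional (\<lambda>p n m. \<exists>a b. val \<Phi> p n a \<and> val \<Psi> p n b \<and> m = npair a b)"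

definition rf_comp :: "'v \<Rightarrow> 'v \<Rightarrow> 'v" where
  "rf_comp \<Phi> \<Psi> = functional (\<lambda>p n m. \<exists>a. val \<Psi> p n a \<and> val \<Phi> p a m)"

text \<open>Primitive recursion: the value at \<open>\<langle>a, k\<rangle>\<close> is \<open>s(k)\<close> where \<open>s(0) = \<Phi>(p, a)\<close> and
  \<open>s(j + 1) = \<Psi>(p, \<langle>a, \<langle>j, s(j)\<rangle>\<rangle>)\<close>.\<close>

definition rf_prec :: "'v \<Rightarrow> 'v \<Rightarrow> 'v" where
  "rf_prec \<Phi> \<Psi> = functional (\<lambda>p n m. \<exists>a k s. a \<^bold>\<in> \<omega> \<and> k \<^bold>\<in> \<omega> \<and> n = npair a k \<and> maps s (succ k) \<omega> \<and>
     val \<Phi> p a (s \<^bold>\<cdot> \<^bold>0) \<and>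
     (\<forall>j. j \<^bold>\<in> k \<longrightarrow> val \<Psi> p (npair a (npair j (s \<^bold>\<cdot> j))) (s \<^bold>\<cdot> succ j)) \<and> m = s \<^bold>\<cdot> k)"

text \<open>Unbounded search: the value at \<open>n\<close> is the least \<open>m\<close> with \<open>\<Phi>(p, \<langle>n, m\<rangle>) = 0\<close>, provided
  that all earlier values are defined.\<close>

definition rf_mu :: "'v \<Rightarrow> 'v" where
  "rf_mu \<Phi> = functional (\<lambda>p n m. val \<Phi> p (npair n m) \<^bold>0 \<and>
     (\<forall>j. j \<^bold>\<in> m \<longrightarrow> (\<exists>v. val \<Phi> p (npair n j) v \<and> v \<noteq> \<^bold>0)))"

definition rf_closed :: "'v \<Rightarrow> bool" where
  "rf_closed C \<longleftrightarrow> rf_zero \<^bold>\<in> C \<and> rf_succ \<^bold>\<in> C \<and> rf_left \<^bold>\<in> C \<and> rf_right \<^bold>\<in> C \<and> rf_oracle \<^bold>\<in> C \<and>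
     (\<forall>\<Phi> \<Psi>. \<Phi> \<^bold>\<in> C \<and> \<Psi> \<^bold>\<in> C \<longrightarrow>
        rf_pair \<Phi> \<Psi> \<^bold>\<in> C \<and> rf_comp \<Phi> \<Psi> \<^bold>\<in> C \<and> rf_prec \<Phi> \<Psi> \<^bold>\<in> C \<and> rf_mu \<Phi> \<^bold>\<in> C)"

definition recursive_functional :: "'v \<Rightarrow> bool" where
  "recursive_functional \<Phi> \<longleftrightarrow> (\<forall>C. rf_closed C \<longrightarrow> \<Phi> \<^bold>\<in> C)"

text \<open>As usual in computable analysis, any restriction of a computable partial function counts as
  computable.\<close>

definition computable :: "'v \<Rightarrow> bool" where
  "computable F \<longleftrightarrow> partial_maps F \<N> \<N> \<and> (\<exists>\<Phi>. recursive_functional \<Phi> \<and>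
     (\<forall>p q. \<^bold>\<langle>p, q\<^bold>\<rangle> \<^bold>\<in> F \<longrightarrow> (\<forall>n. n \<^bold>\<in> \<omega> \<longrightarrow> val \<Phi> p n (q \<^bold>\<cdot> n))))"

definition continuous :: "'v \<Rightarrow> bool" where
  "continuous F \<longleftrightarrow> partial_maps F \<N> \<N> \<and>
     (\<forall>p q n. \<^bold>\<langle>p, q\<^bold>\<rangle> \<^bold>\<in> F \<and> n \<^bold>\<in> \<omega> \<longrightarrow>
        (\<exists>m. m \<^bold>\<in> \<omega> \<and> (\<forall>p' q'. \<^bold>\<langle>p', q'\<^bold>\<rangle> \<^bold>\<in> F \<and> p' \<^bold>\<restriction> m = p \<^bold>\<restriction> m \<longrightarrow> q' \<^bold>\<restriction> n = q \<^bold>\<restriction> n)))"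

subsection \<open>Problems and Weihrauch reducibility\<close>

definition represented_space :: "'v \<Rightarrow> 'v \<Rightarrow> bool" where
  "represented_space X \<delta> \<longleftrightarrow> partial_maps \<delta> \<N> X \<and> (\<forall>x. x \<^bold>\<in> X \<longrightarrow> (\<exists>p. \<^bold>\<langle>p, x\<^bold>\<rangle> \<^bold>\<in> \<delta>))"

definition is_problem :: "'v problem \<Rightarrow> bool" where
  "is_problem f \<longleftrightarrow> represented_space (src f) (src_rep f) \<and> represented_space (tgt f) (tgt_rep f) \<and>
     (\<forall>z. z \<^bold>\<in> graph f \<longrightarrow> (\<exists>x y. x \<^bold>\<in> src f \<and> y \<^bold>\<in> tgt f \<and> z = \<^bold>\<langle>x, y\<^bold>\<rangle>))"

definition instance_name :: "'v problem \<Rightarrow> 'v \<Rightarrow> bool" where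
  "instance_name f p \<longleftrightarrow> (\<exists>x. \<^bold>\<langle>p, x\<^bold>\<rangle> \<^bold>\<in> src_rep f \<and> in_dom x (graph f))"

definition solution_name :: "'v problem \<Rightarrow> 'v \<Rightarrow> 'v \<Rightarrow> bool" where
  "solution_name f p q \<longleftrightarrow> (\<exists>x y. \<^bold>\<langle>p, x\<^bold>\<rangle> \<^bold>\<in> src_rep f \<and> \<^bold>\<langle>x, y\<^bold>\<rangle> \<^bold>\<in> graph f \<and> \<^bold>\<langle>q, y\<^bold>\<rangle> \<^bold>\<in> tgt_rep f)"

text \<open>Without choice a problem may fail to have a realizer, so "for every realizer \<open>G\<close> of \<open>h\<close>" is
  read pointwise, with \<open>q\<close> ranging over the admissible values of \<open>G(H(p))\<close>.  If \<open>h\<close> has a realizer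
  at all, this is the same as quantifying over realizers, since a realizer can be changed at
  one point.\<close>

definition reduces_via :: "('v \<Rightarrow> bool) \<Rightarrow> 'v problem \<Rightarrow> 'v problem \<Rightarrow> bool" where
  "reduces_via Q g h \<longleftrightarrow> (\<exists>H K. Q H \<and> Q K \<and>
     (\<forall>p. instance_name g p \<longrightarrow> in_dom p H \<and> instance_name h (H \<^bold>\<cdot> p) \<and>
        (\<forall>q. solution_name h (H \<^bold>\<cdot> p) q \<longrightarrow>
           in_dom (interleave p q) K \<and> solution_name g p (K \<^bold>\<cdot> interleave p q))))"

definition le_W :: "'v problem \<Rightarrow> 'v problem \<Rightarrow> bool"  (infix "\<le>\<^sub>W" 50) where
  "g \<le>\<^sub>W h \<longleftrightarrow> reduces_via computable g h"

definition le_W_cont :: "'v problem \<Rightarrow> 'v problem \<Rightarrow> bool"  (infix "\<le>\<^sub>W\<^sup>*" 50) where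
  "g \<le>\<^sub>W\<^sup>* h \<longleftrightarrow> reduces_via continuous g h"

subsection \<open>The first-order part, choice on the naturals, and all-or-co-unique choice\<close>

definition baire_rep :: 'v where
  "baire_rep = collect (\<lambda>z. \<exists>p. p \<^bold>\<in> \<N> \<and> z = \<^bold>\<langle>p, p\<^bold>\<rangle>)"

definition nat_rep :: 'v where
  "nat_rep = collect (\<lambda>z. \<exists>p. p \<^bold>\<in> \<N> \<and> z = \<^bold>\<langle>p, p \<^bold>\<cdot> \<^bold>0\<^bold>\<rangle>)"

definition baire_nat_problem :: "'v problem \<Rightarrow> bool" where
  "baire_nat_problem g \<longleftrightarrow> is_problem g \<and>
     src g = \<N> \<and> src_rep g = baire_rep \<and> tgt g = \<omega> \<and> tgt_rep g = nat_rep"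

text \<open>The first-order part is a maximum for a preorder, so it is determined only up to
  equivalence; this says that \<open>g\<close> is a representative.\<close>

definition is_first_order_part :: "'v problem \<Rightarrow> 'v problem \<Rightarrow> bool" where
  "is_first_order_part g f \<longleftrightarrow> baire_nat_problem g \<and> g \<le>\<^sub>W f \<and>
     (\<forall>g'. baire_nat_problem g' \<and> g' \<le>\<^sub>W f \<longrightarrow> g' \<le>\<^sub>W g)"

text \<open>A set \<open>A\<close> of naturals is named by an enumeration of its complement, in which \<open>0\<close> enumerates
  nothing and \<open>k + 1\<close> enumerates \<open>k\<close>.\<close>

definition closed_sets_rep :: 'v where
  "closed_sets_rep = collect (\<lambda>z. \<exists>p. p \<^bold>\<in> \<N> \<and>
     z = \<^bold>\<langle>p, collect (\<lambda>k. k \<^bold>\<in> \<omega> \<and> \<not> (\<exists>n. n \<^bold>\<in> \<omega> \<and> p \<^bold>\<cdot> n = succ k))\<^bold>\<rangle>)"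

definition C_Nat :: "'v problem"  ("C\<^sub>\<nat>") where
  "C\<^sub>\<nat> = \<lparr>src = collect (\<lambda>A. A \<^bold>\<subseteq> \<omega>), src_rep = closed_sets_rep, tgt = \<omega>, tgt_rep = nat_rep,
     graph = collect (\<lambda>z. \<exists>A k. A \<^bold>\<subseteq> \<omega> \<and> k \<^bold>\<in> A \<and> z = \<^bold>\<langle>A, k\<^bold>\<rangle>)\<rparr>"

definition has_limit :: "'v \<Rightarrow> 'v \<Rightarrow> bool" where
  "has_limit p k \<longleftrightarrow> (\<exists>m. m \<^bold>\<in> \<omega> \<and> (\<forall>n. n \<^bold>\<in> \<omega> \<and> \<not> n \<^bold>\<in> m \<longrightarrow> p \<^bold>\<cdot> n = k))"

definition Pi02_ACC_Nat :: "'v problem"  ("\<Pi>\<^sup>0\<^sub>2ACC\<^sub>\<nat>") where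
  "\<Pi>\<^sup>0\<^sub>2ACC\<^sub>\<nat> = \<lparr>src = \<N>, src_rep = baire_rep, tgt = \<omega>, tgt_rep = nat_rep,
     graph = collect (\<lambda>z. \<exists>p k. p \<^bold>\<in> \<N> \<and> k \<^bold>\<in> \<omega> \<and> \<not> has_limit p k \<and> z = \<^bold>\<langle>p, k\<^bold>\<rangle>)\<rparr>"

end

end

theory Submission
  imports Defs
begin

text \<open>
  For the positive direction, consider the game in which I plays a sequence \<open>a\<close>, II plays a
  sequence \<open>b\<close>, and I wins unless \<open>b\<close> is an instance of \<open>g\<close> none of whose solutions is the limit
  of \<open>a\<close>. A winning strategy of II is a continuous reduction of all-or-co-unique choice to \<open>g\<close> with
  trivial backward part. A winning strategy of I turns every instance of \<open>g\<close> into a sequence that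
  converges to a solution, and limits of sequences of naturals are found by choice on the naturals.

  For exclusivity, a continuous reduction \<open>(H, K)\<close> of all-or-co-unique choice to \<open>f\<close> is made
  computable by letting the names carry \<open>H(p)\<close> and a table of the finitely determined answers of \<open>K\<close>.
  The resulting problem reduces to the first-order part, so all-or-co-unique choice would reduce
  continuously to choice on the naturals. A Baire category argument, using dependent choice, refutes
  this: every prefix of an instance extends to one that removes a given \<open>j\<close> from the closed set, so
  some instance is mapped to the empty set.

  All of this takes place inside the structure. A predicate is called definable if it is given by a
  first-order formula with parameters, and every set that is formed and every induction on the
  naturals of the structure is justified by definability.
\<close>

text \<open>The game is played for the first-order part \<open>g\<close> and not for
  \<open>f\<close>, because the payoff compares solutions with the limit of a sequence of naturals.
  Making a non-instance \<open>b\<close> a loss for II means that a winning strategy of II always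
  produces an instance, while one of I owes nothing outside the domain.

  The obstacle to exclusivity is that \<open>g\<close> is maximal for computable reductions only,
  while the given reduction of all-or-co-unique choice is merely continuous and may need an oracle.
  Its oracle data are therefore moved into the instances, in a way that must stay continuous in
  \<open>p\<close>. This works because the first output of \<open>K\<close> is decided by a prefix
  of \<open>p\<close> and a prefix of the answer, and because a Cantor code bounds its components,
  so that entry \<open>i\<close> of the table inspects \<open>p\<close> only below \<open>i\<close>.

  Since \<open>collect\<close> and \<open>nrec\<close> are definite descriptions, they are
  controlled only where ZF provides the set or the value. Hence arithmetic is handled through total
  variants that are definable everywhere.\<close>

context set_structure
begin

subsection \<open>Definability with parameters\<close>

text \<open>A formula mentions finitely many variables; this supplies the fresh variable that
  renaming under a quantifier needs.\<close>

lemma sat_support: "\<exists>N. \<forall>e e'. (\<forall>n<N. e n = e' n) \<longrightarrow> sat e \<phi> = sat e' \<phi>"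
proof (induction \<phi>)
  case (Mem i j)
  show ?case by (rule exI[of _ "Suc (max i j)"]) (auto simp: less_Suc_eq_le)
next
  case (Eq i j)
  show ?case by (rule exI[of _ "Suc (max i j)"]) (auto simp: less_Suc_eq_le)
next
  case (Neg \<phi>)
  then show ?case by auto
next
  case (Conj \<phi> \<psi>)
  then obtain N M where
    "\<forall>e e'. (\<forall>n<N. e n = e' n) \<longrightarrow> sat e \<phi> = sat e' \<phi>"
    "\<forall>e e'. (\<forall>n<M. e n = e' n) \<longrightarrow> sat e \<psi> = sat e' \<psi>" by blast
  then have "\<forall>e e'. (\<forall>n<max N M. e n = e' n) \<longrightarrow> sat e (Conj \<phi> \<psi>) = sat e' (Conj \<phi> \<psi>)"
    by (metis sat.simps(4) less_max_iff_disj)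
  then show ?case by blast
next
  case (Forall i \<phi>)
  then obtain N where N: "\<And>e e'. (\<forall>n<N. e n = e' n) \<Longrightarrow> sat e \<phi> = sat e' \<phi>" by blast
  have "sat (e(i := x)) \<phi> = sat (e'(i := x)) \<phi>" if "\<forall>n<N. e n = e' n" for e e' x
    by (rule N) (use that in auto)
  then show ?case unfolding sat.simps by blast
qed

lemma sat_rename: "\<exists>\<psi>. \<forall>e. sat e \<psi> = sat (\<lambda>n. e (\<rho> n)) \<phi>"
proof (induction \<phi> arbitrary: \<rho>)
  case (Mem i j)
  show ?case by (rule exI[of _ "Mem (\<rho> i) (\<rho> j)"]) simp
next
  case (Eq i j)
  show ?case by (rule exI[of _ "Eq (\<rho> i) (\<rho> j)"]) simp
next
  case (Neg \<phi>)
  then show ?case by (metis sat.simps(3))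
next
  case (Conj \<phi> \<psi>)
  then show ?case by (metis sat.simps(4))
next
  case (Forall i \<phi>)
  obtain N where N: "\<And>e e'. (\<forall>n<N. e n = e' n) \<Longrightarrow> sat e \<phi> = sat e' \<phi>"
    using sat_support by blast
  \<comment> \<open>\<open>\<rho>\<close> need not be injective, so the bound variable moves to an
    index to which no relevant variable is sent; this avoids capture.\<close>
  obtain j where j: "j \<notin> \<rho> ` {..<N}"
    using ex_new_if_finite[of "\<rho> ` {..<N}"] by auto
  obtain \<psi> where \<psi>: "\<And>e. sat e \<psi> = sat (\<lambda>n. e ((\<rho>(i := j)) n)) \<phi>"
    using Forall.IH[of "\<rho>(i := j)"] by blast
  have "sat (\<lambda>n. (e(j := x)) ((\<rho>(i := j)) n)) \<phi> = sat ((\<lambda>n. e (\<rho> n))(i := x)) \<phi>" for e x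
    by (rule N) (use j in auto)
  then show ?case
    using \<psi> by (intro exI[of _ "Forall j \<psi>"]) simp
qed

text \<open>Every variable of a formula is either a variable of the environment or a parameter.\<close>

definition slot :: "(nat \<Rightarrow> nat + 'v) \<Rightarrow> (nat \<Rightarrow> 'v) \<Rightarrow> nat \<Rightarrow> 'v" where
  "slot r e n = (case r n of Inl i \<Rightarrow> e i | Inr a \<Rightarrow> a)"

text \<open>Every predicate brings its own assignment \<open>r\<close>, so parameters never have to
  be lined up in advance. Environments are read in de Bruijn style, with the innermost variable at
  position 0.\<close>

definition definable :: "((nat \<Rightarrow> 'v) \<Rightarrow> bool) \<Rightarrow> bool" where
  "definable P \<longleftrightarrow> (\<exists>\<phi> r. \<forall>e. P e = sat (slot r e) \<phi>)"

text \<open>The formula language has no function symbols, so an operation is definable through its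
  graph, the value being put in front of the arguments.\<close>

definition defterm :: "((nat \<Rightarrow> 'v) \<Rightarrow> 'v) \<Rightarrow> bool" where
  "defterm t \<longleftrightarrow> definable (\<lambda>e. e 0 = t (\<lambda>n. e (Suc n)))"

named_theorems definable_intros

lemma definable_rename: "definable P \<Longrightarrow> definable (\<lambda>e. P (\<lambda>n. e (\<rho> n)))"
proof -
  assume "definable P"
  then obtain \<phi> r where *: "\<And>e. P e = sat (slot r e) \<phi>" by (auto simp: definable_def)
  have "slot r (\<lambda>n. e (\<rho> n)) = slot (\<lambda>n. map_sum \<rho> id (r n)) e" for e
    by (auto simp: slot_def fun_eq_iff split: sum.splits)
  with * show ?thesis unfolding definable_def by metis
qed

lemma definable_var_mem: "definable (\<lambda>e. e i \<^bold>\<in> e j)"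
  unfolding definable_def
  by (rule exI[of _ "Mem 0 1"], rule exI[of _ "\<lambda>n. Inl (if n = 0 then i else j)"])
    (simp add: slot_def)

lemma definable_var_eq: "definable (\<lambda>e. e i = e j)"
  unfolding definable_def
  by (rule exI[of _ "Eq 0 1"], rule exI[of _ "\<lambda>n. Inl (if n = 0 then i else j)"])
    (simp add: slot_def)

lemma definable_not [definable_intros]: "definable P \<Longrightarrow> definable (\<lambda>e. \<not> P e)"
  unfolding definable_def by (metis sat.simps(3))

lemma definable_conj [definable_intros]:
  assumes "definable P" "definable Q"
  shows "definable (\<lambda>e. P e \<and> Q e)"
proof -
  obtain \<phi> r \<psi> s where *: "\<And>e. P e = sat (slot r e) \<phi>" "\<And>e. Q e = sat (slot s e) \<psi>"
    using assms by (auto simp: definable_def)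
  obtain \<phi>' \<psi>' where **: "\<And>e. sat e \<phi>' = sat (\<lambda>n. e (2 * n)) \<phi>" "\<And>e. sat e \<psi>' = sat (\<lambda>n. e (2 * n + 1)) \<psi>"
    using sat_rename[of "\<lambda>n. 2 * n"] sat_rename[of "\<lambda>n. 2 * n + 1"] by metis
  \<comment> \<open>The two formulas live on the even and on the odd variables, so that their
    parameters cannot collide.\<close>
  define q where "q n = (if even n then r (n div 2) else s (n div 2))" for n
  have "(\<lambda>n. slot q e (2 * n)) = slot r e" "(\<lambda>n. slot q e (2 * n + 1)) = slot s e" for e
    by (auto simp: slot_def q_def fun_eq_iff)
  then have "\<forall>e. (P e \<and> Q e) = sat (slot q e) (Conj \<phi>' \<psi>')"
    using * ** by simp
  then show ?thesis unfolding definable_def by blast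
qed

lemma definable_all [definable_intros]:
  assumes "definable (\<lambda>e. Q (e 0) (\<lambda>n. e (Suc n)))"
  shows "definable (\<lambda>e. \<forall>x. Q x e)"
proof -
  obtain \<phi> r where *: "\<And>e. Q (e 0) (\<lambda>n. e (Suc n)) = sat (slot r e) \<phi>"
    using assms by (auto simp: definable_def)
  have Q: "Q x e = sat (slot r (case_nat x e)) \<phi>" for x e
    using *[of "case_nat x e"] by simp
  \<comment> \<open>All variables that stand for the innermost position are merged into variable 0,
    which is then quantified; the others are shifted out of its way. In \<open>q\<close> the binder
    is removed by \<open>i - 1\<close>, and the entry at 0 is a dummy that the quantifier
    overwrites.\<close>
  define \<rho> where "\<rho> n = (if r n = Inl 0 then 0 else Suc n)" for n
  define q :: "nat \<Rightarrow> nat + 'v" where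
    "q n = (case n of 0 \<Rightarrow> Inl 0 | Suc k \<Rightarrow> (case r k of Inl i \<Rightarrow> Inl (i - 1) | Inr a \<Rightarrow> Inr a))" for n
  obtain \<psi> where \<psi>: "\<And>e. sat e \<psi> = sat (\<lambda>n. e (\<rho> n)) \<phi>" using sat_rename by blast
  have "(\<lambda>n. ((slot q e)(0 := x)) (\<rho> n)) = slot r (case_nat x e)" for x e
    by (auto simp: slot_def \<rho>_def q_def fun_eq_iff split: sum.splits nat.splits)
  then have "\<forall>e. (\<forall>x. Q x e) = sat (slot q e) (Forall 0 \<psi>)"
    using Q \<psi> by simp
  then show ?thesis unfolding definable_def by blast
qed

lemma definable_ex [definable_intros]:
  assumes "definable (\<lambda>e. Q (e 0) (\<lambda>n. e (Suc n)))"
  shows "definable (\<lambda>e. \<exists>x. Q x e)"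
proof -
  have "definable (\<lambda>e. \<not> (\<forall>x. \<not> Q x e))" by (intro definable_not definable_all assms)
  then show ?thesis by simp
qed

lemma definable_disj [definable_intros]:
  assumes "definable P" "definable Q" shows "definable (\<lambda>e. P e \<or> Q e)"
proof -
  have "definable (\<lambda>e. \<not> (\<not> P e \<and> \<not> Q e))" by (intro definable_not definable_conj assms)
  then show ?thesis by simp
qed

lemma definable_imp [definable_intros]:
  assumes "definable P" "definable Q" shows "definable (\<lambda>e. P e \<longrightarrow> Q e)"
proof -
  have "definable (\<lambda>e. \<not> P e \<or> Q e)" by (intro definable_not definable_disj assms)
  then show ?thesis unfolding imp_conv_disj .
qed

lemma definable_weaken: "definable P \<Longrightarrow> definable (\<lambda>e. P (\<lambda>n. e (Suc n)))"
  by (rule definable_rename)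

lemma definable_const [definable_intros]: "definable (\<lambda>e. b)"
proof (cases b)
  case True
  then show ?thesis using definable_var_eq[of 0 0] by simp
next
  case False
  then show ?thesis using definable_not[OF definable_var_eq[of 0 0]] by simp
qed

lemma defterm_var [definable_intros]: "defterm (\<lambda>e. e i)"
  unfolding defterm_def by (rule definable_var_eq)

lemma defterm_const [definable_intros]: "defterm (\<lambda>e. c)"
  unfolding defterm_def definable_def
  by (rule exI[of _ "Eq 0 1"], rule exI[of _ "\<lambda>n. if n = 0 then Inl 0 else Inr c"])
    (simp add: slot_def)

lemma defterm_rename: "defterm t \<Longrightarrow> defterm (\<lambda>e. t (\<lambda>n. e (\<rho> n)))"
  unfolding defterm_def
  by (drule definable_rename[of _ "case_nat 0 (\<lambda>n. Suc (\<rho> n))"]) simp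

lemma defterm_weaken: "defterm t \<Longrightarrow> defterm (\<lambda>e. t (\<lambda>n. e (Suc n)))"
  by (rule defterm_rename)

text \<open>In a language without terms, substitution is an existential quantifier over the value of
  the term.\<close>

lemma definable_subst:
  assumes "definable (\<lambda>e. Q (e 0) (\<lambda>n. e (Suc n)))" "defterm t"
  shows "definable (\<lambda>e. Q (t e) e)"
proof -
  have "definable (\<lambda>e. \<exists>y. y = t e \<and> Q y e)"
    using assms by (intro definable_ex definable_conj) (simp_all add: defterm_def)
  then show ?thesis by simp
qed

lemma definable_mem [definable_intros]:
  assumes "defterm t" "defterm s" shows "definable (\<lambda>e. t e \<^bold>\<in> s e)"
  by (rule definable_subst[OF definable_subst[OF _ defterm_weaken[OF assms(2)]] assms(1)])
    (rule definable_var_mem)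

lemma definable_eq [definable_intros]:
  assumes "defterm t" "defterm s" shows "definable (\<lambda>e. t e = s e)"
  by (rule definable_subst[OF definable_subst[OF _ defterm_weaken[OF assms(2)]] assms(1)])
    (rule definable_var_eq)

lemma definable_if [definable_intros]:
  assumes "definable P" "defterm t" "defterm s" shows "defterm (\<lambda>e. if P e then t e else s e)"
proof -
  have "definable (\<lambda>e. (P (\<lambda>n. e (Suc n)) \<and> e 0 = t (\<lambda>n. e (Suc n))) \<or>
      (\<not> P (\<lambda>n. e (Suc n)) \<and> e 0 = s (\<lambda>n. e (Suc n))))"
    by (intro definable_intros definable_weaken defterm_weaken assms)
  moreover have "(\<lambda>e. (P (\<lambda>n. e (Suc n)) \<and> e 0 = t (\<lambda>n. e (Suc n))) \<or>
      (\<not> P (\<lambda>n. e (Suc n)) \<and> e 0 = s (\<lambda>n. e (Suc n)))) =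
      (\<lambda>e. e 0 = (if P (\<lambda>n. e (Suc n)) then t (\<lambda>n. e (Suc n)) else s (\<lambda>n. e (Suc n))))"
    by auto
  ultimately show ?thesis unfolding defterm_def by simp
qed

definition defpred :: "('v \<Rightarrow> bool) \<Rightarrow> bool" where
  "defpred P \<longleftrightarrow> definable (\<lambda>e. P (e 0))"

definition defop :: "('v \<Rightarrow> 'v) \<Rightarrow> bool" where
  "defop F \<longleftrightarrow> definable (\<lambda>e. e 0 = F (e 1))"

definition defop2 :: "('v \<Rightarrow> 'v \<Rightarrow> 'v) \<Rightarrow> bool" where
  "defop2 F \<longleftrightarrow> definable (\<lambda>e. e 0 = F (e 1) (e 2))"

lemma defopI: "defterm (\<lambda>e. F (e 0)) \<Longrightarrow> defop F"
  unfolding defterm_def defop_def by simp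

lemma defop2I: "defterm (\<lambda>e. F (e 0) (e 1)) \<Longrightarrow> defop2 F"
  unfolding defterm_def defop2_def by (simp add: numeral_2_eq_2)

lemma definable_defpred: "defpred P \<Longrightarrow> defterm t \<Longrightarrow> definable (\<lambda>e. P (t e))"
  by (rule definable_subst) (auto simp: defpred_def)

lemma defterm_defop: assumes "defop F" "defterm t" shows "defterm (\<lambda>e. F (t e))"
proof -
  have "definable (\<lambda>e. e (Suc 0) = F (e 0))"
    using definable_rename[of _ "\<lambda>n. 1 - n", OF assms(1)[unfolded defop_def]] by simp
  from definable_subst[OF _ defterm_weaken[OF assms(2)], of "\<lambda>y e. e 0 = F y", OF this]
  show ?thesis unfolding defterm_def by simp
qed

lemma defterm_defop2:
  assumes "defop2 F" "defterm t" "defterm s" shows "defterm (\<lambda>e. F (t e) (s e))"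
proof -
  \<comment> \<open>The arguments are rotated to the front, where \<open>definable_subst\<close> can
    eliminate them one after the other.\<close>
  have "definable (\<lambda>e. e (Suc (Suc 0)) = F (e 0) (e (Suc 0)))"
    using definable_rename[of _ "\<lambda>n. if n = 0 then 2 else n - 1", OF assms(1)[unfolded defop2_def]]
    by (simp add: numeral_2_eq_2)
  from definable_subst[OF _ defterm_weaken[OF defterm_weaken[OF assms(2)]],
    of "\<lambda>y e. e (Suc 0) = F y (e 0)", OF this]
  have "definable (\<lambda>e. e (Suc 0) = F (t (\<lambda>n. e (Suc (Suc n)))) (e 0))" by simp
  from definable_subst[OF _ defterm_weaken[OF assms(3)],
    of "\<lambda>y e. e 0 = F (t (\<lambda>n. e (Suc n))) y", OF this]
  show ?thesis unfolding defterm_def by simp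
qed

end


locale zf_structure = set_structure mem for mem :: "'v \<Rightarrow> 'v \<Rightarrow> bool"  (infix "\<^bold>\<in>" 50) +
  assumes ZF: ZF
begin

subsection \<open>Sets and pairs\<close>

lemma set_eqI: "(\<And>x. x \<^bold>\<in> A \<longleftrightarrow> x \<^bold>\<in> B) \<Longrightarrow> A = B"
proof -
  assume "\<And>x. x \<^bold>\<in> A \<longleftrightarrow> x \<^bold>\<in> B"
  moreover have Extensionality using ZF by (simp add: ZF_def)
  ultimately show "A = B" unfolding Extensionality_def by blast
qed

lemma collect_eqI: "(\<And>x. x \<^bold>\<in> z \<longleftrightarrow> P x) \<Longrightarrow> collect P = z"
  unfolding collect_def by (rule the_equality, simp, rule set_eqI, simp)

lemma mem_collect: "\<exists>z. \<forall>x. x \<^bold>\<in> z \<longleftrightarrow> P x \<Longrightarrow> x \<^bold>\<in> collect P \<longleftrightarrow> P x"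
proof -
  assume "\<exists>z. \<forall>x. x \<^bold>\<in> z \<longleftrightarrow> P x"
  then obtain z where z: "\<And>x. x \<^bold>\<in> z \<longleftrightarrow> P x" by blast
  then have "collect P = z" by (rule collect_eqI)
  with z show ?thesis by simp
qed

lemma separation:
  assumes "defpred P" shows "\<exists>B. \<forall>x. x \<^bold>\<in> B \<longleftrightarrow> x \<^bold>\<in> A \<and> P x"
proof -
  obtain \<phi> r where *: "\<And>e. P (e 0) = sat (slot r e) \<phi>"
    using assms by (auto simp: defpred_def definable_def)
  define \<rho> where "\<rho> n = (if r n = Inl 0 then 0 else Suc n)" for n
  \<comment> \<open>\<open>P\<close> looks at position 0 only, so the other positions of the
    environment may hold anything.\<close>
  define c :: "nat \<Rightarrow> 'v" where "c = (\<lambda>_. undefined)"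
  define q where "q n = (case n of 0 \<Rightarrow> undefined | Suc k \<Rightarrow> slot r c k)" for n
  obtain \<psi> where \<psi>: "\<And>e. sat e \<psi> = sat (\<lambda>n. e (\<rho> n)) \<phi>" using sat_rename by blast
  have "(\<lambda>n. (q(0 := x)) (\<rho> n)) = slot r (case_nat x c)" for x
    by (auto simp: slot_def \<rho>_def q_def c_def fun_eq_iff split: sum.splits nat.splits)
  then have "P x = sat (q(0 := x)) \<psi>" for x
    using *[of "case_nat x c"] \<psi> by simp
  then show ?thesis
    using ZF unfolding ZF_def Separation_def by simp
qed

lemma replacement:
  assumes "definable (\<lambda>e. R (e 0) (e 1))" "\<And>x. x \<^bold>\<in> A \<Longrightarrow> \<exists>!y. R x y"
  shows "\<exists>B. \<forall>y. y \<^bold>\<in> B \<longleftrightarrow> (\<exists>x. x \<^bold>\<in> A \<and> R x y)"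
proof -
  obtain \<phi> r where *: "\<And>e. R (e 0) (e 1) = sat (slot r e) \<phi>"
    using assms(1) by (auto simp: definable_def)
  define \<rho> where "\<rho> n = (if r n = Inl 0 then 0 else if r n = Inl 1 then 1 else n + 2)" for n
  define c :: "nat \<Rightarrow> 'v" where "c = (\<lambda>_. undefined)"
  define q where "q n = slot r c (n - 2)" for n
  obtain \<psi> where \<psi>: "\<And>e. sat e \<psi> = sat (\<lambda>n. e (\<rho> n)) \<phi>" using sat_rename by blast
  have "(\<lambda>n. (q(0 := x, 1 := y)) (\<rho> n)) = slot r (case_nat x (case_nat y c))" for x y
    by (auto simp: slot_def \<rho>_def q_def c_def fun_eq_iff split: sum.splits nat.splits)
  then have **: "R x y = sat (q(0 := x, 1 := y)) \<psi>" for x y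
    using *[of "case_nat x (case_nat y c)"] \<psi> by simp
  show ?thesis
    using ZF assms(2) unfolding ZF_def Replacement_def ** by blast
qed

text \<open>The usual way to justify a set: a definable property that is bounded by some set makes
  \<open>collect\<close> meaningful.\<close>

lemma mem_collect_sub:
  assumes "defpred P" "\<And>x. P x \<Longrightarrow> x \<^bold>\<in> A" shows "x \<^bold>\<in> collect P \<longleftrightarrow> P x"
  using separation[OF assms(1), of A] assms(2) by (intro mem_collect) blast

text \<open>Existence is demanded in every environment because \<open>collect\<close> is a definite
  description: where there is no such set, its value need not be given by any formula.\<close>

lemma defterm_collect:
  assumes "definable (\<lambda>e. P (e 0) (\<lambda>n. e (Suc n)))" "\<And>e. \<exists>z. \<forall>x. x \<^bold>\<in> z \<longleftrightarrow> P x e"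
  shows "defterm (\<lambda>e. collect (\<lambda>x. P x e))"
proof -
  have 1: "definable (\<lambda>e. \<forall>x. (x \<^bold>\<in> e 0 \<longrightarrow> P x (\<lambda>n. e (Suc n))) \<and> (P x (\<lambda>n. e (Suc n)) \<longrightarrow> x \<^bold>\<in> e 0))"
    using definable_rename[OF assms(1), of "case_nat 0 (\<lambda>n. Suc (Suc n))"]
    by (intro definable_intros) auto
  have 2: "(\<lambda>e. e 0 = collect (\<lambda>x. P x (\<lambda>n. e (Suc n)))) =
      (\<lambda>e. \<forall>x. (x \<^bold>\<in> e 0 \<longrightarrow> P x (\<lambda>n. e (Suc n))) \<and> (P x (\<lambda>n. e (Suc n)) \<longrightarrow> x \<^bold>\<in> e 0))"
  proof (rule ext)
    fix e
    let ?c = "collect (\<lambda>x. P x (\<lambda>n. e (Suc n)))"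
    have c: "x \<^bold>\<in> ?c \<longleftrightarrow> P x (\<lambda>n. e (Suc n))" for x
      by (rule mem_collect[of "\<lambda>x. P x (\<lambda>n. e (Suc n))", OF assms(2)[of "\<lambda>n. e (Suc n)"]])
    have "e 0 = ?c \<longleftrightarrow> (\<forall>x. x \<^bold>\<in> e 0 \<longleftrightarrow> x \<^bold>\<in> ?c)"
      using set_eqI[of "e 0" ?c] by metis
    then show "e 0 = ?c \<longleftrightarrow>
      (\<forall>x. (x \<^bold>\<in> e 0 \<longrightarrow> P x (\<lambda>n. e (Suc n))) \<and> (P x (\<lambda>n. e (Suc n)) \<longrightarrow> x \<^bold>\<in> e 0))"
      unfolding c by blast
  qed
  have 3: "definable (\<lambda>e. e 0 = collect (\<lambda>x. P x (\<lambda>n. e (Suc n))))"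
    by (fact iffD2[OF arg_cong[OF 2, of definable] 1])
  show ?thesis unfolding defterm_def by (fact 3)
qed

lemma ex_upair: "\<exists>C. \<forall>x. x \<^bold>\<in> C \<longleftrightarrow> x = a \<or> x = b"
  using ZF unfolding ZF_def Pairing_def by blast

lemma mem_upair [simp]: "x \<^bold>\<in> upair a b \<longleftrightarrow> x = a \<or> x = b"
  unfolding upair_def by (rule mem_collect[OF ex_upair])

lemma ex_union: "\<exists>C. \<forall>x. x \<^bold>\<in> C \<longleftrightarrow> (\<exists>y. y \<^bold>\<in> A \<and> x \<^bold>\<in> y)"
  using ZF unfolding ZF_def Union_def by blast

lemma ex_power: "\<exists>C. \<forall>x. x \<^bold>\<in> C \<longleftrightarrow> x \<^bold>\<subseteq> A"
  using ZF unfolding ZF_def Powerset_def by blast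

lemma ex_union2: "\<exists>C. \<forall>x. x \<^bold>\<in> C \<longleftrightarrow> x \<^bold>\<in> A \<or> x \<^bold>\<in> B"
  using ex_union[of "upair A B"] by auto

lemma ex_empty: "\<exists>z. \<forall>x. \<not> x \<^bold>\<in> z"
  using ZF unfolding ZF_def Infinity_def by blast

lemma mem_empty [simp]: "\<not> x \<^bold>\<in> \<^bold>0"
  unfolding empty_def using mem_collect[of "\<lambda>x. False" x] ex_empty by simp

lemma opair_eq [simp]: "\<^bold>\<langle>a, b\<^bold>\<rangle> = \<^bold>\<langle>c, d\<^bold>\<rangle> \<longleftrightarrow> a = c \<and> b = d"
proof
  assume *: "\<^bold>\<langle>a, b\<^bold>\<rangle> = \<^bold>\<langle>c, d\<^bold>\<rangle>"
  have m: "x \<^bold>\<in> \<^bold>\<langle>a, b\<^bold>\<rangle> \<longleftrightarrow> x = upair a a \<or> x = upair a b" for x a b by (simp add: opair_def)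
  have "upair a a \<^bold>\<in> \<^bold>\<langle>c, d\<^bold>\<rangle>" "upair a b \<^bold>\<in> \<^bold>\<langle>c, d\<^bold>\<rangle>" "upair c d \<^bold>\<in> \<^bold>\<langle>a, b\<^bold>\<rangle>"
    using * m[of _ a b] m[of _ c d] by auto
  then have "upair a a = upair c c \<or> upair a a = upair c d" "upair a b = upair c c \<or> upair a b = upair c d"
    "upair c d = upair a a \<or> upair c d = upair a b" unfolding m by simp_all
  moreover have "c = a" using calculation(1) by (metis mem_upair)
  moreover have "upair a b = upair a d \<longleftrightarrow> b = d" for a b d by (metis mem_upair)
  ultimately show "a = c \<and> b = d" by metis
qed simp

lemma ex_succ: "\<exists>z. \<forall>x. x \<^bold>\<in> z \<longleftrightarrow> x \<^bold>\<in> n \<or> x = n"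
  using ex_union2[of n "upair n n"] by auto

lemma mem_succ [simp]: "x \<^bold>\<in> succ n \<longleftrightarrow> x \<^bold>\<in> n \<or> x = n"
  unfolding succ_def by (rule mem_collect[OF ex_succ])

lemma defterm_upair [definable_intros]:
  assumes "defterm t" "defterm s" shows "defterm (\<lambda>e. upair (t e) (s e))"
  unfolding upair_def
  by (intro defterm_collect definable_intros defterm_weaken assms ex_upair)

lemma defterm_opair [definable_intros]:
  assumes "defterm t" "defterm s" shows "defterm (\<lambda>e. \<^bold>\<langle>t e, s e\<^bold>\<rangle>)"
  unfolding opair_def by (intro definable_intros assms)

lemma defterm_succ [definable_intros]:
  assumes "defterm t" shows "defterm (\<lambda>e. succ (t e))"
  unfolding succ_def
  by (intro defterm_collect definable_intros defterm_weaken assms ex_succ)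

text \<open>For Kuratowski pairs the witnesses are the pair itself and its member
  \<open>upair x y\<close>.\<close>

lemma upair_in_domain: "\<^bold>\<langle>x, y\<^bold>\<rangle> \<^bold>\<in> F \<Longrightarrow> \<exists>u. u \<^bold>\<in> F \<and> (\<exists>v. v \<^bold>\<in> u \<and> x \<^bold>\<in> v \<and> y \<^bold>\<in> v)"
  by (metis mem_upair opair_def)

text \<open>The twofold union of a set contains all components of its pairs.\<close>

lemma ex_components: "\<exists>C. \<forall>x y. \<^bold>\<langle>x, y\<^bold>\<rangle> \<^bold>\<in> F \<longrightarrow> x \<^bold>\<in> C \<and> y \<^bold>\<in> C"
proof -
  obtain C where C: "\<forall>x. x \<^bold>\<in> C \<longleftrightarrow> (\<exists>y. y \<^bold>\<in> F \<and> x \<^bold>\<in> y)" using ex_union by blast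
  obtain D where D: "\<forall>x. x \<^bold>\<in> D \<longleftrightarrow> (\<exists>y. y \<^bold>\<in> C \<and> x \<^bold>\<in> y)" using ex_union by blast
  have "x \<^bold>\<in> D \<and> y \<^bold>\<in> D" if "\<^bold>\<langle>x, y\<^bold>\<rangle> \<^bold>\<in> F" for x y
    using upair_in_domain[OF that] C D by blast
  then show ?thesis by blast
qed

lemma ex_app: "\<exists>z. \<forall>u. u \<^bold>\<in> z \<longleftrightarrow> (\<exists>y. \<^bold>\<langle>x, y\<^bold>\<rangle> \<^bold>\<in> F \<and> u \<^bold>\<in> y)"
proof -
  obtain C where C: "\<And>x y. \<^bold>\<langle>x, y\<^bold>\<rangle> \<^bold>\<in> F \<Longrightarrow> x \<^bold>\<in> C \<and> y \<^bold>\<in> C" using ex_components[of F] by blast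
  obtain D where D: "\<forall>x. x \<^bold>\<in> D \<longleftrightarrow> (\<exists>y. y \<^bold>\<in> C \<and> x \<^bold>\<in> y)" using ex_union by blast
  have "defpred (\<lambda>u. \<exists>y. \<^bold>\<langle>x, y\<^bold>\<rangle> \<^bold>\<in> F \<and> u \<^bold>\<in> y)"
    unfolding defpred_def by (intro definable_intros)
  then obtain z where z: "\<And>u. u \<^bold>\<in> z \<longleftrightarrow> u \<^bold>\<in> D \<and> (\<exists>y. \<^bold>\<langle>x, y\<^bold>\<rangle> \<^bold>\<in> F \<and> u \<^bold>\<in> y)"
    using separation[of _ D] by blast
  have "u \<^bold>\<in> D" if "\<^bold>\<langle>x, y\<^bold>\<rangle> \<^bold>\<in> F" "u \<^bold>\<in> y" for u y
    using C[OF that(1)] that(2) D by blast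
  then show ?thesis using z by blast
qed

lemma mem_app: "u \<^bold>\<in> F \<^bold>\<cdot> x \<longleftrightarrow> (\<exists>y. \<^bold>\<langle>x, y\<^bold>\<rangle> \<^bold>\<in> F \<and> u \<^bold>\<in> y)"
  unfolding app_def by (rule mem_collect[OF ex_app])

lemma defterm_app [definable_intros]:
  assumes "defterm t" "defterm s" shows "defterm (\<lambda>e. t e \<^bold>\<cdot> s e)"
proof -
  have "defterm (\<lambda>e. e 0 \<^bold>\<cdot> e 1)"
    unfolding app_def by (intro defterm_collect definable_intros ex_app)
  then have "defop2 (\<lambda>F x. F \<^bold>\<cdot> x)" by (rule defop2I[of "\<lambda>F x. F \<^bold>\<cdot> x"])
  then show ?thesis using assms by (rule defterm_defop2)
qed


text \<open>Freezing: a predicate that is definable jointly with its environment stays definable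
  when chosen positions are turned into parameters.\<close>

lemma definable_slot: "definable P \<Longrightarrow> definable (\<lambda>e. P (slot \<sigma> e))"
proof -
  assume "definable P"
  then obtain \<phi> r where *: "\<And>e. P e = sat (slot r e) \<phi>" by (auto simp: definable_def)
  have "slot r (slot \<sigma> e) = slot (\<lambda>n. case r n of Inl i \<Rightarrow> \<sigma> i | Inr a \<Rightarrow> Inr a) e" for e
    by (auto simp: slot_def fun_eq_iff split: sum.splits)
  with * show ?thesis unfolding definable_def by metis
qed

lemma definable_iff [definable_intros]:
  assumes "definable P" "definable Q" shows "definable (\<lambda>e. P e \<longleftrightarrow> Q e)"
proof -
  have "definable (\<lambda>e. (P e \<longrightarrow> Q e) \<and> (Q e \<longrightarrow> P e))" by (intro definable_intros assms)
  then show ?thesis unfolding iff_conv_conj_imp .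
qed

definition defpred2 :: "('v \<Rightarrow> 'v \<Rightarrow> bool) \<Rightarrow> bool" where
  "defpred2 R \<longleftrightarrow> definable (\<lambda>e. R (e 0) (e 1))"

lemma definable_defpred2:
  assumes "defpred2 R" "defterm t" "defterm s" shows "definable (\<lambda>e. R (t e) (s e))"
proof -
  have "definable (\<lambda>e. R (e (Suc 0)) (e 0))"
    using definable_rename[of _ "\<lambda>n. 1 - n", OF assms(1)[unfolded defpred2_def]] by simp
  from definable_subst[OF _ defterm_weaken[OF assms(3)], of "\<lambda>y e. R (e 0) y", OF this]
  have "definable (\<lambda>e. R (e 0) (s (\<lambda>n. e (Suc n))))" by simp
  from definable_subst[OF _ assms(2), of "\<lambda>y e. R y (s e)", OF this]
  show ?thesis .
qed

text \<open>\<open>fun_of\<close> forms one set for each environment, so the environment becomes a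
  block of parameters and only the value and the argument stay variable.\<close>

lemma defop_fix: "defterm (\<lambda>e. t (e 0) (\<lambda>n. e (Suc n))) \<Longrightarrow> defop (\<lambda>x. t x e)"
  unfolding defterm_def defop_def
  by (drule definable_slot[of _ "\<lambda>n. case n of 0 \<Rightarrow> Inl 0 | Suc 0 \<Rightarrow> Inl 1 | Suc (Suc k) \<Rightarrow> Inr (e k)"])
    (simp add: slot_def)

subsection \<open>Products and functions\<close>

definition powerset :: "'v \<Rightarrow> 'v" where
  "powerset A = collect (\<lambda>x. x \<^bold>\<subseteq> A)"

definition cart :: "'v \<Rightarrow> 'v \<Rightarrow> 'v" where
  "cart A B = collect (\<lambda>z. \<exists>x y. x \<^bold>\<in> A \<and> y \<^bold>\<in> B \<and> z = \<^bold>\<langle>x, y\<^bold>\<rangle>)"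

lemma mem_powerset: "x \<^bold>\<in> powerset A \<longleftrightarrow> x \<^bold>\<subseteq> A"
  unfolding powerset_def by (rule mem_collect[OF ex_power])

lemma mem_cart: "z \<^bold>\<in> cart A B \<longleftrightarrow> (\<exists>x y. x \<^bold>\<in> A \<and> y \<^bold>\<in> B \<and> z = \<^bold>\<langle>x, y\<^bold>\<rangle>)"
proof -
  obtain U where U: "\<And>x. x \<^bold>\<in> U \<longleftrightarrow> x \<^bold>\<in> A \<or> x \<^bold>\<in> B" using ex_union2[of A B] by blast
  have d: "defpred (\<lambda>z. \<exists>x y. x \<^bold>\<in> A \<and> y \<^bold>\<in> B \<and> z = \<^bold>\<langle>x, y\<^bold>\<rangle>)"
    unfolding defpred_def by (intro definable_intros)
  show ?thesis unfolding cart_def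
    by (rule mem_collect_sub[OF d, of "powerset (powerset U)"])
      (auto simp: mem_powerset subset_def opair_def U)
qed

lemma func_app: "func F \<Longrightarrow> \<^bold>\<langle>x, y\<^bold>\<rangle> \<^bold>\<in> F \<Longrightarrow> F \<^bold>\<cdot> x = y"
  by (rule set_eqI) (auto simp: mem_app func_def)

lemma maps_opair_iff: "maps F A B \<Longrightarrow> \<^bold>\<langle>x, y\<^bold>\<rangle> \<^bold>\<in> F \<longleftrightarrow> x \<^bold>\<in> A \<and> y = F \<^bold>\<cdot> x"
  unfolding maps_def in_dom_def by (metis func_app)

lemma maps_app: "maps F A B \<Longrightarrow> x \<^bold>\<in> A \<Longrightarrow> F \<^bold>\<cdot> x \<^bold>\<in> B"
  using maps_opair_iff[of F A B] unfolding maps_def by blast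

lemma maps_mem_iff: "maps F A B \<Longrightarrow> z \<^bold>\<in> F \<longleftrightarrow> (\<exists>x. x \<^bold>\<in> A \<and> z = \<^bold>\<langle>x, F \<^bold>\<cdot> x\<^bold>\<rangle>)"
  using maps_opair_iff[of F A B] unfolding maps_def func_def by metis

lemma maps_ext:
  assumes "maps F A B" "maps G A C" "\<And>x. x \<^bold>\<in> A \<Longrightarrow> F \<^bold>\<cdot> x = G \<^bold>\<cdot> x" shows "F = G"
proof (rule set_eqI)
  fix z
  show "z \<^bold>\<in> F \<longleftrightarrow> z \<^bold>\<in> G"
    unfolding maps_mem_iff[OF assms(1)] maps_mem_iff[OF assms(2)] using assms(3) by metis
qed

lemma maps_subset_cart: "maps F A B \<Longrightarrow> F \<^bold>\<subseteq> cart A B"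
proof -
  assume F: "maps F A B"
  have "\<exists>x y. x \<^bold>\<in> A \<and> y \<^bold>\<in> B \<and> z = \<^bold>\<langle>x, y\<^bold>\<rangle>" if "z \<^bold>\<in> F" for z
    using that maps_app[OF F] unfolding maps_mem_iff[OF F] by blast
  then show ?thesis unfolding subset_def mem_cart by blast
qed

definition fun_of :: "'v \<Rightarrow> ('v \<Rightarrow> 'v) \<Rightarrow> 'v" where
  "fun_of A t = collect (\<lambda>z. \<exists>x. x \<^bold>\<in> A \<and> z = \<^bold>\<langle>x, t x\<^bold>\<rangle>)"

text \<open>Replacement needs no bound on the values, which is why \<open>fun_of\<close> takes no
  codomain.\<close>

lemma ex_image: "defop t \<Longrightarrow> \<exists>B. \<forall>y. y \<^bold>\<in> B \<longleftrightarrow> (\<exists>x. x \<^bold>\<in> A \<and> y = t x)"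
proof (rule replacement)
  assume d: "defop t"
  show "definable (\<lambda>e. e 1 = t (e 0))" by (intro definable_intros defterm_defop[OF d])
qed auto

lemma ex_fun_of: "defop t \<Longrightarrow> \<exists>B. \<forall>z. z \<^bold>\<in> B \<longleftrightarrow> (\<exists>x. x \<^bold>\<in> A \<and> z = \<^bold>\<langle>x, t x\<^bold>\<rangle>)"
proof (rule ex_image)
  assume d: "defop t"
  show "defop (\<lambda>x. \<^bold>\<langle>x, t x\<^bold>\<rangle>)"
    by (rule defopI) (intro definable_intros defterm_defop[OF d])
qed

lemma mem_fun_of: "defop t \<Longrightarrow> z \<^bold>\<in> fun_of A t \<longleftrightarrow> (\<exists>x. x \<^bold>\<in> A \<and> z = \<^bold>\<langle>x, t x\<^bold>\<rangle>)"
  unfolding fun_of_def by (rule mem_collect[OF ex_fun_of])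

lemma func_fun_of: "defop t \<Longrightarrow> func (fun_of A t)"
  unfolding func_def by (auto simp: mem_fun_of)

lemma fun_of_app: "defop t \<Longrightarrow> x \<^bold>\<in> A \<Longrightarrow> fun_of A t \<^bold>\<cdot> x = t x"
  by (rule func_app[OF func_fun_of]) (auto simp: mem_fun_of)

lemma maps_fun_of: "defop t \<Longrightarrow> (\<And>x. x \<^bold>\<in> A \<Longrightarrow> t x \<^bold>\<in> B) \<Longrightarrow> maps (fun_of A t) A B"
  unfolding maps_def in_dom_def by (auto simp: func_fun_of mem_fun_of)

lemma defterm_fun_of [definable_intros]:
  assumes "defterm a" "defterm (\<lambda>e. t (e 0) (\<lambda>n. e (Suc n)))"
  shows "defterm (\<lambda>e. fun_of (a e) (\<lambda>x. t x e))"
proof -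
  \<comment> \<open>Inside the set comprehension the element of the graph is a further variable
    between the argument and the environment, so \<open>t\<close> must skip one position.\<close>
  have "defterm (\<lambda>e. t (e 0) (\<lambda>n. e (Suc (Suc n))))"
    using assms(2) unfolding defterm_def
    by (drule_tac definable_rename[of _ "case_nat 0 (case_nat 1 (\<lambda>n. Suc (Suc (Suc n))))"]) simp
  then show ?thesis
    unfolding fun_of_def
    by (intro defterm_collect definable_intros ex_fun_of defop_fix assms
      defterm_weaken[OF defterm_weaken[OF assms(1)]])
qed

lemma mem_restr: "z \<^bold>\<in> p \<^bold>\<restriction> n \<longleftrightarrow> z \<^bold>\<in> p \<and> (\<exists>k y. k \<^bold>\<in> n \<and> z = \<^bold>\<langle>k, y\<^bold>\<rangle>)"
  unfolding restr_def
  by (rule mem_collect, rule separation) (unfold defpred_def, intro definable_intros)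

lemma defterm_restr [definable_intros]:
  assumes "defterm t" "defterm s" shows "defterm (\<lambda>e. t e \<^bold>\<restriction> s e)"
proof -
  have "\<exists>B. \<forall>z. z \<^bold>\<in> B \<longleftrightarrow> z \<^bold>\<in> p \<and> (\<exists>k y. k \<^bold>\<in> n \<and> z = \<^bold>\<langle>k, y\<^bold>\<rangle>)" for p n
    by (rule separation) (unfold defpred_def, intro definable_intros)
  then have "defterm (\<lambda>e. e 0 \<^bold>\<restriction> e 1)"
    unfolding restr_def by (intro defterm_collect definable_intros)
  then have "defop2 (\<lambda>p n. p \<^bold>\<restriction> n)" by (rule defop2I[of "\<lambda>F x. F \<^bold>\<restriction> x"])
  then show ?thesis using assms by (rule defterm_defop2)
qed

lemmas def_unfolds = subset_def func_def in_dom_def maps_def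

subsection \<open>Natural numbers\<close>

lemma mem_omega: "n \<^bold>\<in> \<omega> \<longleftrightarrow> (\<forall>I. \<^bold>0 \<^bold>\<in> I \<and> (\<forall>x. x \<^bold>\<in> I \<longrightarrow> succ x \<^bold>\<in> I) \<longrightarrow> n \<^bold>\<in> I)"
proof -
  obtain I z where I: "z \<^bold>\<in> I" "\<And>x. \<not> x \<^bold>\<in> z"
    "\<And>x. x \<^bold>\<in> I \<Longrightarrow> \<exists>y. y \<^bold>\<in> I \<and> (\<forall>u. u \<^bold>\<in> y \<longleftrightarrow> u \<^bold>\<in> x \<or> u = x)"
    using ZF unfolding ZF_def Infinity_def by blast
  have "z = \<^bold>0" by (rule set_eqI) (simp add: I(2))
  moreover have "succ x \<^bold>\<in> I" if x: "x \<^bold>\<in> I" for x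
  proof -
    obtain y where y: "y \<^bold>\<in> I" "\<forall>u. u \<^bold>\<in> y \<longleftrightarrow> u \<^bold>\<in> x \<or> u = x" using I(3)[OF x] by blast
    have "y = succ x" by (rule set_eqI) (simp add: y(2))
    with y(1) show ?thesis by simp
  qed
  ultimately have I: "\<^bold>0 \<^bold>\<in> I \<and> (\<forall>x. x \<^bold>\<in> I \<longrightarrow> succ x \<^bold>\<in> I)" using I(1) by blast
  have d: "defpred (\<lambda>n. \<forall>I. \<^bold>0 \<^bold>\<in> I \<and> (\<forall>x. x \<^bold>\<in> I \<longrightarrow> succ x \<^bold>\<in> I) \<longrightarrow> n \<^bold>\<in> I)"
    unfolding defpred_def by (intro definable_intros)
  show ?thesis unfolding omega_def
    by (rule mem_collect_sub[OF d, of I]) (use I in blast)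
qed

lemma zero_omega [simp]: "\<^bold>0 \<^bold>\<in> \<omega>"
  using mem_omega by blast

lemma succ_omega [simp]: "n \<^bold>\<in> \<omega> \<Longrightarrow> succ n \<^bold>\<in> \<omega>"
  unfolding mem_omega by blast

text \<open>The naturals of the structure may be nonstandard, so only definable properties can be
  induced on. Definability is a case of its own in every such proof.\<close>

lemma omega_induct [consumes 1, case_names zero succ[hyps IH] definable]:
  assumes "n \<^bold>\<in> \<omega>" "P \<^bold>0" "\<And>k. k \<^bold>\<in> \<omega> \<Longrightarrow> P k \<Longrightarrow> P (succ k)" "defpred P"
  shows "P n"
proof -
  obtain B where B: "\<And>x. x \<^bold>\<in> B \<longleftrightarrow> x \<^bold>\<in> \<omega> \<and> P x" using separation[OF assms(4), of \<omega>] by blast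
  have "\<^bold>0 \<^bold>\<in> B" "\<forall>x. x \<^bold>\<in> B \<longrightarrow> succ x \<^bold>\<in> B" using assms(2,3) B by auto
  with assms(1) have "n \<^bold>\<in> B" unfolding mem_omega by blast
  with B show ?thesis by blast
qed

lemma omega_mem: "n \<^bold>\<in> \<omega> \<Longrightarrow> k \<^bold>\<in> n \<Longrightarrow> k \<^bold>\<in> \<omega>"
proof -
  assume "n \<^bold>\<in> \<omega>"
  then have "\<forall>k. k \<^bold>\<in> n \<longrightarrow> k \<^bold>\<in> \<omega>"
    by (induction rule: omega_induct) (auto simp: defpred_def intro!: definable_intros)
  then show "k \<^bold>\<in> n \<Longrightarrow> k \<^bold>\<in> \<omega>" by blast
qed

lemma omega_trans: assumes "n \<^bold>\<in> \<omega>" "m \<^bold>\<in> n" "k \<^bold>\<in> m" shows "k \<^bold>\<in> n"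
proof -
  from assms(1) have "\<forall>m k. m \<^bold>\<in> n \<longrightarrow> k \<^bold>\<in> m \<longrightarrow> k \<^bold>\<in> n"
  proof (induction rule: omega_induct)
    case definable
    show ?case unfolding defpred_def by (intro definable_intros)
  qed auto
  with assms show ?thesis by blast
qed

lemma omega_irrefl: "n \<^bold>\<in> \<omega> \<Longrightarrow> \<not> n \<^bold>\<in> n"
proof (induction rule: omega_induct)
  case (succ k)
  then show ?case using omega_trans[of k "succ k" k] by (metis mem_succ)
next
  case definable
  show ?case unfolding defpred_def by (intro definable_intros)
qed simp

lemma omega_asym: "n \<^bold>\<in> \<omega> \<Longrightarrow> m \<^bold>\<in> n \<Longrightarrow> \<not> n \<^bold>\<in> m"
  using omega_trans[of n m n] omega_irrefl by blast

lemma zero_mem_or_zero: "n \<^bold>\<in> \<omega> \<Longrightarrow> \<^bold>0 \<^bold>\<in> n \<or> n = \<^bold>0"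
proof (induction rule: omega_induct)
  case definable
  show ?case unfolding defpred_def by (intro definable_intros)
qed auto

lemma succ_mem_succ: assumes "n \<^bold>\<in> \<omega>" "k \<^bold>\<in> n" shows "succ k \<^bold>\<in> succ n"
proof -
  from assms(1) have "\<forall>k. k \<^bold>\<in> n \<longrightarrow> succ k \<^bold>\<in> succ n"
  proof (induction rule: omega_induct)
    case definable
    show ?case unfolding defpred_def by (intro definable_intros)
  qed auto
  with assms(2) show ?thesis by blast
qed

lemma omega_linear: assumes "m \<^bold>\<in> \<omega>" "n \<^bold>\<in> \<omega>" shows "m \<^bold>\<in> n \<or> m = n \<or> n \<^bold>\<in> m"
  using assms(2)
proof (induction rule: omega_induct)
  case zero
  then show ?case using zero_mem_or_zero[OF assms(1)] by blast
next
  case (succ k)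
  then show ?case using succ_mem_succ[OF assms(1), of k] unfolding mem_succ by blast
next
  case definable
  show ?case unfolding defpred_def by (intro definable_intros)
qed

lemma not_mem_iff: "m \<^bold>\<in> \<omega> \<Longrightarrow> n \<^bold>\<in> \<omega> \<Longrightarrow> \<not> n \<^bold>\<in> m \<longleftrightarrow> m \<^bold>\<in> succ n"
  using omega_linear[of m n] omega_asym[of n m] omega_irrefl[of m] unfolding mem_succ by blast

lemma succ_mem_iff: "n \<^bold>\<in> \<omega> \<Longrightarrow> k \<^bold>\<in> \<omega> \<Longrightarrow> succ k \<^bold>\<in> succ n \<longleftrightarrow> k \<^bold>\<in> n"
  using succ_mem_succ[of n k] omega_trans[of n "succ k" k] mem_succ[of k k] mem_succ[of "succ k" n] by metis

lemma succ_inject: "m \<^bold>\<in> \<omega> \<Longrightarrow> n \<^bold>\<in> \<omega> \<Longrightarrow> succ m = succ n \<longleftrightarrow> m = n"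
  by (metis mem_succ omega_asym)

lemma succ_not_zero [simp]: "succ n \<noteq> \<^bold>0" "\<^bold>0 \<noteq> succ n"
  by (metis mem_succ mem_empty)+

lemma omega_cases: assumes "n \<^bold>\<in> \<omega>" obtains "n = \<^bold>0" | k where "k \<^bold>\<in> \<omega>" "n = succ k"
proof -
  from assms have "n = \<^bold>0 \<or> (\<exists>k. k \<^bold>\<in> \<omega> \<and> n = succ k)"
  proof (induction rule: omega_induct)
    case definable
    show ?case unfolding defpred_def by (intro definable_intros)
  qed auto
  then show ?thesis using that by blast
qed

lemma omega_max: assumes "m \<^bold>\<in> \<omega>" "n \<^bold>\<in> \<omega>"
  obtains k where "k \<^bold>\<in> \<omega>" "m \<^bold>\<in> succ k" "n \<^bold>\<in> succ k"
  using omega_linear[OF assms] assms that by (metis mem_succ)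

lemma le_trans: "n \<^bold>\<in> \<omega> \<Longrightarrow> k \<^bold>\<in> succ m \<Longrightarrow> m \<^bold>\<in> succ n \<Longrightarrow> k \<^bold>\<in> succ n"
  using omega_trans[of n m k] unfolding mem_succ by blast

lemma less_le_trans: "n \<^bold>\<in> \<omega> \<Longrightarrow> k \<^bold>\<in> m \<Longrightarrow> m \<^bold>\<in> succ n \<Longrightarrow> k \<^bold>\<in> n"
  using omega_trans[of n m k] unfolding mem_succ by blast

lemma omega_least:
  assumes "defpred P" "n \<^bold>\<in> \<omega>" "P n"
  obtains m where "m \<^bold>\<in> \<omega>" "P m" "\<And>k. k \<^bold>\<in> m \<Longrightarrow> \<not> P k"
proof -
  obtain B where B: "\<And>x. x \<^bold>\<in> B \<longleftrightarrow> x \<^bold>\<in> \<omega> \<and> P x" using separation[OF assms(1), of \<omega>] by blast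
  \<comment> \<open>Membership is the order on the naturals, so Foundation applied to the set of
    naturals with \<open>P\<close> yields a least one.\<close>
  have "n \<^bold>\<in> B" using assms B by blast
  moreover have Foundation using ZF unfolding ZF_def by blast
  ultimately obtain m where "m \<^bold>\<in> B" "\<And>y. y \<^bold>\<in> m \<Longrightarrow> \<not> y \<^bold>\<in> B" unfolding Foundation_def by blast
  then show ?thesis using that[of m] B omega_mem by blast
qed

text \<open>Finite maxima inside the structure: \<open>n\<close> may be nonstandard, so HOL finite
  sets are of no help. The lemma merges the moduli of all steps of one oracle computation into a
  single prefix length.\<close>

lemma omega_bounding:
  assumes d: "defpred2 R" and n: "n \<^bold>\<in> \<omega>" and ex: "\<And>j. j \<^bold>\<in> n \<Longrightarrow> \<exists>m. m \<^bold>\<in> \<omega> \<and> R j m"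
    and mono: "\<And>j m m'. R j m \<Longrightarrow> m \<^bold>\<in> \<omega> \<Longrightarrow> m' \<^bold>\<in> \<omega> \<Longrightarrow> m \<^bold>\<in> succ m' \<Longrightarrow> R j m'"
  obtains M where "M \<^bold>\<in> \<omega>" "\<And>j. j \<^bold>\<in> n \<Longrightarrow> R j M"
proof -
  from n have "(\<forall>j. j \<^bold>\<in> n \<longrightarrow> (\<exists>m. m \<^bold>\<in> \<omega> \<and> R j m)) \<longrightarrow> (\<exists>M. M \<^bold>\<in> \<omega> \<and> (\<forall>j. j \<^bold>\<in> n \<longrightarrow> R j M))"
  proof (induction rule: omega_induct)
    case zero
    then show ?case using zero_omega mem_empty by blast
  next
    case (succ k)
    show ?case
    proof
      assume *: "\<forall>j. j \<^bold>\<in> succ k \<longrightarrow> (\<exists>m. m \<^bold>\<in> \<omega> \<and> R j m)"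
      then obtain M m where M: "M \<^bold>\<in> \<omega>" "\<forall>j. j \<^bold>\<in> k \<longrightarrow> R j M" "m \<^bold>\<in> \<omega>" "R k m"
        using succ.IH mem_succ by metis
      obtain K where K: "K \<^bold>\<in> \<omega>" "M \<^bold>\<in> succ K" "m \<^bold>\<in> succ K" using omega_max M by metis
      have "R j K" if "j \<^bold>\<in> succ k" for j
      proof (cases "j = k")
        case True
        then show ?thesis using mono[OF M(4) M(3) K(1,3)] by simp
      next
        case False
        then have "R j M" using M(2) that by simp
        then show ?thesis using mono M(1) K by blast
      qed
      with K(1) show "\<exists>M. M \<^bold>\<in> \<omega> \<and> (\<forall>j. j \<^bold>\<in> succ k \<longrightarrow> R j M)" by blast
    qed
  next
    case definable
    show ?case unfolding defpred_def by (intro definable_intros definable_defpred2[OF d])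
  qed
  with ex that show ?thesis by blast
qed

subsection \<open>Baire space\<close>

lemma mem_baire: "p \<^bold>\<in> \<N> \<longleftrightarrow> maps p \<omega> \<omega>"
  unfolding baire_def
proof (rule mem_collect_sub[where A = "powerset (cart \<omega> \<omega>)"])
  show "defpred (\<lambda>p. maps p \<omega> \<omega>)"
    unfolding defpred_def def_unfolds by (intro definable_intros)
qed (simp add: mem_powerset maps_subset_cart)

lemma mem_finseqs: "s \<^bold>\<in> finseqs \<longleftrightarrow> (\<exists>n. n \<^bold>\<in> \<omega> \<and> maps s n \<omega>)"
  unfolding finseqs_def
proof (rule mem_collect_sub[where A = "powerset (cart \<omega> \<omega>)"])
  show "defpred (\<lambda>s. \<exists>n. n \<^bold>\<in> \<omega> \<and> maps s n \<omega>)"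
    unfolding defpred_def def_unfolds by (intro definable_intros)
  fix s assume "\<exists>n. n \<^bold>\<in> \<omega> \<and> maps s n \<omega>"
  then obtain n where "n \<^bold>\<in> \<omega>" "s \<^bold>\<subseteq> cart n \<omega>" using maps_subset_cart by blast
  then show "s \<^bold>\<in> powerset (cart \<omega> \<omega>)" unfolding mem_powerset subset_def mem_cart using omega_mem by blast
qed

lemma baire_app [simp]: "p \<^bold>\<in> \<N> \<Longrightarrow> n \<^bold>\<in> \<omega> \<Longrightarrow> p \<^bold>\<cdot> n \<^bold>\<in> \<omega>"
  using maps_app by (simp add: mem_baire)

lemma baire_ext: "p \<^bold>\<in> \<N> \<Longrightarrow> q \<^bold>\<in> \<N> \<Longrightarrow> (\<And>n. n \<^bold>\<in> \<omega> \<Longrightarrow> p \<^bold>\<cdot> n = q \<^bold>\<cdot> n) \<Longrightarrow> p = q"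
  using maps_ext by (simp add: mem_baire)

lemma baire_fun_of: "defop t \<Longrightarrow> (\<And>n. n \<^bold>\<in> \<omega> \<Longrightarrow> t n \<^bold>\<in> \<omega>) \<Longrightarrow> fun_of \<omega> t \<^bold>\<in> \<N>"
  unfolding mem_baire by (rule maps_fun_of)

text \<open>Equality of prefixes expressed through values, without forming the restrictions;
  \<open>restr_eq_iff\<close> leads back to the notion in which continuity is defined.\<close>

definition agree :: "'v \<Rightarrow> 'v \<Rightarrow> 'v \<Rightarrow> bool" where
  "agree n p q \<longleftrightarrow> (\<forall>k. k \<^bold>\<in> n \<longrightarrow> p \<^bold>\<cdot> k = q \<^bold>\<cdot> k)"

lemma agree_refl [simp]: "agree n p p"
  by (simp add: agree_def)

lemma agree_sym: "agree n p q \<Longrightarrow> agree n q p"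
  by (simp add: agree_def)

lemma agree_trans: "agree n p q \<Longrightarrow> agree n q r \<Longrightarrow> agree n p r"
  by (simp add: agree_def)

lemma agree_mono: "m \<^bold>\<in> \<omega> \<Longrightarrow> n \<^bold>\<in> succ m \<Longrightarrow> agree m p q \<Longrightarrow> agree n p q"
  unfolding agree_def using less_le_trans by blast

lemma maps_restr:
  assumes "p \<^bold>\<in> \<N>" "n \<^bold>\<in> \<omega>" shows "maps (p \<^bold>\<restriction> n) n \<omega>" "k \<^bold>\<in> n \<Longrightarrow> (p \<^bold>\<restriction> n) \<^bold>\<cdot> k = p \<^bold>\<cdot> k"
proof -
  have p: "maps p \<omega> \<omega>" using assms(1) by (simp add: mem_baire)
  have *: "\<^bold>\<langle>k, y\<^bold>\<rangle> \<^bold>\<in> p \<^bold>\<restriction> n \<longleftrightarrow> k \<^bold>\<in> n \<and> y = p \<^bold>\<cdot> k" for k y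
    using omega_mem[OF assms(2)] by (auto simp: mem_restr maps_opair_iff[OF p])
  show r: "maps (p \<^bold>\<restriction> n) n \<omega>"
    unfolding maps_def func_def in_dom_def *
    using maps_app[OF p] omega_mem[OF assms(2)] by (auto simp: mem_restr)
  show "(p \<^bold>\<restriction> n) \<^bold>\<cdot> k = p \<^bold>\<cdot> k" if "k \<^bold>\<in> n"
    by (rule func_app) (use r that in \<open>auto simp: maps_def *\<close>)
qed

lemma restr_finseqs: "p \<^bold>\<in> \<N> \<Longrightarrow> n \<^bold>\<in> \<omega> \<Longrightarrow> p \<^bold>\<restriction> n \<^bold>\<in> finseqs"
  using maps_restr(1) mem_finseqs by blast

lemma restr_eq_iff:
  assumes "p \<^bold>\<in> \<N>" "q \<^bold>\<in> \<N>" "n \<^bold>\<in> \<omega>" shows "p \<^bold>\<restriction> n = q \<^bold>\<restriction> n \<longleftrightarrow> agree n p q"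
proof
  assume "p \<^bold>\<restriction> n = q \<^bold>\<restriction> n"
  then show "agree n p q" unfolding agree_def using maps_restr(2) assms by metis
next
  assume "agree n p q"
  then show "p \<^bold>\<restriction> n = q \<^bold>\<restriction> n"
    using maps_ext[OF maps_restr(1)[OF assms(1,3)] maps_restr(1)[OF assms(2,3)]]
      maps_restr(2)[OF assms(1,3)] maps_restr(2)[OF assms(2,3)] by (simp add: agree_def)
qed

lemma definable_agree [definable_intros]:
  assumes "defterm n" "defterm p" "defterm q" shows "definable (\<lambda>e. agree (n e) (p e) (q e))"
  unfolding agree_def by (intro definable_intros defterm_weaken assms)


subsection \<open>Recursion and arithmetic\<close>

text \<open>The relation under the description operator of \<open>nrec\<close>, isolated because it
  is a formula whenever \<open>h\<close> is definable.\<close>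

definition approx :: "'v \<Rightarrow> ('v \<Rightarrow> 'v \<Rightarrow> 'v) \<Rightarrow> 'v \<Rightarrow> 'v \<Rightarrow> bool" where
  "approx a h n s \<longleftrightarrow> func s \<and> (\<forall>k. in_dom k s \<longleftrightarrow> k \<^bold>\<in> succ n) \<and> s \<^bold>\<cdot> \<^bold>0 = a \<and>
     (\<forall>k. k \<^bold>\<in> n \<longrightarrow> s \<^bold>\<cdot> succ k = h k (s \<^bold>\<cdot> k))"

lemma nrec_approx: "nrec a h n = (THE y. \<exists>s. approx a h n s \<and> y = s \<^bold>\<cdot> n)"
  unfolding nrec_def approx_def by (simp only: conj_assoc)

text \<open>Permits exchanging the step operation for a definable one that agrees with it at natural
  indices, as \<open>triangle\<close> requires.\<close>

lemma nrec_cong: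
  assumes "n \<^bold>\<in> \<omega>" "\<And>k x. k \<^bold>\<in> \<omega> \<Longrightarrow> h k x = h' k x" shows "nrec a h n = nrec a h' n"
proof -
  have "approx a h n s \<longleftrightarrow> approx a h' n s" for s
    unfolding approx_def using omega_mem[OF assms(1)] assms(2) by metis
  then show ?thesis unfolding nrec_approx by presburger
qed

text \<open>The two lengths may differ, so the same statement gives well-definedness of
  \<open>nrec\<close> and its recursion equation.\<close>

lemma approx_unique:
  assumes "n \<^bold>\<in> \<omega>" "m \<^bold>\<in> \<omega>" "approx a h n s" "approx a h m t" "k \<^bold>\<in> succ n" "k \<^bold>\<in> succ m"
  shows "s \<^bold>\<cdot> k = t \<^bold>\<cdot> k"
proof -
  have "k \<^bold>\<in> \<omega>" using assms(1,5) omega_mem succ_omega by blast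
  then have "k \<^bold>\<in> succ n \<longrightarrow> k \<^bold>\<in> succ m \<longrightarrow> s \<^bold>\<cdot> k = t \<^bold>\<cdot> k"
  proof (induction rule: omega_induct)
    case zero
    then show ?case using assms(3,4) by (simp add: approx_def)
  next
    case (succ k)
    show ?case
    proof (intro impI)
      assume "succ k \<^bold>\<in> succ n" "succ k \<^bold>\<in> succ m"
      then have "k \<^bold>\<in> n" "k \<^bold>\<in> m" using succ_mem_iff assms(1,2) succ.hyps by blast+
      then show "s \<^bold>\<cdot> succ k = t \<^bold>\<cdot> succ k"
        using succ.IH assms(3,4) by (simp add: approx_def)
    qed
  next
    case definable
    show ?case unfolding defpred_def by (intro definable_intros)
  qed
  with assms show ?thesis by blast
qed

lemma ex_approx:
  assumes d: "defop2 h" and n: "n \<^bold>\<in> \<omega>" shows "\<exists>s. approx a h n s"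
  using n
proof (induction rule: omega_induct)
  case zero
  let ?s = "fun_of (succ \<^bold>0) (\<lambda>_. a)"
  have "defop (\<lambda>_. a)" by (rule defopI) (intro definable_intros)
  then have "approx a h \<^bold>0 ?s"
    using maps_fun_of[of "\<lambda>_. a" "succ \<^bold>0" "upair a a"] fun_of_app[of "\<lambda>_. a" "\<^bold>0" "succ \<^bold>0"]
    by (simp add: approx_def maps_def)
  then show ?case by blast
next
  case (succ k)
  then obtain s where s: "approx a h k s" by blast
  let ?t = "\<lambda>x. if x = succ k then h k (s \<^bold>\<cdot> k) else s \<^bold>\<cdot> x"
  let ?s = "fun_of (succ (succ k)) ?t"
  have t: "defop ?t" by (rule defopI) (intro definable_intros)
  have app: "x \<^bold>\<in> succ (succ k) \<Longrightarrow> ?s \<^bold>\<cdot> x = ?t x" for x by (rule fun_of_app[OF t])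
  have "in_dom x ?s \<longleftrightarrow> x \<^bold>\<in> succ (succ k)" for x
    unfolding in_dom_def mem_fun_of[OF t] opair_eq by blast
  moreover have "?s \<^bold>\<cdot> \<^bold>0 = a"
    using app[of "\<^bold>0"] zero_mem_or_zero[OF succ.hyps] s unfolding approx_def by auto
  moreover have "?s \<^bold>\<cdot> succ j = h j (?s \<^bold>\<cdot> j)" if j: "j \<^bold>\<in> succ k" for j
  proof -
    have jo: "j \<^bold>\<in> \<omega>" using j succ.hyps omega_mem succ_omega by blast
    have 1: "succ j \<^bold>\<in> succ (succ k)" using succ_mem_succ[OF succ_omega[OF succ.hyps] j] .
    have 2: "j \<noteq> succ k" using j omega_irrefl[OF succ_omega[OF succ.hyps]] by blast
    have 3: "j = k \<or> (j \<^bold>\<in> k \<and> succ j \<noteq> succ k)"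
      using j succ_inject[OF jo succ.hyps] omega_irrefl[OF succ.hyps] unfolding mem_succ by blast
    show ?thesis using 3 app[OF 1] app[of j] j 2 s by (auto simp: approx_def)
  qed
  ultimately have "approx a h (succ k) ?s"
    using func_fun_of[OF t] by (simp add: approx_def)
  then show ?case by blast
next
  case definable
  show ?case unfolding defpred_def approx_def def_unfolds
    by (intro definable_intros defterm_defop2[OF d])
qed

lemma nrec_eq:
  assumes "n \<^bold>\<in> \<omega>" "approx a h n s" shows "nrec a h n = s \<^bold>\<cdot> n"
  unfolding nrec_approx
proof (rule the_equality)
  fix y assume "\<exists>s. approx a h n s \<and> y = s \<^bold>\<cdot> n"
  then show "y = s \<^bold>\<cdot> n" using approx_unique[OF assms(1,1) _ assms(2)] mem_succ by blast
qed (use assms in blast)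

lemma nrec_zero: "defop2 h \<Longrightarrow> nrec a h \<^bold>0 = a"
  using ex_approx[of h "\<^bold>0" a] nrec_eq[of "\<^bold>0" a h] by (auto simp: approx_def)

lemma nrec_succ: assumes d: "defop2 h" and n: "n \<^bold>\<in> \<omega>" shows "nrec a h (succ n) = h n (nrec a h n)"
proof -
  obtain s t where s: "approx a h (succ n) s" and t: "approx a h n t"
    using ex_approx[OF d] n succ_omega by metis
  have "s \<^bold>\<cdot> n = t \<^bold>\<cdot> n"
    by (rule approx_unique[OF _ n s t]) (use n in auto)
  then show ?thesis using nrec_eq[OF _ s] nrec_eq[OF n t] n s by (simp add: approx_def)
qed

text \<open>Outside the naturals the recursor is an unspecified value, which need not be definable.\<close>

lemma defop2_nrec:
  assumes d: "defop2 h" shows "defop2 (\<lambda>a n. if n \<^bold>\<in> \<omega> then nrec a h n else \<^bold>0)"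
proof -
  have "y = (if n \<^bold>\<in> \<omega> then nrec a h n else \<^bold>0) \<longleftrightarrow>
      (n \<^bold>\<in> \<omega> \<and> (\<exists>s. approx a h n s \<and> y = s \<^bold>\<cdot> n)) \<or> (\<not> n \<^bold>\<in> \<omega> \<and> y = \<^bold>0)" for y a n
    using ex_approx[OF d, of n a] nrec_eq[of n a h] by auto
  moreover have "definable (\<lambda>e. (e 2 \<^bold>\<in> \<omega> \<and> (\<exists>s. approx (e 1) h (e 2) s \<and> e 0 = s \<^bold>\<cdot> e 2)) \<or>
      (\<not> e 2 \<^bold>\<in> \<omega> \<and> e 0 = \<^bold>0))"
    unfolding approx_def def_unfolds by (intro definable_intros defterm_defop2[OF d])
  ultimately show ?thesis unfolding defop2_def by presburger
qed

text \<open>The default value off the naturals makes addition definable everywhere. As with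
  \<open>trio\<close> and \<open>npairo\<close>, inductions are run on this variant and the result
  is transferred to the official operation.\<close>

definition addo :: "'v \<Rightarrow> 'v \<Rightarrow> 'v" where
  "addo m n = (if n \<^bold>\<in> \<omega> then add m n else \<^bold>0)"

lemma defop2_succ: "defop2 (\<lambda>k x. succ x)"
  by (rule defop2I) (intro definable_intros)

lemma addo_eq [simp]: "n \<^bold>\<in> \<omega> \<Longrightarrow> addo m n = add m n"
  by (simp add: addo_def)

lemma defterm_addo [definable_intros]:
  assumes "defterm t" "defterm s" shows "defterm (\<lambda>e. addo (t e) (s e))"
  unfolding addo_def add_def by (rule defterm_defop2[OF defop2_nrec[OF defop2_succ] assms])

lemma add_zero [simp]: "add m \<^bold>0 = m"
  unfolding add_def by (rule nrec_zero[OF defop2_succ])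

lemma add_succ [simp]: "n \<^bold>\<in> \<omega> \<Longrightarrow> add m (succ n) = succ (add m n)"
  unfolding add_def by (rule nrec_succ[OF defop2_succ])

lemma add_omega [simp]: assumes m: "m \<^bold>\<in> \<omega>" and n: "n \<^bold>\<in> \<omega>" shows "add m n \<^bold>\<in> \<omega>"
proof -
  from n have "addo m n \<^bold>\<in> \<omega>"
  proof (induction rule: omega_induct)
    case definable
    show ?case unfolding defpred_def by (intro definable_intros)
  qed (use m in simp_all)
  with n show ?thesis by simp
qed

lemma add_zero_left [simp]: assumes n: "n \<^bold>\<in> \<omega>" shows "add \<^bold>0 n = n"
proof -
  from n have "addo \<^bold>0 n = n"
  proof (induction rule: omega_induct)
    case definable
    show ?case unfolding defpred_def by (intro definable_intros)
  qed simp_all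
  with n show ?thesis by simp
qed

lemma add_succ_left [simp]: assumes n: "n \<^bold>\<in> \<omega>" shows "add (succ m) n = succ (add m n)"
proof -
  from n have "addo (succ m) n = succ (addo m n)"
  proof (induction rule: omega_induct)
    case definable
    show ?case unfolding defpred_def by (intro definable_intros)
  qed simp_all
  with n show ?thesis by simp
qed

lemma add_commute: assumes m: "m \<^bold>\<in> \<omega>" and n: "n \<^bold>\<in> \<omega>" shows "add m n = add n m"
proof -
  from n have "addo m n = addo n m"
  proof (induction rule: omega_induct)
    case definable
    show ?case unfolding defpred_def by (intro definable_intros)
  qed (use m in simp_all)
  with m n show ?thesis by simp
qed

lemma le_add: assumes m: "m \<^bold>\<in> \<omega>" and n: "n \<^bold>\<in> \<omega>" shows "m \<^bold>\<in> succ (add m n)"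
proof -
  from n have "m \<^bold>\<in> succ (addo m n)"
  proof (induction rule: omega_induct)
    case definable
    show ?case unfolding defpred_def by (intro definable_intros)
  qed auto
  with n show ?thesis by simp
qed

lemma le_add2: "m \<^bold>\<in> \<omega> \<Longrightarrow> n \<^bold>\<in> \<omega> \<Longrightarrow> n \<^bold>\<in> succ (add m n)"
  using le_add[of n m] add_commute[of m n] by simp

lemma add_less: assumes m: "m \<^bold>\<in> \<omega>" and n: "n \<^bold>\<in> \<omega>" and k: "k \<^bold>\<in> n" shows "add m k \<^bold>\<in> add m n"
proof -
  from n have "\<forall>k. k \<^bold>\<in> n \<longrightarrow> addo m k \<^bold>\<in> addo m n"
  proof (induction rule: omega_induct)
    case definable
    show ?case unfolding defpred_def by (intro definable_intros)
  qed auto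
  with k n omega_mem[OF n k] show ?thesis by auto
qed

lemma add_cancel:
  assumes m: "m \<^bold>\<in> \<omega>" and n: "n \<^bold>\<in> \<omega>" and k: "k \<^bold>\<in> \<omega>" and eq: "add m k = add m n" shows "k = n"
  using omega_linear[OF k n] add_less[OF m n] add_less[OF m k] eq omega_irrefl[OF add_omega[OF m n]] by metis

definition trio :: "'v \<Rightarrow> 'v" where
  "trio n = (if n \<^bold>\<in> \<omega> then triangle n else \<^bold>0)"

lemma defop2_triangle: "defop2 (\<lambda>k x. addo x (succ k))"
  by (rule defop2I) (intro definable_intros)

lemma triangle_eq: "n \<^bold>\<in> \<omega> \<Longrightarrow> triangle n = nrec \<^bold>0 (\<lambda>k x. addo x (succ k)) n"
  unfolding triangle_def by (rule nrec_cong) simp_all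

lemma trio_eq [simp]: "n \<^bold>\<in> \<omega> \<Longrightarrow> trio n = triangle n"
  by (simp add: trio_def)

lemma defterm_trio [definable_intros]:
  assumes "defterm t" shows "defterm (\<lambda>e. trio (t e))"
proof -
  have "trio = (\<lambda>n. if n \<^bold>\<in> \<omega> then nrec \<^bold>0 (\<lambda>k x. addo x (succ k)) n else \<^bold>0)"
    by (rule ext) (simp add: trio_def triangle_eq)
  then show ?thesis
    using defterm_defop2[OF defop2_nrec[OF defop2_triangle] defterm_const[of "\<^bold>0"] assms] by simp
qed

lemma triangle_zero [simp]: "triangle \<^bold>0 = \<^bold>0"
  unfolding triangle_eq[OF zero_omega] by (rule nrec_zero[OF defop2_triangle])

lemma triangle_succ [simp]: "n \<^bold>\<in> \<omega> \<Longrightarrow> triangle (succ n) = add (triangle n) (succ n)"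
  by (simp only: triangle_eq succ_omega nrec_succ[OF defop2_triangle] addo_eq)

lemma triangle_omega [simp]: assumes n: "n \<^bold>\<in> \<omega>" shows "triangle n \<^bold>\<in> \<omega>"
proof -
  from n have "trio n \<^bold>\<in> \<omega>"
  proof (induction rule: omega_induct)
    case definable
    show ?case unfolding defpred_def by (intro definable_intros)
  qed (simp_all del: add_succ)
  with n show ?thesis by simp
qed

lemma le_triangle: assumes n: "n \<^bold>\<in> \<omega>" shows "n \<^bold>\<in> succ (triangle n)"
proof (cases rule: omega_cases[OF n])
  case (2 k)
  then show ?thesis using le_add2[of "triangle k" "succ k"] by simp
qed simp

text \<open>Pairs with component sum \<open>m\<close> have their codes from
  \<open>triangle m\<close> to below \<open>triangle (succ m)\<close>. These blocks do not overlap,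
  which is the reason why Cantor pairing is injective.\<close>

lemma triangle_less:
  assumes n: "n \<^bold>\<in> \<omega>" and m: "m \<^bold>\<in> n" shows "triangle (succ m) \<^bold>\<in> succ (triangle n)"
proof -
  from n have "\<forall>m. m \<^bold>\<in> n \<longrightarrow> trio (succ m) \<^bold>\<in> succ (trio n)"
  proof (induction rule: omega_induct)
    case (succ k)
    show ?case
    proof (intro allI impI)
      fix m assume m: "m \<^bold>\<in> succ k"
      have "triangle k \<^bold>\<in> succ (triangle (succ k))" using succ.hyps le_add[of "triangle k" "succ k"] by simp
      then show "trio (succ m) \<^bold>\<in> succ (trio (succ k))"
        using m succ.IH le_trans[of "triangle (succ k)" "trio (succ m)" "triangle k"] succ.hyps
        unfolding mem_succ[of m k] by (auto simp del: triangle_succ mem_succ) (simp_all)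
    qed
  next
    case definable
    show ?case unfolding defpred_def by (intro definable_intros)
  qed simp
  with m have "trio (succ m) \<^bold>\<in> succ (trio n)" by blast
  then show ?thesis using n omega_mem[OF n m] by (simp only: trio_eq succ_omega)
qed

definition npairo :: "'v \<Rightarrow> 'v \<Rightarrow> 'v" where
  "npairo m n = addo (trio (addo m n)) m"

lemma npairo_eq [simp]: "m \<^bold>\<in> \<omega> \<Longrightarrow> n \<^bold>\<in> \<omega> \<Longrightarrow> npairo m n = npair m n"
  by (simp add: npairo_def npair_def)

lemma defterm_npairo [definable_intros]:
  assumes "defterm t" "defterm s" shows "defterm (\<lambda>e. npairo (t e) (s e))"
  unfolding npairo_def by (intro definable_intros assms)

lemma npair_omega [simp]: "m \<^bold>\<in> \<omega> \<Longrightarrow> n \<^bold>\<in> \<omega> \<Longrightarrow> npair m n \<^bold>\<in> \<omega>"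
  by (simp add: npair_def)

lemma npair_less:
  assumes "m \<^bold>\<in> \<omega>" "n \<^bold>\<in> \<omega>" "m' \<^bold>\<in> \<omega>" "n' \<^bold>\<in> \<omega>" "add m n \<^bold>\<in> add m' n'"
  shows "npair m n \<^bold>\<in> npair m' n'"
proof -
  have "m \<^bold>\<in> succ (add m n)" using le_add assms by blast
  then have "npair m n \<^bold>\<in> triangle (succ (add m n))"
    using add_less[of "triangle (add m n)" "succ (add m n)" m] assms by (simp add: npair_def del: add_succ)
  also have "triangle (succ (add m n)) \<^bold>\<in> succ (triangle (add m' n'))"
    using triangle_less assms add_omega by blast
  finally (less_le_trans[rotated 1]) have "npair m n \<^bold>\<in> triangle (add m' n')"
    using assms by simp
  moreover have "triangle (add m' n') \<^bold>\<in> succ (npair m' n')"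
    using le_add assms by (simp add: npair_def)
  ultimately show ?thesis using less_le_trans assms npair_omega by blast
qed

lemma npair_inject:
  assumes "m \<^bold>\<in> \<omega>" "n \<^bold>\<in> \<omega>" "m' \<^bold>\<in> \<omega>" "n' \<^bold>\<in> \<omega>"
  shows "npair m n = npair m' n' \<longleftrightarrow> m = m' \<and> n = n'"
proof
  assume eq: "npair m n = npair m' n'"
  have "add m n = add m' n'"
    using omega_linear[of "add m n" "add m' n'"] npair_less[of m n m' n'] npair_less[of m' n' m n]
      omega_irrefl[of "npair m n"] eq assms by auto
  moreover from this have "m = m'"
    using eq add_cancel[of "triangle (add m n)" m' m] assms by (simp add: npair_def)
  ultimately show "m = m' \<and> n = n'" using add_cancel[of m n' n] assms by simp
qed simp

text \<open>Whatever entry \<open>i\<close> of a sequence computes from the components of the pair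
  coded by \<open>i\<close> needs no position beyond \<open>i\<close>. Continuity of
  \<open>viol\<close> and of the answer table rests on this.\<close>

lemma npair_ge: assumes "m \<^bold>\<in> \<omega>" "n \<^bold>\<in> \<omega>"
  shows "m \<^bold>\<in> succ (npair m n)" "n \<^bold>\<in> succ (npair m n)"
proof -
  have "triangle (add m n) \<^bold>\<in> succ (npair m n)" unfolding npair_def by (rule le_add) (use assms in simp_all)
  then have "add m n \<^bold>\<in> succ (npair m n)"
    using le_triangle[of "add m n"] le_trans[of "npair m n" "add m n" "triangle (add m n)"] assms
    by (simp del: mem_succ)
  then show "m \<^bold>\<in> succ (npair m n)" "n \<^bold>\<in> succ (npair m n)"
    using le_add[of m n] le_add2[of m n] le_trans[of "npair m n" _ "add m n"] assms
    by (simp_all del: mem_succ)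
qed

subsection \<open>Interleaving\<close>

lemma double_cases:
  assumes "k \<^bold>\<in> \<omega>"
  obtains n where "n \<^bold>\<in> \<omega>" "k = add n n" | n where "n \<^bold>\<in> \<omega>" "k = succ (add n n)"
proof -
  from assms have "\<exists>n. n \<^bold>\<in> \<omega> \<and> (k = addo n n \<or> k = succ (addo n n))"
  proof (induction rule: omega_induct)
    case zero
    then show ?case by (intro exI[of _ "\<^bold>0"]) simp
  next
    case (succ k)
    then obtain n where n: "n \<^bold>\<in> \<omega>" "k = addo n n \<or> k = succ (addo n n)" by blast
    then have "succ k = succ (addo n n) \<or> succ k = addo (succ n) (succ n)" by auto
    with n(1) show ?case using succ_omega by blast
  next
    case definable
    show ?case unfolding defpred_def by (intro definable_intros)
  qed
  then show ?thesis using that by auto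
qed

lemma double_less:
  assumes m: "m \<^bold>\<in> \<omega>" and n: "n \<^bold>\<in> m" shows "succ (add n n) \<^bold>\<in> add m m"
proof -
  have no: "n \<^bold>\<in> \<omega>" using omega_mem[OF m n] .
  have "succ (add n n) \<^bold>\<in> succ (add n m)"
    by (rule succ_mem_succ[OF add_omega[OF no m] add_less[OF no m n]])
  moreover have "add n m \<^bold>\<in> add m m"
    using add_less[OF m m n] add_commute[OF m no] by simp
  ultimately show ?thesis
    using omega_trans[OF add_omega[OF m m], of "add n m" "succ (add n n)"] mem_succ by metis
qed

lemma double_inject:
  assumes "m \<^bold>\<in> \<omega>" "n \<^bold>\<in> \<omega>"
  shows "add m m = add n n \<longleftrightarrow> m = n" "add m m \<noteq> succ (add n n)" "succ (add n n) \<noteq> add m m"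
proof -
  have 1: "add m m \<^bold>\<in> add n n \<and> succ (add m m) \<^bold>\<in> add n n" if "m \<^bold>\<in> n" "n \<^bold>\<in> \<omega>" for m n
    using double_less[OF that(2,1)] that omega_trans[of "add n n" "succ (add m m)" "add m m"] by simp
  have o: "add m m \<^bold>\<in> \<omega>" "add n n \<^bold>\<in> \<omega>" using assms by simp_all
  show "add m m = add n n \<longleftrightarrow> m = n"
    using omega_linear[OF assms] 1[of m n] 1[of n m] assms omega_irrefl[OF o(1)] by metis
  show "add m m \<noteq> succ (add n n)"
    using omega_linear[OF assms] 1[of m n] 1[of n m] assms omega_irrefl[OF o(1)] omega_irrefl[OF o(2)]
      omega_asym[OF o(1)] mem_succ by metis
  then show "succ (add n n) \<noteq> add m m" by metis
qed

lemma interleave_eq: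
  "interleave p q = collect (\<lambda>z. \<exists>n. n \<^bold>\<in> \<omega> \<and> (z = \<^bold>\<langle>addo n n, p \<^bold>\<cdot> n\<^bold>\<rangle> \<or> z = \<^bold>\<langle>succ (addo n n), q \<^bold>\<cdot> n\<^bold>\<rangle>))"
proof -
  have "(\<lambda>z. \<exists>n. n \<^bold>\<in> \<omega> \<and> (z = \<^bold>\<langle>add n n, p \<^bold>\<cdot> n\<^bold>\<rangle> \<or> z = \<^bold>\<langle>succ (add n n), q \<^bold>\<cdot> n\<^bold>\<rangle>)) =
    (\<lambda>z. \<exists>n. n \<^bold>\<in> \<omega> \<and> (z = \<^bold>\<langle>addo n n, p \<^bold>\<cdot> n\<^bold>\<rangle> \<or> z = \<^bold>\<langle>succ (addo n n), q \<^bold>\<cdot> n\<^bold>\<rangle>))"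
    by (intro ext ex_cong1 conj_cong) simp_all
  then show ?thesis unfolding interleave_def by simp
qed

lemma ex_interleave:
  "\<exists>B. \<forall>z. z \<^bold>\<in> B \<longleftrightarrow> (\<exists>n. n \<^bold>\<in> \<omega> \<and> (z = \<^bold>\<langle>addo n n, p \<^bold>\<cdot> n\<^bold>\<rangle> \<or> z = \<^bold>\<langle>succ (addo n n), q \<^bold>\<cdot> n\<^bold>\<rangle>))"
proof -
  have "defop (\<lambda>n. \<^bold>\<langle>addo n n, p \<^bold>\<cdot> n\<^bold>\<rangle>)" "defop (\<lambda>n. \<^bold>\<langle>succ (addo n n), q \<^bold>\<cdot> n\<^bold>\<rangle>)"
    by (rule defopI, intro definable_intros)+
  from this[THEN ex_image, of \<omega>] obtain A B where
    "\<And>z. z \<^bold>\<in> A \<longleftrightarrow> (\<exists>n. n \<^bold>\<in> \<omega> \<and> z = \<^bold>\<langle>addo n n, p \<^bold>\<cdot> n\<^bold>\<rangle>)"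
    "\<And>z. z \<^bold>\<in> B \<longleftrightarrow> (\<exists>n. n \<^bold>\<in> \<omega> \<and> z = \<^bold>\<langle>succ (addo n n), q \<^bold>\<cdot> n\<^bold>\<rangle>)" by blast
  moreover obtain C where "\<And>z. z \<^bold>\<in> C \<longleftrightarrow> z \<^bold>\<in> A \<or> z \<^bold>\<in> B" using ex_union2[of A B] by blast
  ultimately have "z \<^bold>\<in> C \<longleftrightarrow> (\<exists>n. n \<^bold>\<in> \<omega> \<and> (z = \<^bold>\<langle>addo n n, p \<^bold>\<cdot> n\<^bold>\<rangle> \<or> z = \<^bold>\<langle>succ (addo n n), q \<^bold>\<cdot> n\<^bold>\<rangle>))" for z
    by blast
  then show ?thesis by blast
qed

lemma mem_interleave:
  "z \<^bold>\<in> interleave p q \<longleftrightarrow> (\<exists>n. n \<^bold>\<in> \<omega> \<and> (z = \<^bold>\<langle>add n n, p \<^bold>\<cdot> n\<^bold>\<rangle> \<or> z = \<^bold>\<langle>succ (add n n), q \<^bold>\<cdot> n\<^bold>\<rangle>))"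
proof -
  have "z \<^bold>\<in> interleave p q \<longleftrightarrow> (\<exists>n. n \<^bold>\<in> \<omega> \<and> (z = \<^bold>\<langle>addo n n, p \<^bold>\<cdot> n\<^bold>\<rangle> \<or> z = \<^bold>\<langle>succ (addo n n), q \<^bold>\<cdot> n\<^bold>\<rangle>))"
    unfolding interleave_eq by (rule mem_collect[OF ex_interleave])
  also have "\<dots> \<longleftrightarrow> (\<exists>n. n \<^bold>\<in> \<omega> \<and> (z = \<^bold>\<langle>add n n, p \<^bold>\<cdot> n\<^bold>\<rangle> \<or> z = \<^bold>\<langle>succ (add n n), q \<^bold>\<cdot> n\<^bold>\<rangle>))"
    by (intro ex_cong1 conj_cong) simp_all
  finally show ?thesis .
qed

lemma defterm_interleave [definable_intros]:
  assumes "defterm t" "defterm s" shows "defterm (\<lambda>e. interleave (t e) (s e))"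
proof -
  have "defterm (\<lambda>e. interleave (e 0) (e 1))"
    unfolding interleave_eq by (intro defterm_collect definable_intros ex_interleave)
  then have "defop2 interleave" by (rule defop2I[of interleave])
  then show ?thesis using assms by (rule defterm_defop2)
qed

lemma func_interleave: "func (interleave p q)"
proof -
  have "y = y'" if H: "\<^bold>\<langle>x, y\<^bold>\<rangle> \<^bold>\<in> interleave p q" "\<^bold>\<langle>x, y'\<^bold>\<rangle> \<^bold>\<in> interleave p q" for x y y'
  proof -
    obtain n m where "n \<^bold>\<in> \<omega>" "m \<^bold>\<in> \<omega>"
      "(x = add n n \<and> y = p \<^bold>\<cdot> n) \<or> (x = succ (add n n) \<and> y = q \<^bold>\<cdot> n)"
      "(x = add m m \<and> y' = p \<^bold>\<cdot> m) \<or> (x = succ (add m m) \<and> y' = q \<^bold>\<cdot> m)"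
      using H unfolding mem_interleave opair_eq by blast
    then show ?thesis
      using double_inject[of n m] double_inject[of m n] succ_inject[of "add n n" "add m m"] by (elim disjE) simp_all
  qed
  then show ?thesis unfolding func_def mem_interleave by blast
qed

lemma interleave_app [simp]:
  assumes "n \<^bold>\<in> \<omega>"
  shows "interleave p q \<^bold>\<cdot> add n n = p \<^bold>\<cdot> n" "interleave p q \<^bold>\<cdot> succ (add n n) = q \<^bold>\<cdot> n"
  using assms by (auto intro!: func_app[OF func_interleave] simp: mem_interleave)

lemma interleave_baire [simp]:
  assumes "p \<^bold>\<in> \<N>" "q \<^bold>\<in> \<N>" shows "interleave p q \<^bold>\<in> \<N>"
proof -
  have "in_dom x (interleave p q) \<longleftrightarrow> x \<^bold>\<in> \<omega>" for x
    unfolding in_dom_def mem_interleave opair_eq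
    by (metis add_omega succ_omega double_cases)
  moreover have "y \<^bold>\<in> \<omega>" if "\<^bold>\<langle>x, y\<^bold>\<rangle> \<^bold>\<in> interleave p q" for x y
    using that assms unfolding mem_interleave opair_eq by auto
  ultimately show ?thesis unfolding mem_baire maps_def using func_interleave by blast
qed

definition left :: "'v \<Rightarrow> 'v" where
  "left x = fun_of \<omega> (\<lambda>n. x \<^bold>\<cdot> addo n n)"

definition right :: "'v \<Rightarrow> 'v" where
  "right x = fun_of \<omega> (\<lambda>n. x \<^bold>\<cdot> succ (addo n n))"

definition const_seq :: "'v \<Rightarrow> 'v" where
  "const_seq l = fun_of \<omega> (\<lambda>n. l)"

lemma defop_left: "defop (\<lambda>n. x \<^bold>\<cdot> addo n n)" and defop_right: "defop (\<lambda>n. x \<^bold>\<cdot> succ (addo n n))"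
  and defop_const: "defop (\<lambda>n. l)"
  by (rule defopI, intro definable_intros)+

lemma defterm_left [definable_intros]: "defterm t \<Longrightarrow> defterm (\<lambda>e. left (t e))"
  unfolding left_def by (intro definable_intros defterm_weaken)

lemma defterm_right [definable_intros]: "defterm t \<Longrightarrow> defterm (\<lambda>e. right (t e))"
  unfolding right_def by (intro definable_intros defterm_weaken)

lemma defterm_const_seq [definable_intros]: "defterm t \<Longrightarrow> defterm (\<lambda>e. const_seq (t e))"
  unfolding const_seq_def by (intro definable_intros defterm_weaken)

lemma left_app [simp]: "n \<^bold>\<in> \<omega> \<Longrightarrow> left x \<^bold>\<cdot> n = x \<^bold>\<cdot> add n n"
  unfolding left_def using fun_of_app[OF defop_left] by simp

lemma right_app [simp]: "n \<^bold>\<in> \<omega> \<Longrightarrow> right x \<^bold>\<cdot> n = x \<^bold>\<cdot> succ (add n n)"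
  unfolding right_def using fun_of_app[OF defop_right] by simp

lemma const_app [simp]: "n \<^bold>\<in> \<omega> \<Longrightarrow> const_seq l \<^bold>\<cdot> n = l"
  unfolding const_seq_def using fun_of_app[OF defop_const] by simp

lemma left_baire [simp]: "x \<^bold>\<in> \<N> \<Longrightarrow> left x \<^bold>\<in> \<N>"
  unfolding left_def by (rule baire_fun_of[OF defop_left]) simp

lemma right_baire [simp]: "x \<^bold>\<in> \<N> \<Longrightarrow> right x \<^bold>\<in> \<N>"
  unfolding right_def by (rule baire_fun_of[OF defop_right]) simp

lemma const_baire [simp]: "l \<^bold>\<in> \<omega> \<Longrightarrow> const_seq l \<^bold>\<in> \<N>"
  unfolding const_seq_def by (rule baire_fun_of[OF defop_const])

lemma left_interleave [simp]: "p \<^bold>\<in> \<N> \<Longrightarrow> q \<^bold>\<in> \<N> \<Longrightarrow> left (interleave p q) = p"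
  by (rule baire_ext) simp_all

lemma right_interleave [simp]: "p \<^bold>\<in> \<N> \<Longrightarrow> q \<^bold>\<in> \<N> \<Longrightarrow> right (interleave p q) = q"
  by (rule baire_ext) simp_all


subsection \<open>Continuous operations on Baire space\<close>

text \<open>Continuity of a HOL operation on a HOL predicate. Compositions are formed at this level,
  and definability is checked only once, when the result is turned into a set by
  \<open>conti_continuous\<close>.\<close>

definition conti :: "('v \<Rightarrow> bool) \<Rightarrow> ('v \<Rightarrow> 'v) \<Rightarrow> bool" where
  "conti P \<phi> \<longleftrightarrow> (\<forall>p. P p \<longrightarrow> p \<^bold>\<in> \<N> \<and> \<phi> p \<^bold>\<in> \<N>) \<and>
     (\<forall>p n. P p \<and> n \<^bold>\<in> \<omega> \<longrightarrow> (\<exists>m. m \<^bold>\<in> \<omega> \<and> (\<forall>p'. P p' \<and> agree m p' p \<longrightarrow> agree n (\<phi> p') (\<phi> p))))"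

lemma contiI:
  assumes "\<And>p. P p \<Longrightarrow> p \<^bold>\<in> \<N>" "\<And>p. P p \<Longrightarrow> \<phi> p \<^bold>\<in> \<N>"
    "\<And>p n. P p \<Longrightarrow> n \<^bold>\<in> \<omega> \<Longrightarrow> \<exists>m. m \<^bold>\<in> \<omega> \<and> (\<forall>p'. P p' \<and> agree m p' p \<longrightarrow> agree n (\<phi> p') (\<phi> p))"
  shows "conti P \<phi>"
  using assms unfolding conti_def by blast

lemma contiD:
  assumes "conti P \<phi>" "P p"
  shows "p \<^bold>\<in> \<N>" "\<phi> p \<^bold>\<in> \<N>"
    "n \<^bold>\<in> \<omega> \<Longrightarrow> \<exists>m. m \<^bold>\<in> \<omega> \<and> (\<forall>p'. P p' \<and> agree m p' p \<longrightarrow> agree n (\<phi> p') (\<phi> p))"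
  using assms unfolding conti_def by blast+

lemma conti_cong:
  assumes "conti P \<phi>" "\<And>p. Q p \<Longrightarrow> P p" "\<And>p. Q p \<Longrightarrow> \<psi> p = \<phi> p" shows "conti Q \<psi>"
proof (rule contiI)
  fix p n assume p: "Q p" "n \<^bold>\<in> \<omega>"
  obtain m where "m \<^bold>\<in> \<omega>" "\<And>p'. P p' \<Longrightarrow> agree m p' p \<Longrightarrow> agree n (\<phi> p') (\<phi> p)"
    using contiD(3)[OF assms(1) assms(2)[OF p(1)] p(2)] by blast
  then show "\<exists>m. m \<^bold>\<in> \<omega> \<and> (\<forall>p'. Q p' \<and> agree m p' p \<longrightarrow> agree n (\<psi> p') (\<psi> p))"
    using assms(2,3) p(1) by auto
qed (use assms contiD in auto)

lemma conti_comp: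
  assumes "conti P \<phi>" "conti Q \<psi>" "\<And>p. P p \<Longrightarrow> Q (\<phi> p)" shows "conti P (\<lambda>p. \<psi> (\<phi> p))"
proof (rule contiI)
  fix p n assume p: "P p" "n \<^bold>\<in> \<omega>"
  obtain k where k: "k \<^bold>\<in> \<omega>" "\<And>q. Q q \<Longrightarrow> agree k q (\<phi> p) \<Longrightarrow> agree n (\<psi> q) (\<psi> (\<phi> p))"
    using contiD(3)[OF assms(2) assms(3)[OF p(1)] p(2)] by blast
  obtain m where m: "m \<^bold>\<in> \<omega>" "\<And>p'. P p' \<Longrightarrow> agree m p' p \<Longrightarrow> agree k (\<phi> p') (\<phi> p)"
    using contiD(3)[OF assms(1) p(1) k(1)] by blast
  show "\<exists>m. m \<^bold>\<in> \<omega> \<and> (\<forall>p'. P p' \<and> agree m p' p \<longrightarrow> agree n (\<psi> (\<phi> p')) (\<psi> (\<phi> p)))"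
    using m k(2) assms(3) by blast
qed (use assms contiD in blast)+

lemma double_le: assumes n: "n \<^bold>\<in> \<omega>" and j: "j \<^bold>\<in> \<omega>" and "add j j \<^bold>\<in> n \<or> succ (add j j) \<^bold>\<in> n" shows "j \<^bold>\<in> n"
proof -
  have d: "add j j \<^bold>\<in> n" using assms(3) omega_trans[OF n, of "succ (add j j)" "add j j"] mem_succ by blast
  have "j \<^bold>\<in> add j j \<or> j = add j j" using le_add[OF j j] unfolding mem_succ .
  then show ?thesis
  proof
    assume "j = add j j"
    then show ?thesis using d by (rule ssubst[of j "add j j" "\<lambda>x. x \<^bold>\<in> n"])
  qed (rule omega_trans[OF n d])
qed

text \<open>Interleaving needs no longer prefix than it delivers, since each of
  \<open>2j < n\<close> and \<open>2j + 1 < n\<close> gives \<open>j < n\<close>; splitting, in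
  contrast, needs twice the length.\<close>

lemma agree_interleave:
  assumes "n \<^bold>\<in> \<omega>" "agree n p p'" "agree n q q'" shows "agree n (interleave p q) (interleave p' q')"
  unfolding agree_def
proof (intro allI impI)
  fix k assume k: "k \<^bold>\<in> n"
  then have "k \<^bold>\<in> \<omega>" using omega_mem[OF assms(1)] by blast
  then show "interleave p q \<^bold>\<cdot> k = interleave p' q' \<^bold>\<cdot> k"
  proof (cases rule: double_cases)
    case (1 j)
    then have "j \<^bold>\<in> n" using double_le[OF assms(1)] k by blast
    then show ?thesis using 1 assms(2) by (simp add: agree_def)
  next
    case (2 j)
    then have "j \<^bold>\<in> n" using double_le[OF assms(1)] k by blast
    then show ?thesis using 2 assms(3) by (simp add: agree_def)
  qed
qed

lemma agree_left: assumes "n \<^bold>\<in> \<omega>" "agree (add n n) x y" shows "agree n (left x) (left y)"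
  unfolding agree_def
proof (intro allI impI)
  fix k assume k: "k \<^bold>\<in> n"
  have ko: "k \<^bold>\<in> \<omega>" using omega_mem[OF assms(1) k] .
  have "succ (add k k) \<^bold>\<in> add n n" using double_less[OF assms(1) k] .
  then have "add k k \<^bold>\<in> add n n" using omega_trans[of "add n n" "succ (add k k)" "add k k"] assms(1) by simp
  then show "left x \<^bold>\<cdot> k = left y \<^bold>\<cdot> k" using assms(2) ko by (simp add: agree_def)
qed

lemma agree_right: assumes "n \<^bold>\<in> \<omega>" "agree (add n n) x y" shows "agree n (right x) (right y)"
  unfolding agree_def
proof (intro allI impI)
  fix k assume k: "k \<^bold>\<in> n"
  have ko: "k \<^bold>\<in> \<omega>" using omega_mem[OF assms(1) k] .
  have "succ (add k k) \<^bold>\<in> add n n" using double_less[OF assms(1) k] .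
  then show "right x \<^bold>\<cdot> k = right y \<^bold>\<cdot> k" using assms(2) ko by (simp add: agree_def)
qed

lemma conti_interleave:
  assumes "conti P \<phi>" "conti P \<psi>" shows "conti P (\<lambda>p. interleave (\<phi> p) (\<psi> p))"
proof (rule contiI)
  fix p n assume p: "P p" "n \<^bold>\<in> \<omega>"
  obtain k where k: "k \<^bold>\<in> \<omega>" "\<And>q. P q \<Longrightarrow> agree k q p \<Longrightarrow> agree n (\<phi> q) (\<phi> p)"
    using contiD(3)[OF assms(1) p] by blast
  obtain l where l: "l \<^bold>\<in> \<omega>" "\<And>q. P q \<Longrightarrow> agree l q p \<Longrightarrow> agree n (\<psi> q) (\<psi> p)"
    using contiD(3)[OF assms(2) p] by blast
  obtain m where m: "m \<^bold>\<in> \<omega>" "k \<^bold>\<in> succ m" "l \<^bold>\<in> succ m" using omega_max[OF k(1) l(1)] by blast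
  show "\<exists>m. m \<^bold>\<in> \<omega> \<and> (\<forall>p'. P p' \<and> agree m p' p \<longrightarrow>
      agree n (interleave (\<phi> p') (\<psi> p')) (interleave (\<phi> p) (\<psi> p)))"
    using m(1) k(2) l(2) agree_mono[OF m(1) m(2)] agree_mono[OF m(1) m(3)] agree_interleave[OF p(2)] by blast
qed (use contiD[OF assms(1)] contiD[OF assms(2)] in simp_all)

lemma conti_left: assumes "\<And>p. P p \<Longrightarrow> p \<^bold>\<in> \<N>" shows "conti P left"
proof (rule contiI)
  fix p n assume "n \<^bold>\<in> \<omega>"
  then show "\<exists>m. m \<^bold>\<in> \<omega> \<and> (\<forall>p'. P p' \<and> agree m p' p \<longrightarrow> agree n (left p') (left p))"
    using agree_left add_omega by blast
qed (use assms in simp_all)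

lemma conti_right: assumes "\<And>p. P p \<Longrightarrow> p \<^bold>\<in> \<N>" shows "conti P right"
proof (rule contiI)
  fix p n assume "n \<^bold>\<in> \<omega>"
  then show "\<exists>m. m \<^bold>\<in> \<omega> \<and> (\<forall>p'. P p' \<and> agree m p' p \<longrightarrow> agree n (right p') (right p))"
    using agree_right add_omega by blast
qed (use assms in simp_all)

lemma continuous_conti:
  assumes "continuous F" shows "conti (\<lambda>p. in_dom p F) (\<lambda>p. F \<^bold>\<cdot> p)"
proof -
  have F: "func F" "\<And>x y. \<^bold>\<langle>x, y\<^bold>\<rangle> \<^bold>\<in> F \<Longrightarrow> x \<^bold>\<in> \<N> \<and> y \<^bold>\<in> \<N>"
    using assms by (auto simp: continuous_def partial_maps_def)
  have app: "\<^bold>\<langle>p, F \<^bold>\<cdot> p\<^bold>\<rangle> \<^bold>\<in> F" if "in_dom p F" for p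
    using that func_app[OF F(1)] unfolding in_dom_def by blast
  show ?thesis
  proof (rule contiI)
    fix p n assume p: "in_dom p F" "n \<^bold>\<in> \<omega>"
    obtain m where m: "m \<^bold>\<in> \<omega>"
      "\<And>p' q'. \<^bold>\<langle>p', q'\<^bold>\<rangle> \<^bold>\<in> F \<Longrightarrow> p' \<^bold>\<restriction> m = p \<^bold>\<restriction> m \<Longrightarrow> q' \<^bold>\<restriction> n = (F \<^bold>\<cdot> p) \<^bold>\<restriction> n"
      using assms app[OF p(1)] p(2) unfolding continuous_def by blast
    have "agree n (F \<^bold>\<cdot> p') (F \<^bold>\<cdot> p)" if "in_dom p' F" "agree m p' p" for p'
      using m(2)[OF app[OF that(1)]] that(2) F(2)[OF app[OF that(1)]] F(2)[OF app[OF p(1)]]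
        restr_eq_iff m(1) p(2) by metis
    with m(1) show "\<exists>m. m \<^bold>\<in> \<omega> \<and> (\<forall>p'. in_dom p' F \<and> agree m p' p \<longrightarrow> agree n (F \<^bold>\<cdot> p') (F \<^bold>\<cdot> p))"
      by blast
  qed (use app F(2) in blast)+
qed

text \<open>Definability of \<open>P\<close> and \<open>\<phi>\<close> lets separation cut the graph
  out of the square of Baire space.\<close>

lemma conti_continuous:
  assumes c: "conti P \<phi>" and P: "defpred P" and \<phi>: "defop \<phi>"
  obtains F where "continuous F" "\<And>p. in_dom p F \<longleftrightarrow> P p" "\<And>p. P p \<Longrightarrow> F \<^bold>\<cdot> p = \<phi> p"
proof -
  let ?Q = "\<lambda>z. \<exists>p. P p \<and> z = \<^bold>\<langle>p, \<phi> p\<^bold>\<rangle>"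
  have d: "defpred ?Q"
    unfolding defpred_def by (intro definable_intros definable_defpred[OF P] defterm_defop[OF \<phi>])
  have F: "z \<^bold>\<in> collect ?Q \<longleftrightarrow> ?Q z" for z
    by (rule mem_collect_sub[OF d, of "cart \<N> \<N>"]) (use contiD[OF c] in \<open>auto simp: mem_cart\<close>)
  have f: "func (collect ?Q)" unfolding func_def F by auto
  show ?thesis
  proof (rule that[of "collect ?Q"])
    show "in_dom p (collect ?Q) \<longleftrightarrow> P p" for p unfolding in_dom_def F by auto
    show "collect ?Q \<^bold>\<cdot> p = \<phi> p" if "P p" for p
      by (rule func_app[OF f]) (use that in \<open>simp add: F\<close>)
    have "\<exists>m. m \<^bold>\<in> \<omega> \<and> (\<forall>p' q'. \<^bold>\<langle>p', q'\<^bold>\<rangle> \<^bold>\<in> collect ?Q \<and> p' \<^bold>\<restriction> m = p \<^bold>\<restriction> m \<longrightarrow> q' \<^bold>\<restriction> n = q \<^bold>\<restriction> n)"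
      if pq: "\<^bold>\<langle>p, q\<^bold>\<rangle> \<^bold>\<in> collect ?Q" and n: "n \<^bold>\<in> \<omega>" for p q n
    proof -
      have p: "P p" "q = \<phi> p" using pq unfolding F by simp_all
      obtain m where m: "m \<^bold>\<in> \<omega>" "\<And>p'. P p' \<Longrightarrow> agree m p' p \<Longrightarrow> agree n (\<phi> p') (\<phi> p)"
        using contiD(3)[OF c p(1) n] by blast
      have "\<phi> p' \<^bold>\<restriction> n = \<phi> p \<^bold>\<restriction> n" if p': "P p'" and e: "p' \<^bold>\<restriction> m = p \<^bold>\<restriction> m" for p'
      proof -
        have "agree m p' p"
          using restr_eq_iff[OF contiD(1)[OF c p'] contiD(1)[OF c p(1)] m(1)] e by blast
        from m(2)[OF p' this] show ?thesis
          using restr_eq_iff[OF contiD(2)[OF c p'] contiD(2)[OF c p(1)] n] by blast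
      qed
      with m(1) p(2) show ?thesis unfolding F by auto
    qed
    moreover have "x \<^bold>\<in> \<N> \<and> y \<^bold>\<in> \<N>" if "\<^bold>\<langle>x, y\<^bold>\<rangle> \<^bold>\<in> collect ?Q" for x y
      using that contiD[OF c] unfolding F by auto
    ultimately show "continuous (collect ?Q)"
      unfolding continuous_def partial_maps_def using f by blast
  qed
qed

section \<open>Continuous Weihrauch reductions as definable operations\<close>

lemma defpred_instance_name: "defpred (instance_name g)"
  unfolding defpred_def instance_name_def in_dom_def by (intro definable_intros)

lemma defpred2_solution_name: "defpred2 (solution_name g)"
  unfolding defpred2_def solution_name_def by (intro definable_intros)

lemmas definable_instance_name [definable_intros] = definable_defpred[OF defpred_instance_name]
lemmas definable_solution_name [definable_intros] = definable_defpred2[OF defpred2_solution_name]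

text \<open>The arguments at which the backward map is ever evaluated; its continuity is asked for,
  and is available, only there.\<close>

definition out_dom :: "'v problem \<Rightarrow> 'v problem \<Rightarrow> ('v \<Rightarrow> 'v) \<Rightarrow> 'v \<Rightarrow> bool" where
  "out_dom g h H x \<longleftrightarrow> (\<exists>p q. instance_name g p \<and> solution_name h (H p) q \<and> x = interleave p q)"

lemma le_W_contI:
  assumes H: "defop H" and K: "defop K"
    and "conti (instance_name g) H" "conti (out_dom g h H) K"
    and 1: "\<And>p. instance_name g p \<Longrightarrow> instance_name h (H p)"
    and 2: "\<And>p q. instance_name g p \<Longrightarrow> solution_name h (H p) q \<Longrightarrow> solution_name g p (K (interleave p q))"
  shows "g \<le>\<^sub>W\<^sup>* h"
proof -
  obtain F where F: "continuous F" "\<And>p. in_dom p F \<longleftrightarrow> instance_name g p"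
      "\<And>p. instance_name g p \<Longrightarrow> F \<^bold>\<cdot> p = H p"
    using conti_continuous[OF assms(3) defpred_instance_name H] by blast
  have "defpred (out_dom g h H)"
    unfolding defpred_def out_dom_def by (intro definable_intros defterm_defop[OF H])
  then obtain G where G: "continuous G" "\<And>p. in_dom p G \<longleftrightarrow> out_dom g h H p"
      "\<And>p. out_dom g h H p \<Longrightarrow> G \<^bold>\<cdot> p = K p"
    using conti_continuous[OF assms(4) _ K] by blast
  have "in_dom (interleave p q) G \<and> solution_name g p (G \<^bold>\<cdot> interleave p q)"
    if p: "instance_name g p" and q: "solution_name h (F \<^bold>\<cdot> p) q" for p q
  proof -
    have q': "solution_name h (H p) q" using q F(3)[OF p] by simp
    then have "out_dom g h H (interleave p q)" using p unfolding out_dom_def by blast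
    then show ?thesis using G(2,3) 2[OF p q'] by simp
  qed
  then show ?thesis
    unfolding le_W_cont_def reduces_via_def
    using F G(1) 1 by (intro exI[of _ F] exI[of _ G]) simp
qed

lemma le_W_contE:
  assumes "g \<le>\<^sub>W\<^sup>* h"
  obtains H K where "conti (instance_name g) (\<lambda>p. H \<^bold>\<cdot> p)" "conti (out_dom g h (\<lambda>p. H \<^bold>\<cdot> p)) (\<lambda>p. K \<^bold>\<cdot> p)"
    "\<And>p. instance_name g p \<Longrightarrow> instance_name h (H \<^bold>\<cdot> p)"
    "\<And>p q. instance_name g p \<Longrightarrow> solution_name h (H \<^bold>\<cdot> p) q \<Longrightarrow> solution_name g p (K \<^bold>\<cdot> interleave p q)"
proof -
  obtain H K where c: "continuous H" "continuous K" and
    *: "\<And>p. instance_name g p \<Longrightarrow> in_dom p H \<and> instance_name h (H \<^bold>\<cdot> p) \<and>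
        (\<forall>q. solution_name h (H \<^bold>\<cdot> p) q \<longrightarrow>
           in_dom (interleave p q) K \<and> solution_name g p (K \<^bold>\<cdot> interleave p q))"
    using assms unfolding le_W_cont_def reduces_via_def by blast
  show ?thesis
  proof (rule that[of H K])
    show "conti (instance_name g) (\<lambda>p. H \<^bold>\<cdot> p)"
      by (rule conti_cong[OF continuous_conti[OF c(1)]]) (use * in auto)
    show "conti (out_dom g h (\<lambda>p. H \<^bold>\<cdot> p)) (\<lambda>p. K \<^bold>\<cdot> p)"
      by (rule conti_cong[OF continuous_conti[OF c(2)]]) (use * in \<open>auto simp: out_dom_def\<close>)
  qed (use * in auto)
qed

text \<open>The last premise makes \<open>left\<close> and \<open>right\<close> recover the parts of
  an input of the composed backward map; \<open>solution_name\<close> alone does not place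
  \<open>q\<close> in Baire space, because \<open>k\<close> is not assumed to be a problem.\<close>

lemma le_W_cont_trans:
  assumes gh: "g \<le>\<^sub>W\<^sup>* h" and hk: "h \<le>\<^sub>W\<^sup>* k" and k: "\<And>p q. solution_name k p q \<Longrightarrow> q \<^bold>\<in> \<N>"
  shows "g \<le>\<^sub>W\<^sup>* k"
proof -
  obtain H K where HK: "conti (instance_name g) (\<lambda>p. H \<^bold>\<cdot> p)"
    "conti (out_dom g h (\<lambda>p. H \<^bold>\<cdot> p)) (\<lambda>p. K \<^bold>\<cdot> p)"
    "\<And>p. instance_name g p \<Longrightarrow> instance_name h (H \<^bold>\<cdot> p)"
    "\<And>p q. instance_name g p \<Longrightarrow> solution_name h (H \<^bold>\<cdot> p) q \<Longrightarrow> solution_name g p (K \<^bold>\<cdot> interleave p q)"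
    using le_W_contE[OF gh] by blast
  obtain H' K' where HK': "conti (instance_name h) (\<lambda>p. H' \<^bold>\<cdot> p)"
    "conti (out_dom h k (\<lambda>p. H' \<^bold>\<cdot> p)) (\<lambda>p. K' \<^bold>\<cdot> p)"
    "\<And>p. instance_name h p \<Longrightarrow> instance_name k (H' \<^bold>\<cdot> p)"
    "\<And>p q. instance_name h p \<Longrightarrow> solution_name k (H' \<^bold>\<cdot> p) q \<Longrightarrow> solution_name h p (K' \<^bold>\<cdot> interleave p q)"
    using le_W_contE[OF hk] by blast
  let ?H = "\<lambda>p. H' \<^bold>\<cdot> (H \<^bold>\<cdot> p)"
  \<comment> \<open>For \<open>x\<close> interleaving \<open>p\<close> and \<open>q\<close>,
    \<open>?in x\<close> is the input of the backward map of the second reduction, and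
    \<open>?mid x\<close> pairs \<open>p\<close> with the solution of \<open>h\<close> obtained from
    it.\<close>
  let ?in = "\<lambda>x. interleave (H \<^bold>\<cdot> left x) (right x)"
  let ?mid = "\<lambda>x. interleave (left x) (K' \<^bold>\<cdot> ?in x)"
  let ?D = "out_dom g k ?H"
  have D: "\<exists>p q. instance_name g p \<and> solution_name k (?H p) q \<and> x = interleave p q \<and>
      p \<^bold>\<in> \<N> \<and> q \<^bold>\<in> \<N>" if "?D x" for x
    using that k contiD(1)[OF HK(1)] unfolding out_dom_def by blast
  have DN: "x \<^bold>\<in> \<N>" and l: "instance_name g (left x)" and i: "out_dom h k (\<lambda>p. H' \<^bold>\<cdot> p) (?in x)"
    and m: "out_dom g h (\<lambda>p. H \<^bold>\<cdot> p) (?mid x)" if x: "?D x" for x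
  proof -
    obtain p q where pq: "instance_name g p" "solution_name k (?H p) q" "x = interleave p q"
      "p \<^bold>\<in> \<N>" "q \<^bold>\<in> \<N>" using D[OF x] by blast
    then have e: "left x = p" "right x = q" by simp_all
    show "x \<^bold>\<in> \<N>" "instance_name g (left x)" using pq e by simp_all
    show "out_dom h k (\<lambda>p. H' \<^bold>\<cdot> p) (?in x)"
      unfolding out_dom_def e using HK(3)[OF pq(1)] pq(2) by blast
    have "solution_name h (H \<^bold>\<cdot> p) (K' \<^bold>\<cdot> interleave (H \<^bold>\<cdot> p) q)"
      using HK'(4) HK(3)[OF pq(1)] pq(2) by blast
    then show "out_dom g h (\<lambda>p. H \<^bold>\<cdot> p) (?mid x)"
      unfolding out_dom_def e using pq(1) by blast
  qed
  show ?thesis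
  proof (rule le_W_contI[of ?H "\<lambda>x. K \<^bold>\<cdot> ?mid x"])
    show "defop ?H" "defop (\<lambda>x. K \<^bold>\<cdot> ?mid x)"
      by (rule defopI, intro definable_intros)+
    show "conti (instance_name g) ?H"
      by (rule conti_comp[OF HK(1) HK'(1)]) (rule HK(3))
    have cl: "conti ?D left" "conti ?D right" using DN by (auto intro: conti_left conti_right)
    have "conti ?D (\<lambda>x. H \<^bold>\<cdot> left x)" by (rule conti_comp[OF cl(1) HK(1)]) (rule l)
    then have "conti ?D ?in" by (rule conti_interleave[OF _ cl(2)])
    then have "conti ?D (\<lambda>x. K' \<^bold>\<cdot> ?in x)" by (rule conti_comp[OF _ HK'(2)]) (rule i)
    then have "conti ?D ?mid" by (rule conti_interleave[OF cl(1)])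
    then show "conti ?D (\<lambda>x. K \<^bold>\<cdot> ?mid x)" by (rule conti_comp[OF _ HK(2)]) (rule m)
    show "instance_name k (?H p)" if "instance_name g p" for p
      using that HK(3) HK'(3) by blast
    show "solution_name g p (K \<^bold>\<cdot> ?mid (interleave p q))"
      if p: "instance_name g p" and q: "solution_name k (?H p) q" for p q
      using p q HK(3)[OF p] HK'(4) HK(4)[OF p] contiD(1)[OF HK(1) p] k[OF q] by simp
  qed
qed


subsection \<open>Partial recursive functionals\<close>

text \<open>All functionals are subsets of this set, so a definable class of functionals is a set
  cut out of its power set.\<close>

definition ambient :: 'v where
  "ambient = cart (cart \<N> \<omega>) \<omega>"

definition defpred3 :: "('v \<Rightarrow> 'v \<Rightarrow> 'v \<Rightarrow> bool) \<Rightarrow> bool" where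
  "defpred3 G \<longleftrightarrow> definable (\<lambda>e. G (e 0) (e 1) (e 2))"

text \<open>The defining relations mention \<open>npair\<close>, which is under control only on
  naturals. The definable \<open>G'\<close> replaces \<open>G\<close> and has to agree with it only
  on legitimate arguments.\<close>

lemma functional_char:
  assumes d: "defpred3 G'"
    and eq: "\<And>p n m. p \<^bold>\<in> \<N> \<Longrightarrow> n \<^bold>\<in> \<omega> \<Longrightarrow> m \<^bold>\<in> \<omega> \<Longrightarrow> G p n m \<longleftrightarrow> G' p n m"
  shows "functional G \<^bold>\<subseteq> ambient"
    and "val (functional G) p n m \<longleftrightarrow> p \<^bold>\<in> \<N> \<and> n \<^bold>\<in> \<omega> \<and> m \<^bold>\<in> \<omega> \<and> G p n m"
proof -
  let ?Q = "\<lambda>z. \<exists>p n m. p \<^bold>\<in> \<N> \<and> n \<^bold>\<in> \<omega> \<and> m \<^bold>\<in> \<omega> \<and> G' p n m \<and> z = \<^bold>\<langle>\<^bold>\<langle>p, n\<^bold>\<rangle>, m\<^bold>\<rangle>"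
  have d': "definable (\<lambda>e. G' (e (Suc (Suc 0))) (e (Suc 0)) (e 0))"
    using definable_rename[OF d[unfolded defpred3_def], of "\<lambda>n. 2 - n"] by (simp add: numeral_2_eq_2)
  have Q: "defpred ?Q"
    unfolding defpred_def by (intro definable_intros d')
  have "(\<lambda>z. \<exists>p n m. p \<^bold>\<in> \<N> \<and> n \<^bold>\<in> \<omega> \<and> m \<^bold>\<in> \<omega> \<and> G p n m \<and> z = \<^bold>\<langle>\<^bold>\<langle>p, n\<^bold>\<rangle>, m\<^bold>\<rangle>) = ?Q"
    using eq by (intro ext ex_cong1) blast
  then have f: "functional G = collect ?Q" unfolding functional_def by simp
  have mem: "z \<^bold>\<in> functional G \<longleftrightarrow> ?Q z" for z
    unfolding f by (rule mem_collect_sub[OF Q, of ambient]) (auto simp: ambient_def mem_cart)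
  show "functional G \<^bold>\<subseteq> ambient"
    unfolding subset_def mem ambient_def mem_cart by blast
  show "val (functional G) p n m \<longleftrightarrow> p \<^bold>\<in> \<N> \<and> n \<^bold>\<in> \<omega> \<and> m \<^bold>\<in> \<omega> \<and> G p n m"
    unfolding val_def mem opair_eq using eq by blast
qed

lemma definable_val [definable_intros]:
  assumes "defterm f" "defterm p" "defterm n" "defterm m"
  shows "definable (\<lambda>e. val (f e) (p e) (n e) (m e))"
  unfolding val_def by (intro definable_intros assms)

lemma definable_maps [definable_intros]:
  assumes "defterm f" "defterm a" "defterm b" shows "definable (\<lambda>e. maps (f e) (a e) (b e))"
  unfolding def_unfolds by (intro definable_intros defterm_weaken assms)

lemma
  shows rf_zero_ambient: "rf_zero \<^bold>\<subseteq> ambient"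
    and val_rf_zero: "val rf_zero p n m \<longleftrightarrow> p \<^bold>\<in> \<N> \<and> n \<^bold>\<in> \<omega> \<and> m \<^bold>\<in> \<omega> \<and> m = \<^bold>0"
  unfolding rf_zero_def by (rule functional_char[OF _ refl], unfold defpred3_def, intro definable_intros)+

lemma
  shows rf_succ_ambient: "rf_succ \<^bold>\<subseteq> ambient"
    and val_rf_succ: "val rf_succ p n m \<longleftrightarrow> p \<^bold>\<in> \<N> \<and> n \<^bold>\<in> \<omega> \<and> m \<^bold>\<in> \<omega> \<and> m = succ n"
  unfolding rf_succ_def by (rule functional_char[OF _ refl], unfold defpred3_def, intro definable_intros)+

lemma
  shows rf_oracle_ambient: "rf_oracle \<^bold>\<subseteq> ambient"
    and val_rf_oracle: "val rf_oracle p n m \<longleftrightarrow> p \<^bold>\<in> \<N> \<and> n \<^bold>\<in> \<omega> \<and> m \<^bold>\<in> \<omega> \<and> m = p \<^bold>\<cdot> n"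
  unfolding rf_oracle_def by (rule functional_char[OF _ refl], unfold defpred3_def, intro definable_intros)+

lemma
  shows rf_left_ambient: "rf_left \<^bold>\<subseteq> ambient"
    and val_rf_left: "val rf_left p n m \<longleftrightarrow> p \<^bold>\<in> \<N> \<and> n \<^bold>\<in> \<omega> \<and> m \<^bold>\<in> \<omega> \<and> (\<exists>k. k \<^bold>\<in> \<omega> \<and> n = npair m k)"
proof -
  have d: "defpred3 (\<lambda>p n m. \<exists>k. k \<^bold>\<in> \<omega> \<and> n = npairo m k)"
    unfolding defpred3_def by (intro definable_intros)
  have e: "(\<exists>k. k \<^bold>\<in> \<omega> \<and> n = npair m k) \<longleftrightarrow> (\<exists>k. k \<^bold>\<in> \<omega> \<and> n = npairo m k)" if "m \<^bold>\<in> \<omega>" for n m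
    using that by auto
  show "rf_left \<^bold>\<subseteq> ambient"
    "val rf_left p n m \<longleftrightarrow> p \<^bold>\<in> \<N> \<and> n \<^bold>\<in> \<omega> \<and> m \<^bold>\<in> \<omega> \<and> (\<exists>k. k \<^bold>\<in> \<omega> \<and> n = npair m k)"
    unfolding rf_left_def by (rule functional_char[OF d], rule e, assumption)+
qed

lemma
  shows rf_right_ambient: "rf_right \<^bold>\<subseteq> ambient"
    and val_rf_right: "val rf_right p n m \<longleftrightarrow> p \<^bold>\<in> \<N> \<and> n \<^bold>\<in> \<omega> \<and> m \<^bold>\<in> \<omega> \<and> (\<exists>k. k \<^bold>\<in> \<omega> \<and> n = npair k m)"
proof -
  have d: "defpred3 (\<lambda>p n m. \<exists>k. k \<^bold>\<in> \<omega> \<and> n = npairo k m)"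
    unfolding defpred3_def by (intro definable_intros)
  have e: "(\<exists>k. k \<^bold>\<in> \<omega> \<and> n = npair k m) \<longleftrightarrow> (\<exists>k. k \<^bold>\<in> \<omega> \<and> n = npairo k m)" if "m \<^bold>\<in> \<omega>" for n m
    using that by auto
  show "rf_right \<^bold>\<subseteq> ambient"
    "val rf_right p n m \<longleftrightarrow> p \<^bold>\<in> \<N> \<and> n \<^bold>\<in> \<omega> \<and> m \<^bold>\<in> \<omega> \<and> (\<exists>k. k \<^bold>\<in> \<omega> \<and> n = npair k m)"
    unfolding rf_right_def by (rule functional_char[OF d], rule e, assumption)+
qed

lemma val_omega: "val \<Phi> p n m \<Longrightarrow> m \<^bold>\<in> \<omega>"
  by (simp add: val_def)

lemma
  shows rf_pair_ambient: "rf_pair \<Phi> \<Psi> \<^bold>\<subseteq> ambient"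
    and val_rf_pair: "val (rf_pair \<Phi> \<Psi>) p n m \<longleftrightarrow> p \<^bold>\<in> \<N> \<and> n \<^bold>\<in> \<omega> \<and> m \<^bold>\<in> \<omega> \<and>
      (\<exists>a b. val \<Phi> p n a \<and> val \<Psi> p n b \<and> m = npair a b)"
proof -
  have d: "defpred3 (\<lambda>p n m. \<exists>a b. val \<Phi> p n a \<and> val \<Psi> p n b \<and> m = npairo a b)"
    unfolding defpred3_def by (intro definable_intros)
  have e: "(\<exists>a b. val \<Phi> p n a \<and> val \<Psi> p n b \<and> m = npair a b) \<longleftrightarrow>
    (\<exists>a b. val \<Phi> p n a \<and> val \<Psi> p n b \<and> m = npairo a b)" for p n m
    by (intro ex_cong1) (metis val_omega npairo_eq)
  show "rf_pair \<Phi> \<Psi> \<^bold>\<subseteq> ambient"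
    "val (rf_pair \<Phi> \<Psi>) p n m \<longleftrightarrow> p \<^bold>\<in> \<N> \<and> n \<^bold>\<in> \<omega> \<and> m \<^bold>\<in> \<omega> \<and>
      (\<exists>a b. val \<Phi> p n a \<and> val \<Psi> p n b \<and> m = npair a b)"
    unfolding rf_pair_def by (rule functional_char[OF d], rule e)+
qed

lemma
  shows rf_comp_ambient: "rf_comp \<Phi> \<Psi> \<^bold>\<subseteq> ambient"
    and val_rf_comp: "val (rf_comp \<Phi> \<Psi>) p n m \<longleftrightarrow> p \<^bold>\<in> \<N> \<and> n \<^bold>\<in> \<omega> \<and> m \<^bold>\<in> \<omega> \<and>
      (\<exists>a. val \<Psi> p n a \<and> val \<Phi> p a m)"
  unfolding rf_comp_def by (rule functional_char[OF _ refl], unfold defpred3_def, intro definable_intros)+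

definition prec_run :: "'v \<Rightarrow> 'v \<Rightarrow> 'v \<Rightarrow> 'v \<Rightarrow> 'v \<Rightarrow> 'v \<Rightarrow> bool" where
  "prec_run \<Phi> \<Psi> p a k s \<longleftrightarrow> maps s (succ k) \<omega> \<and> val \<Phi> p a (s \<^bold>\<cdot> \<^bold>0) \<and>
     (\<forall>j. j \<^bold>\<in> k \<longrightarrow> val \<Psi> p (npair a (npair j (s \<^bold>\<cdot> j))) (s \<^bold>\<cdot> succ j))"

lemma prec_run_npairo:
  assumes "a \<^bold>\<in> \<omega>" "k \<^bold>\<in> \<omega>"
  shows "prec_run \<Phi> \<Psi> p a k s \<longleftrightarrow> maps s (succ k) \<omega> \<and> val \<Phi> p a (s \<^bold>\<cdot> \<^bold>0) \<and>
     (\<forall>j. j \<^bold>\<in> k \<longrightarrow> val \<Psi> p (npairo a (npairo j (s \<^bold>\<cdot> j))) (s \<^bold>\<cdot> succ j))"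
proof -
  have "npairo a (npairo j (s \<^bold>\<cdot> j)) = npair a (npair j (s \<^bold>\<cdot> j))" if "maps s (succ k) \<omega>" "j \<^bold>\<in> k" for j
    using assms maps_app[OF that(1), of j] omega_mem[OF assms(2) that(2)] that(2) by simp
  then show ?thesis unfolding prec_run_def by auto
qed

lemma
  shows rf_prec_ambient: "rf_prec \<Phi> \<Psi> \<^bold>\<subseteq> ambient"
    and val_rf_prec: "val (rf_prec \<Phi> \<Psi>) p n m \<longleftrightarrow> p \<^bold>\<in> \<N> \<and> n \<^bold>\<in> \<omega> \<and> m \<^bold>\<in> \<omega> \<and>
      (\<exists>a k s. a \<^bold>\<in> \<omega> \<and> k \<^bold>\<in> \<omega> \<and> n = npair a k \<and> prec_run \<Phi> \<Psi> p a k s \<and> m = s \<^bold>\<cdot> k)"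
proof -
  have d: "defpred3 (\<lambda>p n m. \<exists>a k s. a \<^bold>\<in> \<omega> \<and> k \<^bold>\<in> \<omega> \<and> n = npairo a k \<and>
      (maps s (succ k) \<omega> \<and> val \<Phi> p a (s \<^bold>\<cdot> \<^bold>0) \<and>
      (\<forall>j. j \<^bold>\<in> k \<longrightarrow> val \<Psi> p (npairo a (npairo j (s \<^bold>\<cdot> j))) (s \<^bold>\<cdot> succ j))) \<and> m = s \<^bold>\<cdot> k)"
    unfolding defpred3_def by (intro definable_intros)
  have r: "rf_prec \<Phi> \<Psi> = functional (\<lambda>p n m. \<exists>a k s. a \<^bold>\<in> \<omega> \<and> k \<^bold>\<in> \<omega> \<and> n = npair a k \<and>
      prec_run \<Phi> \<Psi> p a k s \<and> m = s \<^bold>\<cdot> k)"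
    unfolding rf_prec_def prec_run_def by (simp only: conj_assoc)
  have e: "(\<exists>a k s. a \<^bold>\<in> \<omega> \<and> k \<^bold>\<in> \<omega> \<and> n = npair a k \<and> prec_run \<Phi> \<Psi> p a k s \<and> m = s \<^bold>\<cdot> k) \<longleftrightarrow>
    (\<exists>a k s. a \<^bold>\<in> \<omega> \<and> k \<^bold>\<in> \<omega> \<and> n = npairo a k \<and>
      (maps s (succ k) \<omega> \<and> val \<Phi> p a (s \<^bold>\<cdot> \<^bold>0) \<and>
      (\<forall>j. j \<^bold>\<in> k \<longrightarrow> val \<Psi> p (npairo a (npairo j (s \<^bold>\<cdot> j))) (s \<^bold>\<cdot> succ j))) \<and> m = s \<^bold>\<cdot> k)" for p n m
    by (intro ex_cong1 conj_cong refl) (simp_all only: npairo_eq prec_run_npairo)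
  show "rf_prec \<Phi> \<Psi> \<^bold>\<subseteq> ambient"
    "val (rf_prec \<Phi> \<Psi>) p n m \<longleftrightarrow> p \<^bold>\<in> \<N> \<and> n \<^bold>\<in> \<omega> \<and> m \<^bold>\<in> \<omega> \<and>
      (\<exists>a k s. a \<^bold>\<in> \<omega> \<and> k \<^bold>\<in> \<omega> \<and> n = npair a k \<and> prec_run \<Phi> \<Psi> p a k s \<and> m = s \<^bold>\<cdot> k)"
    unfolding r by (rule functional_char[OF d], rule e)+
qed

lemma
  shows rf_mu_ambient: "rf_mu \<Phi> \<^bold>\<subseteq> ambient"
    and val_rf_mu: "val (rf_mu \<Phi>) p n m \<longleftrightarrow> p \<^bold>\<in> \<N> \<and> n \<^bold>\<in> \<omega> \<and> m \<^bold>\<in> \<omega> \<and>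
      val \<Phi> p (npair n m) \<^bold>0 \<and> (\<forall>j. j \<^bold>\<in> m \<longrightarrow> (\<exists>v. val \<Phi> p (npair n j) v \<and> v \<noteq> \<^bold>0))"
proof -
  have d: "defpred3 (\<lambda>p n m. val \<Phi> p (npairo n m) \<^bold>0 \<and>
      (\<forall>j. j \<^bold>\<in> m \<longrightarrow> (\<exists>v. val \<Phi> p (npairo n j) v \<and> v \<noteq> \<^bold>0)))"
    unfolding defpred3_def by (intro definable_intros)
  have e: "(val \<Phi> p (npair n m) \<^bold>0 \<and> (\<forall>j. j \<^bold>\<in> m \<longrightarrow> (\<exists>v. val \<Phi> p (npair n j) v \<and> v \<noteq> \<^bold>0))) \<longleftrightarrow>
    (val \<Phi> p (npairo n m) \<^bold>0 \<and> (\<forall>j. j \<^bold>\<in> m \<longrightarrow> (\<exists>v. val \<Phi> p (npairo n j) v \<and> v \<noteq> \<^bold>0)))"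
    if "n \<^bold>\<in> \<omega>" "m \<^bold>\<in> \<omega>" for p n m
    using that omega_mem[OF that(2)] by auto
  show "rf_mu \<Phi> \<^bold>\<subseteq> ambient"
    "val (rf_mu \<Phi>) p n m \<longleftrightarrow> p \<^bold>\<in> \<N> \<and> n \<^bold>\<in> \<omega> \<and> m \<^bold>\<in> \<omega> \<and>
      val \<Phi> p (npair n m) \<^bold>0 \<and> (\<forall>j. j \<^bold>\<in> m \<longrightarrow> (\<exists>v. val \<Phi> p (npair n j) v \<and> v \<noteq> \<^bold>0))"
    unfolding rf_mu_def by (rule functional_char[OF d], rule e, assumption+)+
qed

subsection \<open>Computable functions are continuous\<close>

text \<open>The invariant of Kleene's schemes: values are unique and are decided by a finite prefix
  of the oracle. Uniqueness is part of it because two oracles with a common prefix must be shown to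
  give the same output.\<close>

definition locally_determined :: "'v \<Rightarrow> bool" where
  "locally_determined \<Phi> \<longleftrightarrow> \<Phi> \<^bold>\<subseteq> ambient \<and>
     (\<forall>p n m m'. val \<Phi> p n m \<and> val \<Phi> p n m' \<longrightarrow> m = m') \<and>
     (\<forall>p n m. val \<Phi> p n m \<longrightarrow> (\<exists>k. k \<^bold>\<in> \<omega> \<and> (\<forall>p'. p' \<^bold>\<in> \<N> \<and> agree k p' p \<longrightarrow> val \<Phi> p' n m)))"

lemma val_ambient: "\<Phi> \<^bold>\<subseteq> ambient \<Longrightarrow> val \<Phi> p n m \<Longrightarrow> p \<^bold>\<in> \<N> \<and> n \<^bold>\<in> \<omega> \<and> m \<^bold>\<in> \<omega>"
  unfolding subset_def val_def ambient_def mem_cart by (metis opair_eq)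

lemma locally_determinedI:
  assumes "\<Phi> \<^bold>\<subseteq> ambient" "\<And>p n m m'. val \<Phi> p n m \<Longrightarrow> val \<Phi> p n m' \<Longrightarrow> m = m'"
    "\<And>p n m. val \<Phi> p n m \<Longrightarrow> \<exists>k. k \<^bold>\<in> \<omega> \<and> (\<forall>p'. p' \<^bold>\<in> \<N> \<and> agree k p' p \<longrightarrow> val \<Phi> p' n m)"
  shows "locally_determined \<Phi>"
  using assms unfolding locally_determined_def by blast

lemma locally_determinedD:
  assumes "locally_determined \<Phi>"
  shows "\<Phi> \<^bold>\<subseteq> ambient" "\<And>p n m m'. val \<Phi> p n m \<Longrightarrow> val \<Phi> p n m' \<Longrightarrow> m = m'"
    "\<And>p n m. val \<Phi> p n m \<Longrightarrow> p \<^bold>\<in> \<N> \<and> n \<^bold>\<in> \<omega> \<and> m \<^bold>\<in> \<omega>"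
    "\<And>p n m. val \<Phi> p n m \<Longrightarrow> \<exists>k. k \<^bold>\<in> \<omega> \<and> (\<forall>p'. p' \<^bold>\<in> \<N> \<and> agree k p' p \<longrightarrow> val \<Phi> p' n m)"
  using assms val_ambient unfolding locally_determined_def by blast+

lemma locally_determined_pair2:
  assumes "locally_determined \<Phi>" "locally_determined \<Psi>" "val \<Phi> p n m" "val \<Psi> p n' m'"
  shows "\<exists>k. k \<^bold>\<in> \<omega> \<and> (\<forall>p'. p' \<^bold>\<in> \<N> \<and> agree k p' p \<longrightarrow> val \<Phi> p' n m \<and> val \<Psi> p' n' m')"
proof -
  obtain k where k: "k \<^bold>\<in> \<omega>" "\<And>p'. p' \<^bold>\<in> \<N> \<Longrightarrow> agree k p' p \<Longrightarrow> val \<Phi> p' n m"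
    using locally_determinedD(4)[OF assms(1,3)] by blast
  obtain l where l: "l \<^bold>\<in> \<omega>" "\<And>p'. p' \<^bold>\<in> \<N> \<Longrightarrow> agree l p' p \<Longrightarrow> val \<Psi> p' n' m'"
    using locally_determinedD(4)[OF assms(2,4)] by blast
  obtain m where m: "m \<^bold>\<in> \<omega>" "k \<^bold>\<in> succ m" "l \<^bold>\<in> succ m" using omega_max[OF k(1) l(1)] by blast
  show ?thesis
    using m(1) k(2) l(2) agree_mono[OF m(1) m(2)] agree_mono[OF m(1) m(3)] by blast
qed

lemma locally_determined_basic:
  "locally_determined rf_zero" "locally_determined rf_succ" "locally_determined rf_left"
  "locally_determined rf_right" "locally_determined rf_oracle"
proof -
  show "locally_determined rf_zero"
    by (rule locally_determinedI[OF rf_zero_ambient]) (auto simp: val_rf_zero intro!: exI[of _ "\<^bold>0"])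
  show "locally_determined rf_succ"
    by (rule locally_determinedI[OF rf_succ_ambient]) (auto simp: val_rf_succ intro!: exI[of _ "\<^bold>0"])
  show "locally_determined rf_left"
    by (rule locally_determinedI[OF rf_left_ambient])
      (auto simp: val_rf_left npair_inject intro!: exI[of _ "\<^bold>0"])
  show "locally_determined rf_right"
    by (rule locally_determinedI[OF rf_right_ambient])
      (auto simp: val_rf_right npair_inject intro!: exI[of _ "\<^bold>0"])
  \<comment> \<open>Among the basic functionals only this one reads the oracle; it reads position
    \<open>n\<close>, hence the prefix length \<open>succ n\<close>.\<close>
  show "locally_determined rf_oracle"
  proof (rule locally_determinedI[OF rf_oracle_ambient])
    fix p n m assume "val rf_oracle p n m"
    then show "\<exists>k. k \<^bold>\<in> \<omega> \<and> (\<forall>p'. p' \<^bold>\<in> \<N> \<and> agree k p' p \<longrightarrow> val rf_oracle p' n m)"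
      by (intro exI[of _ "succ n"]) (auto simp: val_rf_oracle agree_def)
  qed (simp add: val_rf_oracle)
qed

lemma locally_determined_pair:
  assumes "locally_determined \<Phi>" "locally_determined \<Psi>" shows "locally_determined (rf_pair \<Phi> \<Psi>)"
proof (rule locally_determinedI[OF rf_pair_ambient])
  fix p n m m' assume "val (rf_pair \<Phi> \<Psi>) p n m" "val (rf_pair \<Phi> \<Psi>) p n m'"
  then show "m = m'"
    unfolding val_rf_pair using locally_determinedD(2)[OF assms(1)] locally_determinedD(2)[OF assms(2)] by metis
next
  fix p n m assume v: "val (rf_pair \<Phi> \<Psi>) p n m"
  then obtain a b where ab: "val \<Phi> p n a" "val \<Psi> p n b" "m = npair a b" unfolding val_rf_pair by blast
  show "\<exists>k. k \<^bold>\<in> \<omega> \<and> (\<forall>p'. p' \<^bold>\<in> \<N> \<and> agree k p' p \<longrightarrow> val (rf_pair \<Phi> \<Psi>) p' n m)"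
    using locally_determined_pair2[OF assms ab(1,2)] ab(3) v unfolding val_rf_pair by blast
qed

lemma locally_determined_comp:
  assumes "locally_determined \<Phi>" "locally_determined \<Psi>" shows "locally_determined (rf_comp \<Phi> \<Psi>)"
proof (rule locally_determinedI[OF rf_comp_ambient])
  fix p n m m' assume "val (rf_comp \<Phi> \<Psi>) p n m" "val (rf_comp \<Phi> \<Psi>) p n m'"
  then show "m = m'"
    unfolding val_rf_comp using locally_determinedD(2)[OF assms(1)] locally_determinedD(2)[OF assms(2)] by metis
next
  fix p n m assume v: "val (rf_comp \<Phi> \<Psi>) p n m"
  then obtain a where a: "val \<Psi> p n a" "val \<Phi> p a m" unfolding val_rf_comp by blast
  show "\<exists>k. k \<^bold>\<in> \<omega> \<and> (\<forall>p'. p' \<^bold>\<in> \<N> \<and> agree k p' p \<longrightarrow> val (rf_comp \<Phi> \<Psi>) p' n m)"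
    using locally_determined_pair2[OF assms a(2,1)] v unfolding val_rf_comp by blast
qed

lemma prec_run_unique:
  assumes "locally_determined \<Phi>" "locally_determined \<Psi>" and k: "k \<^bold>\<in> \<omega>"
    and s: "prec_run \<Phi> \<Psi> p a k s" "prec_run \<Phi> \<Psi> p a k s'"
  shows "s \<^bold>\<cdot> k = s' \<^bold>\<cdot> k"
proof -
  have "j \<^bold>\<in> \<omega> \<Longrightarrow> j \<^bold>\<in> succ k \<longrightarrow> s \<^bold>\<cdot> j = s' \<^bold>\<cdot> j" for j
  proof (induction rule: omega_induct)
    case zero
    then show ?case using s locally_determinedD(2)[OF assms(1)] unfolding prec_run_def by blast
  next
    case (succ j)
    show ?case
    proof
      assume "succ j \<^bold>\<in> succ k"
      then have j: "j \<^bold>\<in> k" using succ_mem_iff k succ.hyps by blast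
      then have "s \<^bold>\<cdot> j = s' \<^bold>\<cdot> j" using succ.IH by simp
      then show "s \<^bold>\<cdot> succ j = s' \<^bold>\<cdot> succ j"
        using s j locally_determinedD(2)[OF assms(2)] unfolding prec_run_def by metis
    qed
  next
    case definable
    show ?case unfolding defpred_def by (intro definable_intros)
  qed
  with k show ?thesis by simp
qed

lemma locally_determined_prec:
  assumes "locally_determined \<Phi>" "locally_determined \<Psi>" shows "locally_determined (rf_prec \<Phi> \<Psi>)"
proof (rule locally_determinedI[OF rf_prec_ambient])
  fix p n m m' assume "val (rf_prec \<Phi> \<Psi>) p n m" "val (rf_prec \<Phi> \<Psi>) p n m'"
  then obtain a k s a' k' s' where
    "a \<^bold>\<in> \<omega>" "k \<^bold>\<in> \<omega>" "n = npair a k" "prec_run \<Phi> \<Psi> p a k s" "m = s \<^bold>\<cdot> k"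
    "a' \<^bold>\<in> \<omega>" "k' \<^bold>\<in> \<omega>" "n = npair a' k'" "prec_run \<Phi> \<Psi> p a' k' s'" "m' = s' \<^bold>\<cdot> k'"
    unfolding val_rf_prec by blast
  moreover from this have "a' = a" "k' = k" using npair_inject by metis+
  ultimately show "m = m'" using prec_run_unique[OF assms] by blast
next
  fix p n m assume v: "val (rf_prec \<Phi> \<Psi>) p n m"
  then obtain a k s where as: "a \<^bold>\<in> \<omega>" "k \<^bold>\<in> \<omega>" "n = npair a k" "prec_run \<Phi> \<Psi> p a k s" "m = s \<^bold>\<cdot> k"
    unfolding val_rf_prec by blast
  \<comment> \<open>The same run \<open>s\<close> is to witness the value for every nearby oracle,
    so a prefix is needed that preserves all of its steps at once.\<close>
  let ?R = "\<lambda>j M. \<forall>p'. p' \<^bold>\<in> \<N> \<and> agree M p' p \<longrightarrow> val \<Psi> p' (npairo a (npairo j (s \<^bold>\<cdot> j))) (s \<^bold>\<cdot> succ j)"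
  have run: "maps s (succ k) \<omega>" "val \<Phi> p a (s \<^bold>\<cdot> \<^bold>0)"
    "\<And>j. j \<^bold>\<in> k \<Longrightarrow> val \<Psi> p (npairo a (npairo j (s \<^bold>\<cdot> j))) (s \<^bold>\<cdot> succ j)"
    using as(4) unfolding prec_run_npairo[OF as(1,2)] by blast+
  have "defpred2 ?R" unfolding defpred2_def by (intro definable_intros)
  then obtain M where M: "M \<^bold>\<in> \<omega>" "\<And>j. j \<^bold>\<in> k \<Longrightarrow> ?R j M"
  proof (rule omega_bounding[OF _ as(2)])
    show "\<exists>m. m \<^bold>\<in> \<omega> \<and> ?R j m" if "j \<^bold>\<in> k" for j
      using locally_determinedD(4)[OF assms(2) run(3)[OF that]] .
    show "?R j m'" if "?R j m" "m \<^bold>\<in> \<omega>" "m' \<^bold>\<in> \<omega>" "m \<^bold>\<in> succ m'" for j m m'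
      using that(1) agree_mono[OF that(3,4)] by blast
  qed blast
  obtain L where L: "L \<^bold>\<in> \<omega>" "\<And>p'. p' \<^bold>\<in> \<N> \<Longrightarrow> agree L p' p \<Longrightarrow> val \<Phi> p' a (s \<^bold>\<cdot> \<^bold>0)"
    using locally_determinedD(4)[OF assms(1) run(2)] by blast
  obtain K where K: "K \<^bold>\<in> \<omega>" "M \<^bold>\<in> succ K" "L \<^bold>\<in> succ K" using omega_max[OF M(1) L(1)] by blast
  have "prec_run \<Phi> \<Psi> p' a k s" if "p' \<^bold>\<in> \<N>" "agree K p' p" for p'
    unfolding prec_run_npairo[OF as(1,2)]
    using run(1) L(2)[OF that(1) agree_mono[OF K(1,3) that(2)]] M(2) that(1) agree_mono[OF K(1,2) that(2)] by blast
  then show "\<exists>k. k \<^bold>\<in> \<omega> \<and> (\<forall>p'. p' \<^bold>\<in> \<N> \<and> agree k p' p \<longrightarrow> val (rf_prec \<Phi> \<Psi>) p' n m)"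
    using K(1) v as unfolding val_rf_prec by blast
qed

lemma locally_determined_mu:
  assumes "locally_determined \<Phi>" shows "locally_determined (rf_mu \<Phi>)"
proof (rule locally_determinedI[OF rf_mu_ambient])
  fix p n m m' assume v: "val (rf_mu \<Phi>) p n m" "val (rf_mu \<Phi>) p n m'"
  have "\<not> m \<^bold>\<in> m'" "\<not> m' \<^bold>\<in> m"
    using v locally_determinedD(2)[OF assms] unfolding val_rf_mu by blast+
  then show "m = m'" using v omega_linear unfolding val_rf_mu by blast
next
  fix p n m assume v: "val (rf_mu \<Phi>) p n m"
  then have *: "n \<^bold>\<in> \<omega>" "m \<^bold>\<in> \<omega>" "val \<Phi> p (npair n m) \<^bold>0"
    "\<And>j. j \<^bold>\<in> m \<Longrightarrow> \<exists>v. val \<Phi> p (npair n j) v \<and> v \<noteq> \<^bold>0"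
    unfolding val_rf_mu by blast+
  \<comment> \<open>The value \<open>v\<close> is chosen before the nearby oracles, which makes the
    relation monotone in the prefix length and thus fit for bounding.\<close>
  let ?R = "\<lambda>j M. \<exists>v. v \<noteq> \<^bold>0 \<and> (\<forall>p'. p' \<^bold>\<in> \<N> \<and> agree M p' p \<longrightarrow> val \<Phi> p' (npairo n j) v)"
  have "defpred2 ?R" unfolding defpred2_def by (intro definable_intros)
  then obtain M where M: "M \<^bold>\<in> \<omega>" "\<And>j. j \<^bold>\<in> m \<Longrightarrow> ?R j M"
  proof (rule omega_bounding[OF _ *(2)])
    show "\<exists>M. M \<^bold>\<in> \<omega> \<and> ?R j M" if j: "j \<^bold>\<in> m" for j
    proof -
      obtain v where "val \<Phi> p (npairo n j) v" "v \<noteq> \<^bold>0"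
        using *(4)[OF j] *(1) omega_mem[OF *(2) j] by auto
      then show ?thesis using locally_determinedD(4)[OF assms] by blast
    qed
    show "?R j m'" if "?R j m" "m \<^bold>\<in> \<omega>" "m' \<^bold>\<in> \<omega>" "m \<^bold>\<in> succ m'" for j m m'
      using that(1) agree_mono[OF that(3,4)] by blast
  qed blast
  obtain L where L: "L \<^bold>\<in> \<omega>" "\<And>p'. p' \<^bold>\<in> \<N> \<Longrightarrow> agree L p' p \<Longrightarrow> val \<Phi> p' (npair n m) \<^bold>0"
    using locally_determinedD(4)[OF assms *(3)] by blast
  obtain K where K: "K \<^bold>\<in> \<omega>" "M \<^bold>\<in> succ K" "L \<^bold>\<in> succ K" using omega_max[OF M(1) L(1)] by blast
  have "val (rf_mu \<Phi>) p' n m" if "p' \<^bold>\<in> \<N>" "agree K p' p" for p'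
  proof -
    have "\<exists>v. val \<Phi> p' (npair n j) v \<and> v \<noteq> \<^bold>0" if j: "j \<^bold>\<in> m" for j
      using M(2)[OF j] \<open>p' \<^bold>\<in> \<N>\<close> agree_mono[OF K(1,2) \<open>agree K p' p\<close>] *(1) omega_mem[OF *(2) j] by auto
    then show ?thesis unfolding val_rf_mu
      using * that(1) L(2)[OF that(1) agree_mono[OF K(1,3) that(2)]] by blast
  qed
  then show "\<exists>k. k \<^bold>\<in> \<omega> \<and> (\<forall>p'. p' \<^bold>\<in> \<N> \<and> agree k p' p \<longrightarrow> val (rf_mu \<Phi>) p' n m)"
    using K(1) by blast
qed

text \<open>Recursive functionals belong to every closed set, so it suffices that the locally
  determined ones form a set and that it is closed under the schemes.\<close>

lemma recursive_functional_locally_determined: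
  assumes "recursive_functional \<Phi>" shows "locally_determined \<Phi>"
proof -
  have d: "defpred locally_determined"
    unfolding defpred_def locally_determined_def subset_def by (intro definable_intros)
  let ?C = "collect locally_determined"
  have C: "\<Psi> \<^bold>\<in> ?C \<longleftrightarrow> locally_determined \<Psi>" for \<Psi>
    by (rule mem_collect_sub[OF d, of "powerset ambient"]) (simp add: mem_powerset locally_determinedD(1))
  have "rf_closed ?C"
    unfolding rf_closed_def C
    by (simp add: locally_determined_basic locally_determined_pair locally_determined_comp
      locally_determined_prec locally_determined_mu)
  with assms have "\<Phi> \<^bold>\<in> ?C" unfolding recursive_functional_def by blast
  then show ?thesis unfolding C .
qed

lemma computable_continuous: assumes "computable F" shows "continuous F"
proof -
  obtain \<Phi> where \<Phi>: "recursive_functional \<Phi>"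
    "\<And>p q n. \<^bold>\<langle>p, q\<^bold>\<rangle> \<^bold>\<in> F \<Longrightarrow> n \<^bold>\<in> \<omega> \<Longrightarrow> val \<Phi> p n (q \<^bold>\<cdot> n)" and F: "partial_maps F \<N> \<N>"
    using assms unfolding computable_def by blast
  have ld: "locally_determined \<Phi>" by (rule recursive_functional_locally_determined[OF \<Phi>(1)])
  have FN: "p \<^bold>\<in> \<N>" "q \<^bold>\<in> \<N>" if "\<^bold>\<langle>p, q\<^bold>\<rangle> \<^bold>\<in> F" for p q
    using F that unfolding partial_maps_def by blast+
  have "\<exists>m. m \<^bold>\<in> \<omega> \<and> (\<forall>p' q'. \<^bold>\<langle>p', q'\<^bold>\<rangle> \<^bold>\<in> F \<and> p' \<^bold>\<restriction> m = p \<^bold>\<restriction> m \<longrightarrow> q' \<^bold>\<restriction> n = q \<^bold>\<restriction> n)"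
    if pq: "\<^bold>\<langle>p, q\<^bold>\<rangle> \<^bold>\<in> F" and n: "n \<^bold>\<in> \<omega>" for p q n
  proof -
    \<comment> \<open>Each of the output positions below \<open>n\<close> has its own modulus, and
      bounding gives a common one.\<close>
    let ?R = "\<lambda>j M. \<forall>p'. p' \<^bold>\<in> \<N> \<and> agree M p' p \<longrightarrow> val \<Phi> p' j (q \<^bold>\<cdot> j)"
    have "defpred2 ?R" unfolding defpred2_def by (intro definable_intros)
    then obtain M where M: "M \<^bold>\<in> \<omega>" "\<And>j. j \<^bold>\<in> n \<Longrightarrow> ?R j M"
    proof (rule omega_bounding[OF _ n])
      show "\<exists>m. m \<^bold>\<in> \<omega> \<and> ?R j m" if "j \<^bold>\<in> n" for j
        using locally_determinedD(4)[OF ld \<Phi>(2)[OF pq omega_mem[OF n that]]] .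
      show "?R j m'" if "?R j m" "m \<^bold>\<in> \<omega>" "m' \<^bold>\<in> \<omega>" "m \<^bold>\<in> succ m'" for j m m'
        using that(1) agree_mono[OF that(3,4)] by blast
    qed blast
    have "q' \<^bold>\<restriction> n = q \<^bold>\<restriction> n" if p': "\<^bold>\<langle>p', q'\<^bold>\<rangle> \<^bold>\<in> F" and e: "p' \<^bold>\<restriction> M = p \<^bold>\<restriction> M" for p' q'
    proof -
      have a: "agree M p' p" using restr_eq_iff[OF FN(1)[OF p'] FN(1)[OF pq] M(1)] e by blast
      have "q' \<^bold>\<cdot> j = q \<^bold>\<cdot> j" if j: "j \<^bold>\<in> n" for j
        using M(2)[OF j] FN(1)[OF p'] a \<Phi>(2)[OF p' omega_mem[OF n j]] locally_determinedD(2)[OF ld] by blast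
      then show ?thesis
        using restr_eq_iff[OF FN(2)[OF p'] FN(2)[OF pq] n] unfolding agree_def by blast
    qed
    with M(1) show ?thesis by blast
  qed
  then show ?thesis unfolding continuous_def using F by blast
qed

lemma le_W_imp_le_W_cont: "g \<le>\<^sub>W h \<Longrightarrow> g \<le>\<^sub>W\<^sup>* h"
  unfolding le_W_def le_W_cont_def reduces_via_def using computable_continuous by blast


subsection \<open>Names for the problems on the naturals\<close>

lemma mem_baire_rep': "z \<^bold>\<in> baire_rep \<longleftrightarrow> (\<exists>p. p \<^bold>\<in> \<N> \<and> z = \<^bold>\<langle>p, p\<^bold>\<rangle>)"
proof -
  have d: "defpred (\<lambda>z. \<exists>p. p \<^bold>\<in> \<N> \<and> z = \<^bold>\<langle>p, p\<^bold>\<rangle>)"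
    unfolding defpred_def by (intro definable_intros)
  show ?thesis
    unfolding baire_rep_def by (rule mem_collect_sub[OF d, of "cart \<N> \<N>"]) (auto simp: mem_cart)
qed

lemma mem_baire_rep: "\<^bold>\<langle>p, x\<^bold>\<rangle> \<^bold>\<in> baire_rep \<longleftrightarrow> p \<^bold>\<in> \<N> \<and> x = p"
  unfolding mem_baire_rep' by auto

lemma mem_nat_rep': "z \<^bold>\<in> nat_rep \<longleftrightarrow> (\<exists>p. p \<^bold>\<in> \<N> \<and> z = \<^bold>\<langle>p, p \<^bold>\<cdot> \<^bold>0\<^bold>\<rangle>)"
proof -
  have d: "defpred (\<lambda>z. \<exists>p. p \<^bold>\<in> \<N> \<and> z = \<^bold>\<langle>p, p \<^bold>\<cdot> \<^bold>0\<^bold>\<rangle>)"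
    unfolding defpred_def by (intro definable_intros)
  show ?thesis
    unfolding nat_rep_def by (rule mem_collect_sub[OF d, of "cart \<N> \<omega>"]) (auto simp: mem_cart)
qed

lemma mem_nat_rep: "\<^bold>\<langle>p, k\<^bold>\<rangle> \<^bold>\<in> nat_rep \<longleftrightarrow> p \<^bold>\<in> \<N> \<and> k = p \<^bold>\<cdot> \<^bold>0"
  unfolding mem_nat_rep' by auto

lemma baire_nat_instance_name:
  "src_rep g = baire_rep \<Longrightarrow> instance_name g p \<longleftrightarrow> p \<^bold>\<in> \<N> \<and> in_dom p (graph g)"
  unfolding instance_name_def by (auto simp: mem_baire_rep)

lemma baire_nat_solution_name:
  "src_rep g = baire_rep \<Longrightarrow> tgt_rep g = nat_rep \<Longrightarrow>
    solution_name g p q \<longleftrightarrow> p \<^bold>\<in> \<N> \<and> q \<^bold>\<in> \<N> \<and> \<^bold>\<langle>p, q \<^bold>\<cdot> \<^bold>0\<^bold>\<rangle> \<^bold>\<in> graph g"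
  unfolding solution_name_def by (auto simp: mem_baire_rep mem_nat_rep)

section \<open>Limits and the names for all-or-co-unique choice\<close>

lemma definable_has_limit [definable_intros]:
  "defterm p \<Longrightarrow> defterm k \<Longrightarrow> definable (\<lambda>e. has_limit (p e) (k e))"
  unfolding has_limit_def by (intro definable_intros defterm_weaken)

lemma has_limit_unique: assumes "has_limit p k" "has_limit p l" shows "k = l"
proof -
  obtain m n where m: "m \<^bold>\<in> \<omega>" "\<And>i. i \<^bold>\<in> \<omega> \<Longrightarrow> \<not> i \<^bold>\<in> m \<Longrightarrow> p \<^bold>\<cdot> i = k"
    and n: "n \<^bold>\<in> \<omega>" "\<And>i. i \<^bold>\<in> \<omega> \<Longrightarrow> \<not> i \<^bold>\<in> n \<Longrightarrow> p \<^bold>\<cdot> i = l"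
    using assms unfolding has_limit_def by blast
  obtain i where "i \<^bold>\<in> \<omega>" "m \<^bold>\<in> succ i" "n \<^bold>\<in> succ i" using omega_max[OF m(1) n(1)] by blast
  then show ?thesis using m n not_mem_iff by metis
qed

lemma Pi02_ACC_simps [simp]:
  "src \<Pi>\<^sup>0\<^sub>2ACC\<^sub>\<nat> = \<N>" "src_rep \<Pi>\<^sup>0\<^sub>2ACC\<^sub>\<nat> = baire_rep" "tgt \<Pi>\<^sup>0\<^sub>2ACC\<^sub>\<nat> = \<omega>" "tgt_rep \<Pi>\<^sup>0\<^sub>2ACC\<^sub>\<nat> = nat_rep"
  by (simp_all add: Pi02_ACC_Nat_def)

lemma graph_Pi02_ACC: "\<^bold>\<langle>p, k\<^bold>\<rangle> \<^bold>\<in> graph \<Pi>\<^sup>0\<^sub>2ACC\<^sub>\<nat> \<longleftrightarrow> p \<^bold>\<in> \<N> \<and> k \<^bold>\<in> \<omega> \<and> \<not> has_limit p k"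
proof -
  have d: "defpred (\<lambda>z. \<exists>p k. p \<^bold>\<in> \<N> \<and> k \<^bold>\<in> \<omega> \<and> \<not> has_limit p k \<and> z = \<^bold>\<langle>p, k\<^bold>\<rangle>)"
    unfolding defpred_def by (intro definable_intros)
  have "z \<^bold>\<in> graph \<Pi>\<^sup>0\<^sub>2ACC\<^sub>\<nat> \<longleftrightarrow> (\<exists>p k. p \<^bold>\<in> \<N> \<and> k \<^bold>\<in> \<omega> \<and> \<not> has_limit p k \<and> z = \<^bold>\<langle>p, k\<^bold>\<rangle>)" for z
    unfolding Pi02_ACC_Nat_def problem.simps
    by (rule mem_collect_sub[OF d, of "cart \<N> \<omega>"]) (auto simp: mem_cart)
  then show ?thesis by auto
qed

text \<open>Limits are unique, so 0 and 1 cannot both be excluded and every sequence has a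
  solution.\<close>

lemma instance_name_Pi02_ACC: "instance_name \<Pi>\<^sup>0\<^sub>2ACC\<^sub>\<nat> p \<longleftrightarrow> p \<^bold>\<in> \<N>"
proof -
  have "\<exists>k. k \<^bold>\<in> \<omega> \<and> \<not> has_limit p k"
    using has_limit_unique[of p "\<^bold>0" "succ \<^bold>0"] succ_not_zero zero_omega succ_omega by metis
  then show ?thesis by (auto simp: baire_nat_instance_name in_dom_def graph_Pi02_ACC)
qed

lemma solution_name_Pi02_ACC:
  "solution_name \<Pi>\<^sup>0\<^sub>2ACC\<^sub>\<nat> p q \<longleftrightarrow> p \<^bold>\<in> \<N> \<and> q \<^bold>\<in> \<N> \<and> \<not> has_limit p (q \<^bold>\<cdot> \<^bold>0)"
  by (auto simp: baire_nat_solution_name graph_Pi02_ACC)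

section \<open>Names for choice on the naturals\<close>

definition coded_set :: "'v \<Rightarrow> 'v" where
  "coded_set p = collect (\<lambda>k. k \<^bold>\<in> \<omega> \<and> \<not> (\<exists>n. n \<^bold>\<in> \<omega> \<and> p \<^bold>\<cdot> n = succ k))"

lemma ex_coded_set: "\<exists>z. \<forall>k. k \<^bold>\<in> z \<longleftrightarrow> k \<^bold>\<in> \<omega> \<and> \<not> (\<exists>n. n \<^bold>\<in> \<omega> \<and> p \<^bold>\<cdot> n = succ k)"
  by (rule separation) (unfold defpred_def, intro definable_intros)

lemma mem_coded_set: "k \<^bold>\<in> coded_set p \<longleftrightarrow> k \<^bold>\<in> \<omega> \<and> \<not> (\<exists>n. n \<^bold>\<in> \<omega> \<and> p \<^bold>\<cdot> n = succ k)"
  unfolding coded_set_def by (rule mem_collect[OF ex_coded_set])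

lemma mem_closed_sets_rep: "\<^bold>\<langle>p, A\<^bold>\<rangle> \<^bold>\<in> closed_sets_rep \<longleftrightarrow> p \<^bold>\<in> \<N> \<and> A = coded_set p"
proof -
  let ?Q = "\<lambda>z. \<exists>p. p \<^bold>\<in> \<N> \<and> z = \<^bold>\<langle>p, coded_set p\<^bold>\<rangle>"
  have d: "defpred ?Q"
    unfolding defpred_def coded_set_def by (intro defterm_collect definable_intros ex_coded_set)
  have "coded_set p \<^bold>\<in> powerset \<omega>" for p
    unfolding mem_powerset subset_def mem_coded_set by blast
  then have "z \<^bold>\<in> collect ?Q \<longleftrightarrow> ?Q z" for z
    by (intro mem_collect_sub[OF d, of "cart \<N> (powerset \<omega>)"]) (auto simp: mem_cart)
  then show ?thesis unfolding closed_sets_rep_def coded_set_def by auto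
qed

lemma C_Nat_simps [simp]: "src_rep C\<^sub>\<nat> = closed_sets_rep" "tgt_rep C\<^sub>\<nat> = nat_rep"
  by (simp_all add: C_Nat_def)

lemma graph_C_Nat: "\<^bold>\<langle>A, k\<^bold>\<rangle> \<^bold>\<in> graph C\<^sub>\<nat> \<longleftrightarrow> A \<^bold>\<subseteq> \<omega> \<and> k \<^bold>\<in> A"
proof -
  have d: "defpred (\<lambda>z. \<exists>A k. A \<^bold>\<subseteq> \<omega> \<and> k \<^bold>\<in> A \<and> z = \<^bold>\<langle>A, k\<^bold>\<rangle>)"
    unfolding defpred_def subset_def by (intro definable_intros)
  have "z \<^bold>\<in> graph C\<^sub>\<nat> \<longleftrightarrow> (\<exists>A k. A \<^bold>\<subseteq> \<omega> \<and> k \<^bold>\<in> A \<and> z = \<^bold>\<langle>A, k\<^bold>\<rangle>)" for z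
    unfolding C_Nat_def problem.simps
    by (rule mem_collect_sub[OF d, of "cart (powerset \<omega>) \<omega>"]) (auto simp: mem_cart mem_powerset subset_def)
  then show ?thesis by auto
qed

lemma instance_name_C_Nat:
  "instance_name C\<^sub>\<nat> p \<longleftrightarrow> p \<^bold>\<in> \<N> \<and> (\<exists>k. k \<^bold>\<in> \<omega> \<and> \<not> (\<exists>n. n \<^bold>\<in> \<omega> \<and> p \<^bold>\<cdot> n = succ k))"
  unfolding instance_name_def in_dom_def
  by (auto simp: mem_closed_sets_rep graph_C_Nat subset_def mem_coded_set)

lemma solution_name_C_Nat:
  "solution_name C\<^sub>\<nat> p q \<longleftrightarrow> p \<^bold>\<in> \<N> \<and> q \<^bold>\<in> \<N> \<and> \<not> (\<exists>n. n \<^bold>\<in> \<omega> \<and> p \<^bold>\<cdot> n = succ (q \<^bold>\<cdot> \<^bold>0))"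
  unfolding solution_name_def
  by (auto simp: mem_closed_sets_rep graph_C_Nat subset_def mem_coded_set mem_nat_rep)

subsection \<open>The game\<close>

lemma conti_nonexpansive:
  assumes "\<And>p. P p \<Longrightarrow> p \<^bold>\<in> \<N>" "\<And>p. P p \<Longrightarrow> \<phi> p \<^bold>\<in> \<N>"
    "\<And>n p p'. n \<^bold>\<in> \<omega> \<Longrightarrow> P p \<Longrightarrow> P p' \<Longrightarrow> agree n p' p \<Longrightarrow> agree n (\<phi> p') (\<phi> p)"
  shows "conti P \<phi>"
  by (rule contiI) (use assms in blast)+

text \<open>The position that is read is itself an output: one prefix fixes it, another fixes the
  entries of \<open>\<phi> p\<close> up to it. The constant sequence serves as a name of the natural
  that is found.\<close>

lemma conti_eval:
  assumes "conti P \<phi>" "conti P \<psi>" shows "conti P (\<lambda>x. const_seq (\<phi> x \<^bold>\<cdot> (\<psi> x \<^bold>\<cdot> \<^bold>0)))"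
proof (rule contiI)
  fix p n assume p: "P p" and n: "n \<^bold>\<in> \<omega>"
  let ?j = "\<psi> p \<^bold>\<cdot> \<^bold>0"
  have j: "succ ?j \<^bold>\<in> \<omega>" using contiD(2)[OF assms(2) p] by simp
  obtain k where k: "k \<^bold>\<in> \<omega>" "\<And>q. P q \<Longrightarrow> agree k q p \<Longrightarrow> agree (succ ?j) (\<phi> q) (\<phi> p)"
    using contiD(3)[OF assms(1) p j] by blast
  obtain l where l: "l \<^bold>\<in> \<omega>" "\<And>q. P q \<Longrightarrow> agree l q p \<Longrightarrow> agree (succ \<^bold>0) (\<psi> q) (\<psi> p)"
    using contiD(3)[OF assms(2) p succ_omega[OF zero_omega]] by blast
  obtain m where m: "m \<^bold>\<in> \<omega>" "k \<^bold>\<in> succ m" "l \<^bold>\<in> succ m" using omega_max[OF k(1) l(1)] by blast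
  have "\<phi> q \<^bold>\<cdot> (\<psi> q \<^bold>\<cdot> \<^bold>0) = \<phi> p \<^bold>\<cdot> (\<psi> p \<^bold>\<cdot> \<^bold>0)" if q: "P q" "agree m q p" for q
    using k(2)[OF q(1) agree_mono[OF m(1,2) q(2)]] l(2)[OF q(1) agree_mono[OF m(1,3) q(2)]]
    by (simp add: agree_def)
  then show "\<exists>m. m \<^bold>\<in> \<omega> \<and> (\<forall>p'. P p' \<and> agree m p' p \<longrightarrow>
      agree n (const_seq (\<phi> p' \<^bold>\<cdot> (\<psi> p' \<^bold>\<cdot> \<^bold>0))) (const_seq (\<phi> p \<^bold>\<cdot> (\<psi> p \<^bold>\<cdot> \<^bold>0))))"
    using m(1) by (intro exI[of _ m]) simp
qed (use contiD[OF assms(1)] contiD[OF assms(2)] in simp_all)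

text \<open>\<open>viol x\<close> enumerates, in the naming of closed sets, all \<open>m\<close> after which \<open>x\<close> still changes.
  The union over all admissible \<open>m\<close> is empty or a single successor.\<close>

definition viol_at :: "'v \<Rightarrow> 'v \<Rightarrow> 'v \<Rightarrow> bool" where
  "viol_at x i u \<longleftrightarrow> (\<exists>m n. m \<^bold>\<in> \<omega> \<and> n \<^bold>\<in> \<omega> \<and> i = npairo m n \<and> \<not> n \<^bold>\<in> m \<and> x \<^bold>\<cdot> n \<noteq> x \<^bold>\<cdot> m \<and> u \<^bold>\<in> succ m)"

definition viol :: "'v \<Rightarrow> 'v" where
  "viol x = fun_of \<omega> (\<lambda>i. collect (viol_at x i))"

lemma ex_viol_at: "\<exists>z. \<forall>u. u \<^bold>\<in> z \<longleftrightarrow> viol_at x i u"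
proof -
  have "defpred (viol_at x i)" unfolding defpred_def viol_at_def by (intro definable_intros)
  then obtain z where z: "\<And>u. u \<^bold>\<in> z \<longleftrightarrow> u \<^bold>\<in> \<omega> \<and> viol_at x i u" using separation by blast
  have "u \<^bold>\<in> \<omega>" if "viol_at x i u" for u
    using that omega_mem[OF succ_omega] unfolding viol_at_def by blast
  with z show ?thesis by blast
qed

lemma defterm_viol_at:
  assumes "defterm t" "defterm s" shows "defterm (\<lambda>e. collect (viol_at (t e) (s e)))"
  by (rule defterm_collect[OF _ ex_viol_at])
    (unfold viol_at_def, intro definable_intros assms[THEN defterm_rename])

lemma defop_viol: "defop (\<lambda>i. collect (viol_at x i))"
  by (rule defopI) (intro defterm_viol_at definable_intros)

lemma defterm_viol: assumes "defterm t" shows "defterm (\<lambda>e. viol (t e))"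
  unfolding viol_def by (intro defterm_viol_at definable_intros assms defterm_rename[OF assms])

lemma viol_app:
  assumes "m \<^bold>\<in> \<omega>" "n \<^bold>\<in> \<omega>" "\<not> n \<^bold>\<in> m" "x \<^bold>\<cdot> n \<noteq> x \<^bold>\<cdot> m" shows "viol x \<^bold>\<cdot> npair m n = succ m"
proof -
  have "viol_at x (npair m n) u \<longleftrightarrow> u \<^bold>\<in> succ m" for u
  proof
    assume "viol_at x (npair m n) u"
    then obtain m' n' where "m' \<^bold>\<in> \<omega>" "n' \<^bold>\<in> \<omega>" "npair m n = npairo m' n'" "u \<^bold>\<in> succ m'"
      unfolding viol_at_def by blast
    then show "u \<^bold>\<in> succ m" using npair_inject[OF assms(1,2)] by simp
  next
    assume "u \<^bold>\<in> succ m"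
    then show "viol_at x (npair m n) u"
      unfolding viol_at_def using assms npairo_eq[OF assms(1,2)] by metis
  qed
  then show ?thesis
    unfolding viol_def using assms(1,2) by (subst fun_of_app[OF defop_viol]) (auto intro: collect_eqI)
qed

lemma viol_cases:
  assumes "i \<^bold>\<in> \<omega>"
  obtains m n where "m \<^bold>\<in> \<omega>" "n \<^bold>\<in> \<omega>" "i = npair m n" "\<not> n \<^bold>\<in> m" "x \<^bold>\<cdot> n \<noteq> x \<^bold>\<cdot> m" "viol x \<^bold>\<cdot> i = succ m"
  | "viol x \<^bold>\<cdot> i = \<^bold>0"
proof (cases "\<exists>u. viol_at x i u")
  case True
  then obtain m n where "m \<^bold>\<in> \<omega>" "n \<^bold>\<in> \<omega>" "i = npair m n" "\<not> n \<^bold>\<in> m" "x \<^bold>\<cdot> n \<noteq> x \<^bold>\<cdot> m"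
    unfolding viol_at_def by auto
  with viol_app[of m n x] that(1)[of m n] show ?thesis by blast
next
  case False
  then have "collect (viol_at x i) = \<^bold>0" by (intro collect_eqI) simp
  then show ?thesis using that(2) fun_of_app[OF defop_viol assms] unfolding viol_def by simp
qed

lemma viol_baire: "viol x \<^bold>\<in> \<N>"
proof -
  have "maps (viol x) \<omega> \<omega>"
    unfolding viol_def
  proof (rule maps_fun_of[OF defop_viol])
    fix i assume i: "i \<^bold>\<in> \<omega>"
    have "viol x \<^bold>\<cdot> i \<^bold>\<in> \<omega>" by (rule viol_cases[OF i, of x]) auto
    then show "collect (viol_at x i) \<^bold>\<in> \<omega>" unfolding viol_def fun_of_app[OF defop_viol i] .
  qed
  then show ?thesis by (simp add: mem_baire)
qed

text \<open>Entry \<open>i\<close> compares \<open>x\<close> at the two components of the pair coded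
  by \<open>i\<close>, and these are at most \<open>i\<close>.\<close>

lemma agree_viol: assumes "n \<^bold>\<in> \<omega>" "agree n x y" shows "agree n (viol x) (viol y)"
  unfolding agree_def
proof (intro allI impI)
  fix i assume i: "i \<^bold>\<in> n"
  have io: "i \<^bold>\<in> \<omega>" using omega_mem[OF assms(1) i] .
  have e: "x \<^bold>\<cdot> j = y \<^bold>\<cdot> j" if "j \<^bold>\<in> succ i" for j
    using that assms(2) i omega_trans[OF assms(1) i, of j] unfolding agree_def mem_succ by blast
  have "viol_at x i u \<longleftrightarrow> viol_at y i u" for u
    unfolding viol_at_def
  proof (intro ex_cong1 conj_cong refl)
    fix m k assume mk: "m \<^bold>\<in> \<omega>" "k \<^bold>\<in> \<omega>" "i = npairo m k"
    then show "x \<^bold>\<cdot> k \<noteq> x \<^bold>\<cdot> m \<longleftrightarrow> y \<^bold>\<cdot> k \<noteq> y \<^bold>\<cdot> m" using e[of m] e[of k] npair_ge[of m k] by simp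
  qed
  then have "viol_at x i = viol_at y i" by blast
  then show "viol x \<^bold>\<cdot> i = viol y \<^bold>\<cdot> i"
    unfolding viol_def fun_of_app[OF defop_viol io] by simp
qed

text \<open>Choice on the naturals is asked for a point from which the moves of I are constant, that
  is, for a number never enumerated by \<open>viol\<close>. Such a point exists on instances because
  the moves converge, and the entry there is the limit, hence a solution.\<close>

lemma player_I_wins:
  assumes rep: "src_rep g = baire_rep" "tgt_rep g = nat_rep" and \<sigma>: "maps \<sigma> finseqs \<omega>"
    and win: "\<And>a b. a \<^bold>\<in> \<N> \<Longrightarrow> b \<^bold>\<in> \<N> \<Longrightarrow> (\<And>n. n \<^bold>\<in> \<omega> \<Longrightarrow> a \<^bold>\<cdot> n = \<sigma> \<^bold>\<cdot> (b \<^bold>\<restriction> n)) \<Longrightarrow>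
      in_dom b (graph g) \<Longrightarrow> \<exists>k. \<^bold>\<langle>b, k\<^bold>\<rangle> \<^bold>\<in> graph g \<and> has_limit a k"
  shows "g \<le>\<^sub>W\<^sup>* C\<^sub>\<nat>"
proof -
  let ?a = "\<lambda>b. fun_of \<omega> (\<lambda>n. \<sigma> \<^bold>\<cdot> (b \<^bold>\<restriction> n))"
  have da: "defop (\<lambda>n. \<sigma> \<^bold>\<cdot> (b \<^bold>\<restriction> n))" for b by (rule defopI) (intro definable_intros)
  have app: "?a b \<^bold>\<cdot> n = \<sigma> \<^bold>\<cdot> (b \<^bold>\<restriction> n)" if "n \<^bold>\<in> \<omega>" for b n by (rule fun_of_app[OF da that])
  have aN: "?a b \<^bold>\<in> \<N>" if "b \<^bold>\<in> \<N>" for b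
    by (rule baire_fun_of[OF da]) (use maps_app[OF \<sigma>] restr_finseqs that in blast)
  have ca: "conti (\<lambda>b. b \<^bold>\<in> \<N>) ?a"
  proof (rule conti_nonexpansive)
    fix n b b' assume n: "n \<^bold>\<in> \<omega>" and b: "b \<^bold>\<in> \<N>" "b' \<^bold>\<in> \<N>" "agree n b' b"
    show "agree n (?a b') (?a b)"
      unfolding agree_def
    proof (intro allI impI)
      fix k assume k: "k \<^bold>\<in> n"
      then have ko: "k \<^bold>\<in> \<omega>" using omega_mem[OF n] by blast
      have "agree k b' b" using b(3) k omega_trans[OF n k] unfolding agree_def by blast
      then have "b' \<^bold>\<restriction> k = b \<^bold>\<restriction> k" using restr_eq_iff[OF b(2,1) ko] by blast
      then show "?a b' \<^bold>\<cdot> k = ?a b \<^bold>\<cdot> k" using app[OF ko] by simp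
    qed
  qed (use aN in blast)+
  let ?H = "\<lambda>b. viol (?a b)"
  \<comment> \<open>The answer is only the point of stabilisation. The strategy is replayed on the
    instance, kept in \<open>left x\<close>, to read the limit off at that point.\<close>
  let ?K = "\<lambda>x. const_seq (?a (left x) \<^bold>\<cdot> (right x \<^bold>\<cdot> \<^bold>0))"
  have lim: "\<exists>k. \<^bold>\<langle>b, k\<^bold>\<rangle> \<^bold>\<in> graph g \<and> has_limit (?a b) k" if "instance_name g b" for b
    using that win[OF aN _ app] unfolding baire_nat_instance_name[OF rep(1)] by blast
  have IN: "b \<^bold>\<in> \<N>" if "instance_name g b" for b
    using that unfolding baire_nat_instance_name[OF rep(1)] by blast
  show ?thesis
  proof (rule le_W_contI[of ?H ?K])
    show "defop ?H" by (rule defopI) (intro defterm_viol definable_intros)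
    show "defop ?K" by (rule defopI) (intro definable_intros)
    have "conti (\<lambda>b. b \<^bold>\<in> \<N>) viol"
      by (rule conti_nonexpansive) (use viol_baire agree_viol in blast)+
    then have "conti (\<lambda>b. b \<^bold>\<in> \<N>) ?H" by (rule conti_comp[OF ca]) (use aN in blast)
    then show "conti (instance_name g) ?H" by (rule conti_cong) (use IN in blast)+
    have D: "x \<^bold>\<in> \<N>" if "out_dom g C\<^sub>\<nat> ?H x" for x
      using that IN unfolding out_dom_def solution_name_C_Nat by auto
    have c: "conti (out_dom g C\<^sub>\<nat> ?H) left" "conti (out_dom g C\<^sub>\<nat> ?H) right"
      by (rule conti_left conti_right, erule D)+
    have "conti (out_dom g C\<^sub>\<nat> ?H) (\<lambda>x. ?a (left x))"
      by (rule conti_comp[OF c(1) ca]) (use D left_baire in blast)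
    then show "conti (out_dom g C\<^sub>\<nat> ?H) ?K" by (rule conti_eval[OF _ c(2)])
    show "instance_name C\<^sub>\<nat> (?H b)" if b: "instance_name g b" for b
    proof -
      obtain k m where m: "m \<^bold>\<in> \<omega>" "\<And>n. n \<^bold>\<in> \<omega> \<Longrightarrow> \<not> n \<^bold>\<in> m \<Longrightarrow> ?a b \<^bold>\<cdot> n = k"
        using lim[OF b] unfolding has_limit_def by blast
      \<comment> \<open>Any \<open>m\<close> from which the moves are constantly \<open>k\<close>
        stays in the set: a later entry different from the one at \<open>m\<close> would contradict
        the limit.\<close>
      have "?H b \<^bold>\<cdot> i \<noteq> succ m" if i: "i \<^bold>\<in> \<omega>" for i
      proof (rule viol_cases[OF i, of "?a b"])
        fix m' n assume v: "m' \<^bold>\<in> \<omega>" "n \<^bold>\<in> \<omega>" "\<not> n \<^bold>\<in> m'" "?a b \<^bold>\<cdot> n \<noteq> ?a b \<^bold>\<cdot> m'" "?H b \<^bold>\<cdot> i = succ m'"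
        have "m' \<noteq> m"
        proof
          assume "m' = m"
          then have "?a b \<^bold>\<cdot> n = k" "?a b \<^bold>\<cdot> m' = k"
            using m(2)[OF v(2)] m(2)[OF m(1) omega_irrefl[OF m(1)]] v(3) by blast+
          then show False using v(4) by simp
        qed
        then show ?thesis using v(5) succ_inject[OF v(1) m(1)] by simp
      qed simp
      then show ?thesis unfolding instance_name_C_Nat using viol_baire m(1) by blast
    qed
    show "solution_name g b (?K (interleave b q))"
      if b: "instance_name g b" and q: "solution_name C\<^sub>\<nat> (?H b) q" for b q
    proof -
      have qN: "q \<^bold>\<in> \<N>" and bN: "b \<^bold>\<in> \<N>" and q0: "\<And>i. i \<^bold>\<in> \<omega> \<Longrightarrow> ?H b \<^bold>\<cdot> i \<noteq> succ (q \<^bold>\<cdot> \<^bold>0)"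
        using q IN[OF b] unfolding solution_name_C_Nat by blast+
      let ?m = "q \<^bold>\<cdot> \<^bold>0"
      have m: "?m \<^bold>\<in> \<omega>" using qN by simp
      have "?a b \<^bold>\<cdot> n = ?a b \<^bold>\<cdot> ?m" if "n \<^bold>\<in> \<omega>" "\<not> n \<^bold>\<in> ?m" for n
        using viol_app[OF m that] q0 npair_omega[OF m that(1)] by blast
      then have "has_limit (?a b) (?a b \<^bold>\<cdot> ?m)" unfolding has_limit_def using m by blast
      then have "\<^bold>\<langle>b, ?a b \<^bold>\<cdot> ?m\<^bold>\<rangle> \<^bold>\<in> graph g" using lim[OF b] has_limit_unique by blast
      then show ?thesis
        unfolding baire_nat_solution_name[OF rep] using bN qN m aN[OF bN] by simp
    qed
  qed
qed

text \<open>The moves of I are an arbitrary instance of all-or-co-unique choice. II answers with an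
  instance of \<open>g\<close> whose solutions all differ from the limit, so each of them can be
  returned unchanged.\<close>

lemma player_II_wins:
  assumes rep: "src_rep g = baire_rep" "tgt_rep g = nat_rep" and \<tau>: "maps \<tau> finseqs \<omega>"
    and win: "\<And>a b. a \<^bold>\<in> \<N> \<Longrightarrow> b \<^bold>\<in> \<N> \<Longrightarrow> (\<And>n. n \<^bold>\<in> \<omega> \<Longrightarrow> b \<^bold>\<cdot> n = \<tau> \<^bold>\<cdot> (a \<^bold>\<restriction> succ n)) \<Longrightarrow>
      in_dom b (graph g) \<and> \<not> (\<exists>k. \<^bold>\<langle>b, k\<^bold>\<rangle> \<^bold>\<in> graph g \<and> has_limit a k)"
  shows "\<Pi>\<^sup>0\<^sub>2ACC\<^sub>\<nat> \<le>\<^sub>W\<^sup>* g"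
proof -
  let ?b = "\<lambda>a. fun_of \<omega> (\<lambda>n. \<tau> \<^bold>\<cdot> (a \<^bold>\<restriction> succ n))"
  have db: "defop (\<lambda>n. \<tau> \<^bold>\<cdot> (a \<^bold>\<restriction> succ n))" for a by (rule defopI) (intro definable_intros)
  have app: "?b a \<^bold>\<cdot> n = \<tau> \<^bold>\<cdot> (a \<^bold>\<restriction> succ n)" if "n \<^bold>\<in> \<omega>" for a n by (rule fun_of_app[OF db that])
  have bN: "?b a \<^bold>\<in> \<N>" if "a \<^bold>\<in> \<N>" for a
    by (rule baire_fun_of[OF db]) (use maps_app[OF \<tau>] restr_finseqs that succ_omega in blast)
  have w: "in_dom (?b a) (graph g)" "\<And>k. \<^bold>\<langle>?b a, k\<^bold>\<rangle> \<^bold>\<in> graph g \<Longrightarrow> \<not> has_limit a k" if "a \<^bold>\<in> \<N>" for a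
    using win[OF that bN[OF that] app] by blast+
  have cb: "conti (instance_name \<Pi>\<^sup>0\<^sub>2ACC\<^sub>\<nat>) ?b"
  proof (rule conti_nonexpansive)
    fix n a a' assume n: "n \<^bold>\<in> \<omega>" and "instance_name \<Pi>\<^sup>0\<^sub>2ACC\<^sub>\<nat> a" "instance_name \<Pi>\<^sup>0\<^sub>2ACC\<^sub>\<nat> a'" and ag: "agree n a' a"
    then have a: "a \<^bold>\<in> \<N>" "a' \<^bold>\<in> \<N>" unfolding instance_name_Pi02_ACC by blast+
    show "agree n (?b a') (?b a)"
      unfolding agree_def
    proof (intro allI impI)
      fix k assume k: "k \<^bold>\<in> n"
      then have ko: "k \<^bold>\<in> \<omega>" using omega_mem[OF n] by blast
      \<comment> \<open>II moves second, so move \<open>k\<close> depends on \<open>k + 1\<close>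
        moves of I; for \<open>k < n\<close> these still lie in the prefix of length
        \<open>n\<close>.\<close>
      have "agree (succ k) a' a" using ag k omega_trans[OF n k] unfolding agree_def mem_succ by blast
      then have "a' \<^bold>\<restriction> succ k = a \<^bold>\<restriction> succ k" using restr_eq_iff[OF a(2,1) succ_omega[OF ko]] by blast
      then show "?b a' \<^bold>\<cdot> k = ?b a \<^bold>\<cdot> k" using app[OF ko] by simp
    qed
  qed (use bN instance_name_Pi02_ACC in blast)+
  show ?thesis
  proof (rule le_W_contI[of ?b right])
    show "defop ?b" "defop right" by (rule defopI, intro definable_intros)+
    show "conti (instance_name \<Pi>\<^sup>0\<^sub>2ACC\<^sub>\<nat>) ?b" by (rule cb)
    show "conti (out_dom \<Pi>\<^sup>0\<^sub>2ACC\<^sub>\<nat> g ?b) right"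
      by (rule conti_right)
        (auto simp: out_dom_def instance_name_Pi02_ACC baire_nat_solution_name[OF rep])
    show "instance_name g (?b a)" if "instance_name \<Pi>\<^sup>0\<^sub>2ACC\<^sub>\<nat> a" for a
      using that w(1) bN unfolding instance_name_Pi02_ACC baire_nat_instance_name[OF rep(1)] by blast
    show "solution_name \<Pi>\<^sup>0\<^sub>2ACC\<^sub>\<nat> a (right (interleave a q))"
      if "instance_name \<Pi>\<^sup>0\<^sub>2ACC\<^sub>\<nat> a" "solution_name g (?b a) q" for a q
      using that w(2)[of a "q \<^bold>\<cdot> \<^bold>0"]
      unfolding instance_name_Pi02_ACC baire_nat_solution_name[OF rep] solution_name_Pi02_ACC by simp
  qed
qed

theorem game_dichotomy:
  assumes AD and rep: "src_rep g = baire_rep" "tgt_rep g = nat_rep"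
  shows "g \<le>\<^sub>W\<^sup>* C\<^sub>\<nat> \<or> \<Pi>\<^sup>0\<^sub>2ACC\<^sub>\<nat> \<le>\<^sub>W\<^sup>* g"
proof -
  let ?W = "\<lambda>a b. in_dom b (graph g) \<longrightarrow> (\<exists>k. \<^bold>\<langle>b, k\<^bold>\<rangle> \<^bold>\<in> graph g \<and> has_limit a k)"
  let ?Q = "\<lambda>z. \<exists>a b. a \<^bold>\<in> \<N> \<and> b \<^bold>\<in> \<N> \<and> z = interleave a b \<and> ?W a b"
  have d: "defpred ?Q" unfolding defpred_def in_dom_def by (intro definable_intros)
  have A: "z \<^bold>\<in> collect ?Q \<longleftrightarrow> ?Q z" for z
    by (rule mem_collect_sub[OF d, of \<N>]) auto
  \<comment> \<open>A run determines the sequences of both players, so membership in the payoff set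
    can be tested on them.\<close>
  have W: "interleave a b \<^bold>\<in> collect ?Q \<longleftrightarrow> ?W a b" if "a \<^bold>\<in> \<N>" "b \<^bold>\<in> \<N>" for a b
    unfolding A using that left_interleave right_interleave by metis
  have "collect ?Q \<^bold>\<subseteq> \<N>" unfolding subset_def A by auto
  then consider \<sigma> where "wins_I \<sigma> (collect ?Q)" | \<tau> where "wins_II \<tau> (collect ?Q)"
    using \<open>AD\<close> unfolding AD_def by blast
  then show ?thesis
  proof cases
    case 1
    have "g \<le>\<^sub>W\<^sup>* C\<^sub>\<nat>"
    proof (rule player_I_wins[OF rep])
      show "maps \<sigma> finseqs \<omega>" using 1 unfolding wins_I_def by blast
      fix a b assume ab: "a \<^bold>\<in> \<N>" "b \<^bold>\<in> \<N>" "\<And>n. n \<^bold>\<in> \<omega> \<Longrightarrow> a \<^bold>\<cdot> n = \<sigma> \<^bold>\<cdot> (b \<^bold>\<restriction> n)" "in_dom b (graph g)"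
      then have "interleave a b \<^bold>\<in> collect ?Q" using 1 unfolding wins_I_def by blast
      then show "\<exists>k. \<^bold>\<langle>b, k\<^bold>\<rangle> \<^bold>\<in> graph g \<and> has_limit a k" using W[OF ab(1,2)] ab(4) by blast
    qed
    then show ?thesis ..
  next
    case 2
    have "\<Pi>\<^sup>0\<^sub>2ACC\<^sub>\<nat> \<le>\<^sub>W\<^sup>* g"
    proof (rule player_II_wins[OF rep])
      show "maps \<tau> finseqs \<omega>" using 2 unfolding wins_II_def by blast
      fix a b assume ab: "a \<^bold>\<in> \<N>" "b \<^bold>\<in> \<N>" "\<And>n. n \<^bold>\<in> \<omega> \<Longrightarrow> b \<^bold>\<cdot> n = \<tau> \<^bold>\<cdot> (a \<^bold>\<restriction> succ n)"
      then have "\<not> interleave a b \<^bold>\<in> collect ?Q" using 2 unfolding wins_II_def by blast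
      then show "in_dom b (graph g) \<and> \<not> (\<exists>k. \<^bold>\<langle>b, k\<^bold>\<rangle> \<^bold>\<in> graph g \<and> has_limit a k)" using W[OF ab(1,2)] by blast
    qed
    then show ?thesis ..
  qed
qed


subsection \<open>All-or-co-unique choice does not reduce to choice on the naturals\<close>

text \<open>Written as a union so that it is a total definable operation, with the empty set as
  value off the pairs. The projections are needed to define a relation on pairs to which dependent
  choice applies.\<close>

definition pfst :: "'v \<Rightarrow> 'v" where
  "pfst z = collect (\<lambda>u. \<exists>a b. z = \<^bold>\<langle>a, b\<^bold>\<rangle> \<and> u \<^bold>\<in> a)"

definition psnd :: "'v \<Rightarrow> 'v" where
  "psnd z = collect (\<lambda>u. \<exists>a b. z = \<^bold>\<langle>a, b\<^bold>\<rangle> \<and> u \<^bold>\<in> b)"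

lemma ex_pfst: "\<exists>y. \<forall>u. u \<^bold>\<in> y \<longleftrightarrow> (\<exists>a b. z = \<^bold>\<langle>a, b\<^bold>\<rangle> \<and> u \<^bold>\<in> a)"
proof (cases "\<exists>a b. z = \<^bold>\<langle>a, b\<^bold>\<rangle>")
  case True
  then obtain a b where "z = \<^bold>\<langle>a, b\<^bold>\<rangle>" by blast
  then show ?thesis by (intro exI[of _ a]) auto
next
  case False
  then show ?thesis by (intro exI[of _ "\<^bold>0"]) auto
qed

lemma ex_psnd: "\<exists>y. \<forall>u. u \<^bold>\<in> y \<longleftrightarrow> (\<exists>a b. z = \<^bold>\<langle>a, b\<^bold>\<rangle> \<and> u \<^bold>\<in> b)"
proof (cases "\<exists>a b. z = \<^bold>\<langle>a, b\<^bold>\<rangle>")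
  case True
  then obtain a b where "z = \<^bold>\<langle>a, b\<^bold>\<rangle>" by blast
  then show ?thesis by (intro exI[of _ b]) auto
next
  case False
  then show ?thesis by (intro exI[of _ "\<^bold>0"]) auto
qed

lemma pfst_opair [simp]: "pfst \<^bold>\<langle>a, b\<^bold>\<rangle> = a"
  unfolding pfst_def by (rule collect_eqI) auto

lemma psnd_opair [simp]: "psnd \<^bold>\<langle>a, b\<^bold>\<rangle> = b"
  unfolding psnd_def by (rule collect_eqI) auto

lemma defterm_pfst [definable_intros]: assumes "defterm t" shows "defterm (\<lambda>e. pfst (t e))"
  unfolding pfst_def by (rule defterm_collect[OF _ ex_pfst]) (intro definable_intros defterm_rename[OF assms])

lemma defterm_psnd [definable_intros]: assumes "defterm t" shows "defterm (\<lambda>e. psnd (t e))"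
  unfolding psnd_def by (rule defterm_collect[OF _ ex_psnd]) (intro definable_intros defterm_rename[OF assms])

text \<open>Suppose a reduction with forward part \<open>H\<close>. The prefix of \<open>p\<close> of length \<open>m\<close> excludes \<open>j\<close> if
  it forces \<open>j\<close> out of the closed set named by the value of \<open>H\<close>.\<close>

definition excludes :: "'v \<Rightarrow> 'v \<Rightarrow> 'v \<Rightarrow> 'v \<Rightarrow> bool" where
  "excludes H p m j \<longleftrightarrow> (\<exists>n. n \<^bold>\<in> \<omega> \<and> (\<forall>p'. p' \<^bold>\<in> \<N> \<and> agree m p' p \<longrightarrow> H \<^bold>\<cdot> p' \<^bold>\<cdot> n = succ j))"

lemma definable_excludes [definable_intros]:
  assumes "defterm h" "defterm p" "defterm m" "defterm j"
  shows "definable (\<lambda>e. excludes (h e) (p e) (m e) (j e))"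
  unfolding excludes_def by (intro definable_intros assms[THEN defterm_rename])

lemma excludes_mono:
  assumes "m' \<^bold>\<in> \<omega>" "m \<^bold>\<in> succ m'" "agree m p' p" "excludes H p m j" shows "excludes H p' m' j"
proof -
  obtain n where "n \<^bold>\<in> \<omega>" "\<And>q. q \<^bold>\<in> \<N> \<Longrightarrow> agree m q p \<Longrightarrow> H \<^bold>\<cdot> q \<^bold>\<cdot> n = succ j"
    using assms(4) unfolding excludes_def by blast
  moreover have "agree m q p" if "agree m' q p'" for q
    using agree_trans[OF agree_mono[OF assms(1,2) that] assms(3)] .
  ultimately show ?thesis unfolding excludes_def by blast
qed

text \<open>One enumerated value depends on finitely many entries of \<open>p\<close>, so some
  prefix, which may be taken at least as long as \<open>m\<close>, already forces it.\<close>

lemma excludes_of_value: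
  assumes H: "conti (\<lambda>p. p \<^bold>\<in> \<N>) (\<lambda>p. H \<^bold>\<cdot> p)" and p: "p \<^bold>\<in> \<N>" and m: "m \<^bold>\<in> \<omega>"
    and n: "n \<^bold>\<in> \<omega>" "H \<^bold>\<cdot> p \<^bold>\<cdot> n = succ j"
  shows "\<exists>m'. m' \<^bold>\<in> \<omega> \<and> m \<^bold>\<in> succ m' \<and> excludes H p m' j"
proof -
  obtain k where k: "k \<^bold>\<in> \<omega>" "\<And>p'. p' \<^bold>\<in> \<N> \<Longrightarrow> agree k p' p \<Longrightarrow> agree (succ n) (H \<^bold>\<cdot> p') (H \<^bold>\<cdot> p)"
    using contiD(3)[OF H p succ_omega[OF n(1)]] by blast
  obtain m' where m': "m' \<^bold>\<in> \<omega>" "m \<^bold>\<in> succ m'" "k \<^bold>\<in> succ m'" using omega_max[OF m k(1)] by blast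
  have "H \<^bold>\<cdot> p' \<^bold>\<cdot> n = succ j" if "p' \<^bold>\<in> \<N>" "agree m' p' p" for p'
    using k(2)[OF that(1) agree_mono[OF m'(1,3) that(2)]] n(2) by (simp add: agree_def)
  then show ?thesis using m'(1,2) n(1) unfolding excludes_def by blast
qed

text \<open>Either \<open>j\<close> is already enumerated out of the set named by \<open>H \<^bold>\<cdot> p\<close>, or it is a legal answer, for
  which \<open>K\<close> returns some \<open>l\<close> after reading a prefix of \<open>p\<close>. Continuing the prefix by \<open>l\<close> forever makes
  \<open>l\<close> wrong, so \<open>j\<close> must be enumerated.\<close>

lemma excludes_extend:
  assumes H: "conti (\<lambda>p. p \<^bold>\<in> \<N>) (\<lambda>p. H \<^bold>\<cdot> p)"
    and K: "conti (out_dom \<Pi>\<^sup>0\<^sub>2ACC\<^sub>\<nat> C\<^sub>\<nat> (\<lambda>p. H \<^bold>\<cdot> p)) (\<lambda>x. K \<^bold>\<cdot> x)"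
    and sol: "\<And>p q. p \<^bold>\<in> \<N> \<Longrightarrow> solution_name C\<^sub>\<nat> (H \<^bold>\<cdot> p) q \<Longrightarrow>
      solution_name \<Pi>\<^sup>0\<^sub>2ACC\<^sub>\<nat> p (K \<^bold>\<cdot> interleave p q)"
    and p: "p \<^bold>\<in> \<N>" and m: "m \<^bold>\<in> \<omega>" and j: "j \<^bold>\<in> \<omega>"
  shows "\<exists>p' m'. p' \<^bold>\<in> \<N> \<and> m' \<^bold>\<in> \<omega> \<and> m \<^bold>\<in> succ m' \<and> agree m p' p \<and> excludes H p' m' j"
proof (cases "\<exists>n. n \<^bold>\<in> \<omega> \<and> H \<^bold>\<cdot> p \<^bold>\<cdot> n = succ j")
  case True
  then show ?thesis using excludes_of_value[OF H p m] p agree_refl by blast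
next
  case False
  have sj: "solution_name C\<^sub>\<nat> (H \<^bold>\<cdot> q) (const_seq j)" if "q \<^bold>\<in> \<N>" "\<not> (\<exists>n. n \<^bold>\<in> \<omega> \<and> H \<^bold>\<cdot> q \<^bold>\<cdot> n = succ j)" for q
    unfolding solution_name_C_Nat using that contiD(2)[OF H that(1)] j by simp
  have dom: "out_dom \<Pi>\<^sup>0\<^sub>2ACC\<^sub>\<nat> C\<^sub>\<nat> (\<lambda>p. H \<^bold>\<cdot> p) (interleave q (const_seq j))"
    if "q \<^bold>\<in> \<N>" "\<not> (\<exists>n. n \<^bold>\<in> \<omega> \<and> H \<^bold>\<cdot> q \<^bold>\<cdot> n = succ j)" for q
    using that(1) sj[OF that] unfolding out_dom_def instance_name_Pi02_ACC by blast
  let ?l = "K \<^bold>\<cdot> interleave p (const_seq j) \<^bold>\<cdot> \<^bold>0"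
  obtain M where M: "M \<^bold>\<in> \<omega>" "\<And>x. out_dom \<Pi>\<^sup>0\<^sub>2ACC\<^sub>\<nat> C\<^sub>\<nat> (\<lambda>p. H \<^bold>\<cdot> p) x \<Longrightarrow> agree M x (interleave p (const_seq j)) \<Longrightarrow>
      agree (succ \<^bold>0) (K \<^bold>\<cdot> x) (K \<^bold>\<cdot> interleave p (const_seq j))"
    using contiD(3)[OF K dom[OF p False] succ_omega[OF zero_omega]] by blast
  \<comment> \<open>The tail is changed only beyond \<open>N\<close>: at least \<open>M\<close>, so
    that \<open>K\<close> cannot notice the change, and at least \<open>m\<close>, so that the given
    prefix is kept.\<close>
  obtain N where N: "N \<^bold>\<in> \<omega>" "M \<^bold>\<in> succ N" "m \<^bold>\<in> succ N" using omega_max[OF M(1) m] by blast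
  have l: "?l \<^bold>\<in> \<omega>" using contiD(2)[OF K dom[OF p False]] by simp
  let ?t = "\<lambda>n. if n \<^bold>\<in> N then p \<^bold>\<cdot> n else ?l"
  let ?p = "fun_of \<omega> ?t"
  have t: "defop ?t" by (rule defopI) (intro definable_intros)
  have pN: "?p \<^bold>\<in> \<N>" by (rule baire_fun_of[OF t]) (use p l in simp)
  have ag: "agree N ?p p" unfolding agree_def
  proof (intro allI impI)
    fix k assume k: "k \<^bold>\<in> N"
    show "?p \<^bold>\<cdot> k = p \<^bold>\<cdot> k" using fun_of_app[OF t omega_mem[OF N(1) k]] k by simp
  qed
  have agm: "agree m ?p p" by (rule agree_mono[OF N(1,3) ag])
  have "?p \<^bold>\<cdot> n = ?l" if "n \<^bold>\<in> \<omega>" "\<not> n \<^bold>\<in> N" for n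
    using fun_of_app[OF t that(1)] that(2) by simp
  then have lim: "has_limit ?p ?l" unfolding has_limit_def using N(1) by blast
  have "\<exists>n. n \<^bold>\<in> \<omega> \<and> H \<^bold>\<cdot> ?p \<^bold>\<cdot> n = succ j"
  proof (rule ccontr)
    assume F: "\<not> (\<exists>n. n \<^bold>\<in> \<omega> \<and> H \<^bold>\<cdot> ?p \<^bold>\<cdot> n = succ j)"
    have "agree M (interleave ?p (const_seq j)) (interleave p (const_seq j))"
      by (rule agree_interleave[OF M(1) agree_mono[OF N(1,2) ag] agree_refl])
    from M(2)[OF dom[OF pN F] this] have "K \<^bold>\<cdot> interleave ?p (const_seq j) \<^bold>\<cdot> \<^bold>0 = ?l"
      by (simp add: agree_def)
    with sol[OF pN sj[OF pN F]] lim show False unfolding solution_name_Pi02_ACC by simp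
  qed
  then obtain n where n: "n \<^bold>\<in> \<omega>" "H \<^bold>\<cdot> ?p \<^bold>\<cdot> n = succ j" by blast
  show ?thesis using excludes_of_value[OF H pN m n] pN agm by blast
qed

text \<open>Since one extension treats all \<open>j\<close> below a bound, the construction of the
  generic point needs no stage counter: the current prefix length can serve as the bound.\<close>

lemma excludes_extend_all:
  assumes ext: "\<And>p m j. p \<^bold>\<in> \<N> \<Longrightarrow> m \<^bold>\<in> \<omega> \<Longrightarrow> j \<^bold>\<in> \<omega> \<Longrightarrow>
      \<exists>p' m'. p' \<^bold>\<in> \<N> \<and> m' \<^bold>\<in> \<omega> \<and> m \<^bold>\<in> succ m' \<and> agree m p' p \<and> excludes H p' m' j"
    and p: "p \<^bold>\<in> \<N>" and m: "m \<^bold>\<in> \<omega>" and i: "i \<^bold>\<in> \<omega>"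
  shows "\<exists>p' m'. p' \<^bold>\<in> \<N> \<and> m' \<^bold>\<in> \<omega> \<and> m \<^bold>\<in> succ m' \<and> agree m p' p \<and> (\<forall>j. j \<^bold>\<in> i \<longrightarrow> excludes H p' m' j)"
  using i
proof (induction rule: omega_induct)
  case zero
  show ?case using p m by (intro exI[of _ p] exI[of _ m]) simp
next
  case (succ i)
  then obtain q k where q: "q \<^bold>\<in> \<N>" "k \<^bold>\<in> \<omega>" "m \<^bold>\<in> succ k" "agree m q p" "\<And>j. j \<^bold>\<in> i \<Longrightarrow> excludes H q k j"
    by blast
  obtain p' m' where p': "p' \<^bold>\<in> \<N>" "m' \<^bold>\<in> \<omega>" "k \<^bold>\<in> succ m'" "agree k p' q" "excludes H p' m' i"
    using ext[OF q(1,2) succ.hyps] by blast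
  have "excludes H p' m' j" if "j \<^bold>\<in> succ i" for j
    using that p'(5) excludes_mono[OF p'(2,3,4) q(5)] unfolding mem_succ by blast
  moreover have "m \<^bold>\<in> succ m'" by (rule le_trans[OF p'(2) q(3) p'(3)])
  moreover have "agree m p' p" using agree_trans[OF agree_mono[OF q(2,3) p'(4)] q(4)] .
  ultimately show ?case using p'(1,2) by blast
next
  case definable
  show ?case unfolding defpred_def by (intro definable_intros)
qed

lemma ex_generic:
  assumes DC and ext: "\<And>p m j. p \<^bold>\<in> \<N> \<Longrightarrow> m \<^bold>\<in> \<omega> \<Longrightarrow> j \<^bold>\<in> \<omega> \<Longrightarrow>
      \<exists>p' m'. p' \<^bold>\<in> \<N> \<and> m' \<^bold>\<in> \<omega> \<and> m \<^bold>\<in> succ m' \<and> agree m p' p \<and> excludes H p' m' j"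
  shows "\<exists>p. p \<^bold>\<in> \<N> \<and> (\<forall>j. j \<^bold>\<in> \<omega> \<longrightarrow> (\<exists>n. n \<^bold>\<in> \<omega> \<and> H \<^bold>\<cdot> p \<^bold>\<cdot> n = succ j))"
proof -
  let ?A = "cart \<N> \<omega>"
  \<comment> \<open>A condition is a point with a prefix length. The next one keeps the prefix,
    lengthens it and excludes every number below the old length.\<close>
  let ?S = "\<lambda>p m p' m'. agree m p' p \<and> m \<^bold>\<in> m' \<and> (\<forall>j. j \<^bold>\<in> m \<longrightarrow> excludes H p' m' j)"
  let ?Q = "\<lambda>z. \<exists>x y. z = \<^bold>\<langle>x, y\<^bold>\<rangle> \<and> ?S (pfst x) (psnd x) (pfst y) (psnd y)"
  have "defpred ?Q" unfolding defpred_def by (intro definable_intros)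
  then obtain R where R: "\<And>z. z \<^bold>\<in> R \<longleftrightarrow> z \<^bold>\<in> cart ?A ?A \<and> ?Q z" using separation by blast
  have mem_R: "\<^bold>\<langle>x, y\<^bold>\<rangle> \<^bold>\<in> R \<longleftrightarrow> x \<^bold>\<in> ?A \<and> y \<^bold>\<in> ?A \<and> ?S (pfst x) (psnd x) (pfst y) (psnd y)" for x y
    unfolding R mem_cart[of _ ?A ?A] opair_eq by blast
  have A: "pfst x \<^bold>\<in> \<N> \<and> psnd x \<^bold>\<in> \<omega>" if "x \<^bold>\<in> ?A" for x
    using that unfolding mem_cart by auto
  have "\<exists>x. x \<^bold>\<in> ?A" using const_baire[OF zero_omega] zero_omega unfolding mem_cart by blast
  moreover have "\<exists>y. y \<^bold>\<in> ?A \<and> \<^bold>\<langle>x, y\<^bold>\<rangle> \<^bold>\<in> R" if x: "x \<^bold>\<in> ?A" for x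
  proof -
    have px: "pfst x \<^bold>\<in> \<N>" and mx: "psnd x \<^bold>\<in> \<omega>" using A[OF x] by blast+
    obtain p' m' where p': "p' \<^bold>\<in> \<N>" "m' \<^bold>\<in> \<omega>" "psnd x \<^bold>\<in> succ m'" "agree (psnd x) p' (pfst x)"
      "\<And>j. j \<^bold>\<in> psnd x \<Longrightarrow> excludes H p' m' j"
      using excludes_extend_all[OF ext px mx mx] by blast
    \<comment> \<open>The extension only guarantees a length of at least the old one; passing to
      \<open>succ m'\<close> makes the lengths strictly increasing.\<close>
    have "excludes H p' (succ m') j" if "j \<^bold>\<in> psnd x" for j
      by (rule excludes_mono[OF _ _ agree_refl p'(5)[OF that]]) (use p'(2) in simp_all)
    moreover have "\<^bold>\<langle>p', succ m'\<^bold>\<rangle> \<^bold>\<in> ?A" using p' unfolding mem_cart by auto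
    ultimately show ?thesis
      using p' x by (intro exI[of _ "\<^bold>\<langle>p', succ m'\<^bold>\<rangle>"]) (simp add: mem_R)
  qed
  ultimately obtain s where s: "maps s \<omega> ?A" "\<And>n. n \<^bold>\<in> \<omega> \<Longrightarrow> \<^bold>\<langle>s \<^bold>\<cdot> n, s \<^bold>\<cdot> succ n\<^bold>\<rangle> \<^bold>\<in> R"
    using \<open>DC\<close> unfolding DC_def by blast
  let ?P = "\<lambda>n. pfst (s \<^bold>\<cdot> n)" and ?M = "\<lambda>n. psnd (s \<^bold>\<cdot> n)"
  have PM: "?P n \<^bold>\<in> \<N>" "?M n \<^bold>\<in> \<omega>" if "n \<^bold>\<in> \<omega>" for n
    using A maps_app[OF s(1) that] by blast+
  have step: "agree (?M n) (?P (succ n)) (?P n)" "?M n \<^bold>\<in> ?M (succ n)"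
    "\<And>j. j \<^bold>\<in> ?M n \<Longrightarrow> excludes H (?P (succ n)) (?M (succ n)) j" if "n \<^bold>\<in> \<omega>" for n
    using s(2)[OF that] unfolding mem_R by blast+
  \<comment> \<open>Strict growth gives length at least \<open>n\<close> at stage \<open>n\<close>;
    hence every entry is eventually fixed and every \<open>j\<close> eventually excluded.\<close>
  have grow: "n \<^bold>\<in> succ (?M n)" if "n \<^bold>\<in> \<omega>" for n
    using that
  proof (induction rule: omega_induct)
    case zero
    then show ?case using zero_mem_or_zero[OF PM(2)[OF zero_omega]] by auto
  next
    case (succ n)
    have "n \<^bold>\<in> ?M (succ n)"
      using succ.IH step(2)[OF succ.hyps] omega_trans[OF PM(2)[OF succ_omega[OF succ.hyps]] step(2)[OF succ.hyps]]
      unfolding mem_succ by metis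
    then show ?case by (rule succ_mem_succ[OF PM(2)[OF succ_omega[OF succ.hyps]]])
  next
    case definable
    show ?case unfolding defpred_def by (intro definable_intros)
  qed
  \<comment> \<open>The chosen relation links consecutive stages only; by induction any later stage
    preserves all earlier prefixes.\<close>
  have coh: "\<forall>i. i \<^bold>\<in> succ n \<longrightarrow> agree (?M i) (?P n) (?P i) \<and> ?M i \<^bold>\<in> succ (?M n)" if "n \<^bold>\<in> \<omega>" for n
    using that
  proof (induction rule: omega_induct)
    case zero
    then show ?case by simp
  next
    case (succ n)
    show ?case
    proof (intro allI impI)
      fix i assume i: "i \<^bold>\<in> succ (succ n)"
      show "agree (?M i) (?P (succ n)) (?P i) \<and> ?M i \<^bold>\<in> succ (?M (succ n))"
      proof (cases "i = succ n")
        case False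
        then have "i \<^bold>\<in> succ n" using i mem_succ by blast
        with succ.IH have IH: "agree (?M i) (?P n) (?P i)" "?M i \<^bold>\<in> succ (?M n)" by blast+
        have "agree (?M i) (?P (succ n)) (?P n)"
          by (rule agree_mono[OF PM(2)[OF succ.hyps] IH(2) step(1)[OF succ.hyps]])
        moreover have "?M i \<^bold>\<in> succ (?M (succ n))"
          by (rule le_trans[OF PM(2)[OF succ_omega[OF succ.hyps]] IH(2)]) (use step(2)[OF succ.hyps] in simp)
        ultimately show ?thesis using agree_trans IH(1) by blast
      qed simp
    qed
  next
    case definable
    show ?case unfolding defpred_def by (intro definable_intros)
  qed
  have d: "defop (\<lambda>n. ?P (succ n) \<^bold>\<cdot> n)" by (rule defopI) (intro definable_intros)
  \<comment> \<open>The limit of the stages, read along the diagonal. Entry \<open>n\<close> comes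
    from stage \<open>n + 1\<close>, whose prefix certainly contains position \<open>n\<close>,
    whereas that of stage \<open>n\<close> may stop right before it.\<close>
  let ?p = "fun_of \<omega> (\<lambda>n. ?P (succ n) \<^bold>\<cdot> n)"
  have pN: "?p \<^bold>\<in> \<N>" by (rule baire_fun_of[OF d]) (use PM(1) in simp)
  have ag: "agree (?M i) ?p (?P i)" if i: "i \<^bold>\<in> \<omega>" for i
    unfolding agree_def
  proof (intro allI impI)
    fix k assume k: "k \<^bold>\<in> ?M i"
    have ko: "k \<^bold>\<in> \<omega>" "succ k \<^bold>\<in> \<omega>" using omega_mem[OF PM(2)[OF i] k] by simp_all
    have "?P (succ k) \<^bold>\<cdot> k = ?P i \<^bold>\<cdot> k"
    proof (cases "i \<^bold>\<in> succ (succ k)")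
      case True
      then show ?thesis using coh[OF ko(2)] k unfolding agree_def by blast
    next
      case False
      then have "succ k \<^bold>\<in> i" using omega_linear[OF i ko(2)] mem_succ by blast
      then have "agree (?M (succ k)) (?P i) (?P (succ k))" using coh[OF i] mem_succ by blast
      moreover have "k \<^bold>\<in> ?M (succ k)"
        using grow[OF ko(2)] less_le_trans[OF PM(2)[OF ko(2)], of k "succ k"] by simp
      ultimately show ?thesis unfolding agree_def by simp
    qed
    then show "?p \<^bold>\<cdot> k = ?P i \<^bold>\<cdot> k" using fun_of_app[OF d ko(1)] by simp
  qed
  have "\<exists>n. n \<^bold>\<in> \<omega> \<and> H \<^bold>\<cdot> ?p \<^bold>\<cdot> n = succ j" if j: "j \<^bold>\<in> \<omega>" for j
  proof -
    have sj: "succ j \<^bold>\<in> \<omega>" using j by simp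
    have "j \<^bold>\<in> ?M (succ j)"
      using grow[OF sj] less_le_trans[OF PM(2)[OF sj], of j "succ j"] by simp
    from step(3)[OF sj this] show ?thesis
      using ag[OF succ_omega[OF sj]] pN unfolding excludes_def by blast
  qed
  with pN show ?thesis by blast
qed

theorem not_Pi02_ACC_le_C_Nat: assumes DC shows "\<not> \<Pi>\<^sup>0\<^sub>2ACC\<^sub>\<nat> \<le>\<^sub>W\<^sup>* C\<^sub>\<nat>"
proof
  assume "\<Pi>\<^sup>0\<^sub>2ACC\<^sub>\<nat> \<le>\<^sub>W\<^sup>* C\<^sub>\<nat>"
  then obtain H K where HK: "conti (instance_name \<Pi>\<^sup>0\<^sub>2ACC\<^sub>\<nat>) (\<lambda>p. H \<^bold>\<cdot> p)"
    "conti (out_dom \<Pi>\<^sup>0\<^sub>2ACC\<^sub>\<nat> C\<^sub>\<nat> (\<lambda>p. H \<^bold>\<cdot> p)) (\<lambda>x. K \<^bold>\<cdot> x)"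
    "\<And>p. instance_name \<Pi>\<^sup>0\<^sub>2ACC\<^sub>\<nat> p \<Longrightarrow> instance_name C\<^sub>\<nat> (H \<^bold>\<cdot> p)"
    "\<And>p q. instance_name \<Pi>\<^sup>0\<^sub>2ACC\<^sub>\<nat> p \<Longrightarrow> solution_name C\<^sub>\<nat> (H \<^bold>\<cdot> p) q \<Longrightarrow>
      solution_name \<Pi>\<^sup>0\<^sub>2ACC\<^sub>\<nat> p (K \<^bold>\<cdot> interleave p q)"
    using le_W_contE by blast
  have H: "conti (\<lambda>p. p \<^bold>\<in> \<N>) (\<lambda>p. H \<^bold>\<cdot> p)"
    by (rule conti_cong[OF HK(1)]) (simp_all add: instance_name_Pi02_ACC)
  have sol: "solution_name \<Pi>\<^sup>0\<^sub>2ACC\<^sub>\<nat> p (K \<^bold>\<cdot> interleave p q)" if "p \<^bold>\<in> \<N>" "solution_name C\<^sub>\<nat> (H \<^bold>\<cdot> p) q" for p q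
    using HK(4) that by (simp add: instance_name_Pi02_ACC)
  obtain p where p: "p \<^bold>\<in> \<N>" "\<And>j. j \<^bold>\<in> \<omega> \<Longrightarrow> \<exists>n. n \<^bold>\<in> \<omega> \<and> H \<^bold>\<cdot> p \<^bold>\<cdot> n = succ j"
    using ex_generic[OF assms excludes_extend[OF H HK(2) sol]] by blast
  have "instance_name C\<^sub>\<nat> (H \<^bold>\<cdot> p)" using HK(3) p(1) by (simp add: instance_name_Pi02_ACC)
  then show False using p(2) unfolding instance_name_C_Nat by blast
qed


subsection \<open>Evaluating recursive functionals\<close>

lemma recursive_functional_intros:
  "recursive_functional rf_zero" "recursive_functional rf_succ" "recursive_functional rf_left"
  "recursive_functional rf_right" "recursive_functional rf_oracle"
  "recursive_functional \<Phi> \<Longrightarrow> recursive_functional \<Psi> \<Longrightarrow> recursive_functional (rf_pair \<Phi> \<Psi>)"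
  "recursive_functional \<Phi> \<Longrightarrow> recursive_functional \<Psi> \<Longrightarrow> recursive_functional (rf_comp \<Phi> \<Psi>)"
  "recursive_functional \<Phi> \<Longrightarrow> recursive_functional \<Psi> \<Longrightarrow> recursive_functional (rf_prec \<Phi> \<Psi>)"
  "recursive_functional \<Phi> \<Longrightarrow> recursive_functional (rf_mu \<Phi>)"
  unfolding recursive_functional_def rf_closed_def by blast+

lemma val_zeroI: "p \<^bold>\<in> \<N> \<Longrightarrow> n \<^bold>\<in> \<omega> \<Longrightarrow> val rf_zero p n \<^bold>0"
  by (simp add: val_rf_zero)

lemma val_succI: "p \<^bold>\<in> \<N> \<Longrightarrow> n \<^bold>\<in> \<omega> \<Longrightarrow> val rf_succ p n (succ n)"
  by (simp add: val_rf_succ)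

lemma val_leftI: "p \<^bold>\<in> \<N> \<Longrightarrow> a \<^bold>\<in> \<omega> \<Longrightarrow> b \<^bold>\<in> \<omega> \<Longrightarrow> val rf_left p (npair a b) a"
  by (auto simp: val_rf_left)

lemma val_rightI: "p \<^bold>\<in> \<N> \<Longrightarrow> a \<^bold>\<in> \<omega> \<Longrightarrow> b \<^bold>\<in> \<omega> \<Longrightarrow> val rf_right p (npair a b) b"
  by (auto simp: val_rf_right)

lemma val_oracleI: "p \<^bold>\<in> \<N> \<Longrightarrow> n \<^bold>\<in> \<omega> \<Longrightarrow> val rf_oracle p n (p \<^bold>\<cdot> n)"
  by (simp add: val_rf_oracle)

lemma val_pairI:
  "p \<^bold>\<in> \<N> \<Longrightarrow> n \<^bold>\<in> \<omega> \<Longrightarrow> val \<Phi> p n a \<Longrightarrow> val \<Psi> p n b \<Longrightarrow> val (rf_pair \<Phi> \<Psi>) p n (npair a b)"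
  unfolding val_rf_pair using val_omega npair_omega by blast

lemma val_compI:
  "p \<^bold>\<in> \<N> \<Longrightarrow> n \<^bold>\<in> \<omega> \<Longrightarrow> val \<Psi> p n a \<Longrightarrow> val \<Phi> p a m \<Longrightarrow> val (rf_comp \<Phi> \<Psi>) p n m"
  unfolding val_rf_comp using val_omega by blast

lemma val_precI:
  assumes "p \<^bold>\<in> \<N>" "a \<^bold>\<in> \<omega>" "k \<^bold>\<in> \<omega>" "maps s (succ k) \<omega>" "val \<Phi> p a (s \<^bold>\<cdot> \<^bold>0)"
    "\<And>j. j \<^bold>\<in> k \<Longrightarrow> j \<^bold>\<in> \<omega> \<Longrightarrow> s \<^bold>\<cdot> j \<^bold>\<in> \<omega> \<Longrightarrow> val \<Psi> p (npair a (npair j (s \<^bold>\<cdot> j))) (s \<^bold>\<cdot> succ j)"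
  shows "val (rf_prec \<Phi> \<Psi>) p (npair a k) (s \<^bold>\<cdot> k)"
proof -
  have "val \<Psi> p (npair a (npair j (s \<^bold>\<cdot> j))) (s \<^bold>\<cdot> succ j)" if "j \<^bold>\<in> k" for j
    using assms(6)[OF that omega_mem[OF assms(3) that]] maps_app[OF assms(4), of j] that by simp
  then have "prec_run \<Phi> \<Psi> p a k s" using assms(4,5) unfolding prec_run_def by blast
  moreover have "s \<^bold>\<cdot> k \<^bold>\<in> \<omega>" using maps_app[OF assms(4), of k] by simp
  ultimately show ?thesis using assms(1-3) npair_omega unfolding val_rf_prec by blast
qed

text \<open>Doubling is needed to address the two halves of an interleaved oracle. It is primitive
  recursion with dummy parameter 0, whose step extracts the previous value from the nested pair and
  adds 2.\<close>

definition rf_double :: "'v \<Rightarrow> 'v" where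
  "rf_double \<Psi> = rf_comp (rf_prec rf_zero (rf_comp rf_succ (rf_comp rf_succ (rf_comp rf_right rf_right))))
     (rf_pair rf_zero \<Psi>)"

lemma val_doubleI:
  assumes p: "p \<^bold>\<in> \<N>" and n: "n \<^bold>\<in> \<omega>" and v: "val \<Psi> p n k" shows "val (rf_double \<Psi>) p n (add k k)"
proof -
  have k: "k \<^bold>\<in> \<omega>" using val_omega[OF v] .
  let ?s = "fun_of (succ k) (\<lambda>j. addo j j)"
  have d: "defop (\<lambda>j. addo j j)" by (rule defopI) (intro definable_intros)
  have app: "?s \<^bold>\<cdot> j = add j j" if "j \<^bold>\<in> succ k" for j
    using fun_of_app[OF d that] omega_mem[OF succ_omega[OF k] that] by simp
  have "val (rf_prec rf_zero (rf_comp rf_succ (rf_comp rf_succ (rf_comp rf_right rf_right)))) p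
      (npair \<^bold>0 k) (?s \<^bold>\<cdot> k)"
  proof (rule val_precI[OF p zero_omega k])
    show "maps ?s (succ k) \<omega>"
      by (rule maps_fun_of[OF d]) (use omega_mem[OF succ_omega[OF k]] in simp)
    show "val rf_zero p \<^bold>0 (?s \<^bold>\<cdot> \<^bold>0)"
      using app[of "\<^bold>0"] zero_mem_or_zero[OF k] val_zeroI[OF p zero_omega] by auto
    fix j assume j: "j \<^bold>\<in> k" "j \<^bold>\<in> \<omega>" "?s \<^bold>\<cdot> j \<^bold>\<in> \<omega>"
    have "?s \<^bold>\<cdot> succ j = succ (succ (?s \<^bold>\<cdot> j))"
      using app[of "succ j"] app[of j] succ_mem_succ[OF k j(1)] j(1,2) by simp
    then show "val (rf_comp rf_succ (rf_comp rf_succ (rf_comp rf_right rf_right))) p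
        (npair \<^bold>0 (npair j (?s \<^bold>\<cdot> j))) (?s \<^bold>\<cdot> succ j)"
      using j p by (auto intro!: val_compI[OF p] val_rightI val_succI)
  qed
  then have "val (rf_prec rf_zero (rf_comp rf_succ (rf_comp rf_succ (rf_comp rf_right rf_right)))) p
      (npair \<^bold>0 k) (add k k)" using app[of k] by simp
  then show ?thesis
    unfolding rf_double_def by (rule val_compI[OF p n val_pairI[OF p n val_zeroI[OF p n] v]])
qed

text \<open>Queries the first half of an interleaved oracle at the position computed by
  \<open>\<Psi>\<close>; \<open>rf_odd\<close> queries the second half.\<close>

definition rf_even :: "'v \<Rightarrow> 'v" where
  "rf_even \<Psi> = rf_comp rf_oracle (rf_double \<Psi>)"

definition rf_odd :: "'v \<Rightarrow> 'v" where
  "rf_odd \<Psi> = rf_comp rf_oracle (rf_comp rf_succ (rf_double \<Psi>))"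

lemma val_evenI:
  assumes "x \<^bold>\<in> \<N>" "q \<^bold>\<in> \<N>" "n \<^bold>\<in> \<omega>" "val \<Psi> (interleave x q) n k"
  shows "val (rf_even \<Psi>) (interleave x q) n (x \<^bold>\<cdot> k)"
proof -
  have k: "k \<^bold>\<in> \<omega>" using val_omega[OF assms(4)] .
  have X: "interleave x q \<^bold>\<in> \<N>" using assms by simp
  show ?thesis
    unfolding rf_even_def
    using val_compI[OF X assms(3) val_doubleI[OF X assms(3,4)] val_oracleI[OF X add_omega[OF k k]]] k by simp
qed

lemma val_oddI:
  assumes "x \<^bold>\<in> \<N>" "q \<^bold>\<in> \<N>" "n \<^bold>\<in> \<omega>" "val \<Psi> (interleave x q) n k"
  shows "val (rf_odd \<Psi>) (interleave x q) n (q \<^bold>\<cdot> k)"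
proof -
  have k: "k \<^bold>\<in> \<omega>" using val_omega[OF assms(4)] .
  have X: "interleave x q \<^bold>\<in> \<N>" using assms by simp
  show ?thesis
    unfolding rf_odd_def
    using val_compI[OF X assms(3) val_compI[OF X assms(3) val_doubleI[OF X assms(3,4)] val_succI[OF X add_omega[OF k k]]]
        val_oracleI[OF X succ_omega[OF add_omega[OF k k]]]] k by simp
qed

subsection \<open>Coding prefixes\<close>

text \<open>Prefixes are coded by iterated pairing, \<open>s\<close> listing the codes of all
  shorter prefixes as well. The code does not reveal the length, because \<open>npair\<close> sends
  two zeros to 0; therefore codes are always used together with \<open>m\<close>.\<close>

definition codes :: "'v \<Rightarrow> 'v \<Rightarrow> 'v \<Rightarrow> bool" where
  "codes q m s \<longleftrightarrow> maps s (succ m) \<omega> \<and> s \<^bold>\<cdot> \<^bold>0 = \<^bold>0 \<and>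
     (\<forall>j. j \<^bold>\<in> m \<longrightarrow> s \<^bold>\<cdot> succ j = npairo (s \<^bold>\<cdot> j) (q \<^bold>\<cdot> j))"

lemma definable_codes [definable_intros]:
  assumes "defterm q" "defterm m" "defterm s" shows "definable (\<lambda>e. codes (q e) (m e) (s e))"
  unfolding codes_def by (intro definable_intros assms[THEN defterm_rename] assms)

lemma codes_omega: "codes q m s \<Longrightarrow> j \<^bold>\<in> succ m \<Longrightarrow> s \<^bold>\<cdot> j \<^bold>\<in> \<omega>"
  unfolding codes_def using maps_app by blast

lemma ex_codes: assumes q: "q \<^bold>\<in> \<N>" and m: "m \<^bold>\<in> \<omega>" shows "\<exists>s. codes q m s"
proof -
  let ?h = "\<lambda>j x. npairo x (q \<^bold>\<cdot> j)"
  have d: "defop2 ?h" by (rule defop2I[of ?h]) (intro definable_intros)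
  obtain s where s: "approx \<^bold>0 ?h m s" using ex_approx[OF d m] by blast
  have v: "j \<^bold>\<in> succ m \<longrightarrow> s \<^bold>\<cdot> j \<^bold>\<in> \<omega>" if "j \<^bold>\<in> \<omega>" for j
    using that
  proof (induction rule: omega_induct)
    case zero
    then show ?case using s by (simp add: approx_def)
  next
    case (succ j)
    show ?case
    proof
      assume "succ j \<^bold>\<in> succ m"
      then have j: "j \<^bold>\<in> m" using succ_mem_iff m succ.hyps by blast
      then have "s \<^bold>\<cdot> j \<^bold>\<in> \<omega>" using succ.IH by simp
      then show "s \<^bold>\<cdot> succ j \<^bold>\<in> \<omega>" using s j succ.hyps q by (simp add: approx_def)
    qed
  next
    case definable
    show ?case unfolding defpred_def by (intro definable_intros)
  qed
  have f: "func s" and dom: "\<And>x. in_dom x s \<longleftrightarrow> x \<^bold>\<in> succ m" using s unfolding approx_def by blast+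
  have "y \<^bold>\<in> \<omega>" if xy: "\<^bold>\<langle>x, y\<^bold>\<rangle> \<^bold>\<in> s" for x y
  proof -
    have x: "x \<^bold>\<in> succ m" using xy dom unfolding in_dom_def by blast
    then have "s \<^bold>\<cdot> x \<^bold>\<in> \<omega>" using v omega_mem[OF succ_omega[OF m] x] by blast
    then show ?thesis using func_app[OF f xy] by simp
  qed
  then have "maps s (succ m) \<omega>" unfolding maps_def using f dom by blast
  then show ?thesis using s unfolding codes_def approx_def by blast
qed

text \<open>For a known length the code can be unwound: injectivity of pairing turns equal codes at
  \<open>succ k\<close> into equal entries at \<open>k\<close> and equal codes at
  \<open>k\<close>.\<close>

lemma codes_agree:
  assumes m: "m \<^bold>\<in> \<omega>" and q: "q \<^bold>\<in> \<N>" "q' \<^bold>\<in> \<N>" and s: "codes q m s" "codes q' m s'"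
    and eq: "s \<^bold>\<cdot> m = s' \<^bold>\<cdot> m"
  shows "agree m q q'"
proof -
  have "k \<^bold>\<in> succ m \<longrightarrow> s \<^bold>\<cdot> k = s' \<^bold>\<cdot> k \<longrightarrow> agree k q q'" if "k \<^bold>\<in> \<omega>" for k
    using that
  proof (induction rule: omega_induct)
    case zero
    then show ?case by (simp add: agree_def)
  next
    case (succ k)
    show ?case
    proof (intro impI)
      assume "succ k \<^bold>\<in> succ m" and e: "s \<^bold>\<cdot> succ k = s' \<^bold>\<cdot> succ k"
      then have k: "k \<^bold>\<in> m" using succ_mem_iff m succ.hyps by blast
      have o: "s \<^bold>\<cdot> k \<^bold>\<in> \<omega>" "s' \<^bold>\<cdot> k \<^bold>\<in> \<omega>" "q \<^bold>\<cdot> k \<^bold>\<in> \<omega>" "q' \<^bold>\<cdot> k \<^bold>\<in> \<omega>"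
        using codes_omega[OF s(1), of k] codes_omega[OF s(2), of k] k succ.hyps q by simp_all
      have "npair (s \<^bold>\<cdot> k) (q \<^bold>\<cdot> k) = npair (s' \<^bold>\<cdot> k) (q' \<^bold>\<cdot> k)"
        using e s k o unfolding codes_def by simp
      then have "s \<^bold>\<cdot> k = s' \<^bold>\<cdot> k" "q \<^bold>\<cdot> k = q' \<^bold>\<cdot> k" using npair_inject[OF o(1,3,2,4)] by blast+
      then show "agree (succ k) q q'" using succ.IH k unfolding agree_def by auto
    qed
  next
    case definable
    show ?case unfolding defpred_def by (intro definable_intros)
  qed
  with m eq show ?thesis by simp
qed

text \<open>Codes a prefix of the second half of the oracle. The parameter of the recursion is not
  consulted by the step; it passes on the argument of the later search. In the step
  \<open>rf_comp rf_left rf_right\<close> is the index \<open>j\<close> and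
  \<open>rf_comp rf_right rf_right\<close> the code so far.\<close>

definition rf_code :: 'v where
  "rf_code = rf_prec rf_zero (rf_pair (rf_comp rf_right rf_right) (rf_odd (rf_comp rf_left rf_right)))"

lemma val_codeI:
  assumes x: "x \<^bold>\<in> \<N>" and q: "q \<^bold>\<in> \<N>" and a: "a \<^bold>\<in> \<omega>" and m: "m \<^bold>\<in> \<omega>" and s: "codes q m s"
  shows "val rf_code (interleave x q) (npair a m) (s \<^bold>\<cdot> m)"
  unfolding rf_code_def
proof (rule val_precI[OF _ a m])
  have X: "interleave x q \<^bold>\<in> \<N>" using x q by simp
  then show "interleave x q \<^bold>\<in> \<N>" .
  show "maps s (succ m) \<omega>" using s unfolding codes_def by blast
  show "val rf_zero (interleave x q) a (s \<^bold>\<cdot> \<^bold>0)" using s val_zeroI[OF X a] unfolding codes_def by simp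
  fix j assume j: "j \<^bold>\<in> m" "j \<^bold>\<in> \<omega>" "s \<^bold>\<cdot> j \<^bold>\<in> \<omega>"
  let ?n = "npair a (npair j (s \<^bold>\<cdot> j))"
  have n: "?n \<^bold>\<in> \<omega>" "npair j (s \<^bold>\<cdot> j) \<^bold>\<in> \<omega>" using j a by simp_all
  have r: "val rf_right (interleave x q) ?n (npair j (s \<^bold>\<cdot> j))" by (rule val_rightI[OF X a n(2)])
  have "val (rf_comp rf_right rf_right) (interleave x q) ?n (s \<^bold>\<cdot> j)"
    by (rule val_compI[OF X n(1) r val_rightI[OF X j(2,3)]])
  moreover have "val (rf_odd (rf_comp rf_left rf_right)) (interleave x q) ?n (q \<^bold>\<cdot> j)"
    by (rule val_oddI[OF x q n(1) val_compI[OF X n(1) r val_leftI[OF X j(2,3)]]])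
  ultimately have "val (rf_pair (rf_comp rf_right rf_right) (rf_odd (rf_comp rf_left rf_right)))
      (interleave x q) ?n (npair (s \<^bold>\<cdot> j) (q \<^bold>\<cdot> j))" by (rule val_pairI[OF X n(1)])
  moreover have "s \<^bold>\<cdot> succ j = npair (s \<^bold>\<cdot> j) (q \<^bold>\<cdot> j)"
    using s j q unfolding codes_def by simp
  ultimately show "val (rf_pair (rf_comp rf_right rf_right) (rf_odd (rf_comp rf_left rf_right)))
      (interleave x q) ?n (s \<^bold>\<cdot> succ j)" by simp
qed

end

subsection \<open>From a continuous to a computable reduction\<close>

text \<open>Holds a fixed continuous reduction of all-or-co-unique choice to \<open>f\<close>, in
  the form that \<open>le_W_contE\<close> delivers.\<close>

locale cont_reduction = zf_structure mem for mem :: "'v \<Rightarrow> 'v \<Rightarrow> bool"  (infix "\<^bold>\<in>" 50) +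
  fixes f :: "'v problem" and H K :: 'v
  assumes f: "is_problem f"
    and H: "conti (\<lambda>p. p \<^bold>\<in> \<N>) (\<lambda>p. H \<^bold>\<cdot> p)"
    and K: "conti (out_dom \<Pi>\<^sup>0\<^sub>2ACC\<^sub>\<nat> f (\<lambda>p. H \<^bold>\<cdot> p)) (\<lambda>x. K \<^bold>\<cdot> x)"
    and inst: "\<And>p. p \<^bold>\<in> \<N> \<Longrightarrow> instance_name f (H \<^bold>\<cdot> p)"
    and sol: "\<And>p q. p \<^bold>\<in> \<N> \<Longrightarrow> solution_name f (H \<^bold>\<cdot> p) q \<Longrightarrow>
      solution_name \<Pi>\<^sup>0\<^sub>2ACC\<^sub>\<nat> p (K \<^bold>\<cdot> interleave p q)"
begin

lemma f_solution_baire: "solution_name f p q \<Longrightarrow> q \<^bold>\<in> \<N>"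
  using f unfolding is_problem_def represented_space_def partial_maps_def solution_name_def by blast

lemma H_baire [simp]: "p \<^bold>\<in> \<N> \<Longrightarrow> H \<^bold>\<cdot> p \<^bold>\<in> \<N>"
  by (rule contiD(2)[OF H])

section \<open>The table of finitely determined answers\<close>

definition run :: "'v \<Rightarrow> 'v \<Rightarrow> 'v \<Rightarrow> 'v \<Rightarrow> bool" where
  "run p m c q \<longleftrightarrow> p \<^bold>\<in> \<N> \<and> solution_name f (H \<^bold>\<cdot> p) q \<and> (\<exists>s. codes q m s \<and> s \<^bold>\<cdot> m = c)"

text \<open>\<open>answer p i l\<close>: for \<open>i\<close> the pair of \<open>m\<close> and \<open>c\<close>, the prefix of \<open>p\<close> of length \<open>m\<close> together with
  the prefix coded by \<open>c\<close> forces the first value of \<open>K\<close> to be \<open>l\<close>.\<close>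

definition answer :: "'v \<Rightarrow> 'v \<Rightarrow> 'v \<Rightarrow> bool" where
  "answer p i l \<longleftrightarrow> (\<exists>m c. m \<^bold>\<in> \<omega> \<and> c \<^bold>\<in> \<omega> \<and> i = npairo m c \<and>
     (\<exists>p' q'. agree m p' p \<and> run p' m c q') \<and>
     (\<forall>p' q'. agree m p' p \<and> run p' m c q' \<longrightarrow> K \<^bold>\<cdot> interleave p' q' \<^bold>\<cdot> \<^bold>0 = l))"

lemma definable_run [definable_intros]:
  assumes "defterm p" "defterm m" "defterm c" "defterm q"
  shows "definable (\<lambda>e. run (p e) (m e) (c e) (q e))"
  unfolding run_def by (intro definable_intros assms[THEN defterm_rename] assms)

lemma definable_answer [definable_intros]:
  assumes "defterm p" "defterm i" "defterm l" shows "definable (\<lambda>e. answer (p e) (i e) (l e))"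
  unfolding answer_def by (intro definable_intros assms[THEN defterm_rename] assms)

lemma K_omega: "p \<^bold>\<in> \<N> \<Longrightarrow> solution_name f (H \<^bold>\<cdot> p) q \<Longrightarrow> K \<^bold>\<cdot> interleave p q \<^bold>\<cdot> \<^bold>0 \<^bold>\<in> \<omega>"
  using sol unfolding solution_name_Pi02_ACC by simp

lemma answer_omega: "answer p i l \<Longrightarrow> l \<^bold>\<in> \<omega>"
  using K_omega unfolding answer_def run_def by metis

text \<open>\<open>answer\<close> requires some compatible run. Without one, every \<open>l\<close>
  would satisfy the universal clause vacuously.\<close>

lemma answer_unique: assumes "answer p i l" "answer p i l'" shows "l = l'"
proof -
  obtain m c where m: "m \<^bold>\<in> \<omega>" "c \<^bold>\<in> \<omega>" "i = npairo m c" "\<exists>p' q'. agree m p' p \<and> run p' m c q'"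
    "\<And>p' q'. agree m p' p \<Longrightarrow> run p' m c q' \<Longrightarrow> K \<^bold>\<cdot> interleave p' q' \<^bold>\<cdot> \<^bold>0 = l"
    using assms(1) unfolding answer_def by blast
  obtain m' c' where m': "m' \<^bold>\<in> \<omega>" "c' \<^bold>\<in> \<omega>" "i = npairo m' c'"
    "\<And>p' q'. agree m' p' p \<Longrightarrow> run p' m' c' q' \<Longrightarrow> K \<^bold>\<cdot> interleave p' q' \<^bold>\<cdot> \<^bold>0 = l'"
    using assms(2) unfolding answer_def by blast
  have "m = m'" "c = c'" using npair_inject[OF m(1,2) m'(1,2)] m(1-3) m'(1-3) by auto
  then show ?thesis using m(4,5) m'(4) by metis
qed

text \<open>Although \<open>answer\<close> quantifies over all runs, it sees \<open>p\<close> only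
  through its prefix of length \<open>m\<close>, and \<open>m\<close> is at most the code
  \<open>i\<close>. This makes the table continuous in \<open>p\<close>.\<close>

lemma answer_agree:
  assumes i: "i \<^bold>\<in> \<omega>" and ag: "agree i p p'" shows "answer p i l \<longleftrightarrow> answer p' i l"
proof -
  have "agree m q p \<longleftrightarrow> agree m q p'" if "m \<^bold>\<in> \<omega>" "c \<^bold>\<in> \<omega>" "i = npairo m c" for m c q
  proof -
    have "agree m p p'" using agree_mono[OF i _ ag, of m] npair_ge(1)[OF that(1,2)] that by simp
    then show ?thesis using agree_trans agree_sym by blast
  qed
  then show ?thesis unfolding answer_def by (intro ex_cong1 conj_cong refl) metis+
qed

text \<open>Zero signals that an answer is present, since unbounded search looks for zeros.\<close>

definition flag :: "'v \<Rightarrow> 'v \<Rightarrow> 'v" where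
  "flag p i = (if \<exists>l. answer p i l then \<^bold>0 else succ \<^bold>0)"

text \<open>The union over the at most one answer: it is the answer if there is one, and 0
  otherwise.\<close>

definition out :: "'v \<Rightarrow> 'v \<Rightarrow> 'v" where
  "out p i = collect (\<lambda>u. \<exists>l. answer p i l \<and> u \<^bold>\<in> l)"

lemma out_eq: "answer p i l \<Longrightarrow> out p i = l"
  unfolding out_def by (rule collect_eqI) (use answer_unique in blast)

lemma out_omega: "out p i \<^bold>\<in> \<omega>"
proof (cases "\<exists>l. answer p i l")
  case True
  then show ?thesis using out_eq answer_omega by metis
next
  case False
  then have "out p i = \<^bold>0" unfolding out_def by (intro collect_eqI) simp
  then show ?thesis by simp
qed

lemma flag_omega: "flag p i \<^bold>\<in> \<omega>"
  by (simp add: flag_def)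

lemma defterm_flag [definable_intros]:
  assumes "defterm p" "defterm i" shows "defterm (\<lambda>e. flag (p e) (i e))"
  unfolding flag_def by (intro definable_intros assms[THEN defterm_rename])

lemma defterm_out [definable_intros]:
  assumes "defterm p" "defterm i" shows "defterm (\<lambda>e. out (p e) (i e))"
  unfolding out_def
proof (rule defterm_collect)
  show "definable (\<lambda>e. \<exists>l. answer (p (\<lambda>n. e (Suc n))) (i (\<lambda>n. e (Suc n))) l \<and> e 0 \<^bold>\<in> l)"
    by (intro definable_intros assms[THEN defterm_rename])
  show "\<exists>z. \<forall>x. x \<^bold>\<in> z \<longleftrightarrow> (\<exists>l. answer (p e) (i e) l \<and> x \<^bold>\<in> l)" for e
    using answer_unique mem_empty by metis
qed

text \<open>The instance \<open>p\<close> is recorded together with the value of \<open>H\<close> and with a table of the answers of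
  \<open>K\<close>, so that both parts of the reduction become computable.\<close>

definition enc_at :: "'v \<Rightarrow> 'v \<Rightarrow> 'v" where
  "enc_at p i = npairo (H \<^bold>\<cdot> p \<^bold>\<cdot> i) (npairo (p \<^bold>\<cdot> i) (npairo (flag p i) (out p i)))"

definition enc :: "'v \<Rightarrow> 'v" where
  "enc p = fun_of \<omega> (enc_at p)"

lemma defterm_enc_at [definable_intros]:
  assumes "defterm p" "defterm i" shows "defterm (\<lambda>e. enc_at (p e) (i e))"
  unfolding enc_at_def by (intro definable_intros assms)

lemma defop_enc_at: "defop (enc_at p)"
  by (rule defopI) (intro definable_intros)

lemma defterm_enc [definable_intros]:
  assumes "defterm p" shows "defterm (\<lambda>e. enc (p e))"
  unfolding enc_def by (intro definable_intros assms[THEN defterm_rename])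

lemma enc_app:
  assumes "p \<^bold>\<in> \<N>" "i \<^bold>\<in> \<omega>"
  shows "enc p \<^bold>\<cdot> i = npair (H \<^bold>\<cdot> p \<^bold>\<cdot> i) (npair (p \<^bold>\<cdot> i) (npair (flag p i) (out p i)))"
  unfolding enc_def fun_of_app[OF defop_enc_at assms(2)] enc_at_def
  using assms flag_omega out_omega by simp

lemma enc_baire [simp]: "p \<^bold>\<in> \<N> \<Longrightarrow> enc p \<^bold>\<in> \<N>"
  unfolding enc_def
  by (rule baire_fun_of[OF defop_enc_at]) (simp add: enc_at_def flag_omega out_omega)

text \<open>The entries of \<open>p\<close> are recorded in \<open>enc_at\<close> for this purpose.
  Injectivity makes the solutions of a recorded instance depend on \<open>p\<close> alone and the
  maps of the new reduction single-valued.\<close>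

lemma enc_inject: assumes p: "p \<^bold>\<in> \<N>" "p' \<^bold>\<in> \<N>" and e: "enc p = enc p'" shows "p = p'"
proof (rule baire_ext[OF p])
  fix i assume i: "i \<^bold>\<in> \<omega>"
  have "npair (H \<^bold>\<cdot> p \<^bold>\<cdot> i) (npair (p \<^bold>\<cdot> i) (npair (flag p i) (out p i))) =
    npair (H \<^bold>\<cdot> p' \<^bold>\<cdot> i) (npair (p' \<^bold>\<cdot> i) (npair (flag p' i) (out p' i)))"
    using e enc_app[OF p(1) i] enc_app[OF p(2) i] by simp
  then show "p \<^bold>\<cdot> i = p' \<^bold>\<cdot> i"
    using p i flag_omega out_omega by (simp add: npair_inject)
qed

lemma conti_enc: "conti (\<lambda>p. p \<^bold>\<in> \<N>) enc"
proof (rule contiI)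
  fix p n assume p: "p \<^bold>\<in> \<N>" and n: "n \<^bold>\<in> \<omega>"
  \<comment> \<open>Only the component coming from \<open>H\<close> calls for a modulus; the other
    components of entry \<open>i\<close> depend on the entries of \<open>p\<close> up to
    \<open>i\<close>.\<close>
  obtain k where k: "k \<^bold>\<in> \<omega>" "\<And>p'. p' \<^bold>\<in> \<N> \<Longrightarrow> agree k p' p \<Longrightarrow> agree n (H \<^bold>\<cdot> p') (H \<^bold>\<cdot> p)"
    using contiD(3)[OF H p n] by blast
  obtain m where m: "m \<^bold>\<in> \<omega>" "k \<^bold>\<in> succ m" "n \<^bold>\<in> succ m" using omega_max[OF k(1) n] by blast
  have "enc p' \<^bold>\<cdot> i = enc p \<^bold>\<cdot> i" if p': "p' \<^bold>\<in> \<N>" "agree m p' p" and i: "i \<^bold>\<in> n" for p' i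
  proof -
    have io: "i \<^bold>\<in> \<omega>" using omega_mem[OF n i] .
    have an: "agree n p' p" by (rule agree_mono[OF m(1,3) p'(2)])
    then have "agree i p' p" using omega_trans[OF n i] unfolding agree_def by blast
    then have a: "answer p' i l \<longleftrightarrow> answer p i l" for l by (rule answer_agree[OF io])
    have "flag p' i = flag p i" "out p' i = out p i" unfolding flag_def out_def a by (rule refl)+
    moreover have "p' \<^bold>\<cdot> i = p \<^bold>\<cdot> i" "H \<^bold>\<cdot> p' \<^bold>\<cdot> i = H \<^bold>\<cdot> p \<^bold>\<cdot> i"
      using an i k(2)[OF p'(1) agree_mono[OF m(1,2) p'(2)]] unfolding agree_def by blast+
    ultimately show ?thesis using enc_app[OF p'(1) io] enc_app[OF p io] by simp
  qed
  then show "\<exists>m. m \<^bold>\<in> \<omega> \<and> (\<forall>p'. p' \<^bold>\<in> \<N> \<and> agree m p' p \<longrightarrow> agree n (enc p') (enc p))"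
    using m(1) unfolding agree_def by blast
qed simp_all

text \<open>All-or-co-unique choice restricted to enriched names. Inputs in Baire space and outputs
  in the naturals place it in the range over which the first-order part is maximal.\<close>

definition coded_problem :: "'v problem" where
  "coded_problem = \<lparr>src = \<N>, src_rep = baire_rep, tgt = \<omega>, tgt_rep = nat_rep,
     graph = collect (\<lambda>z. \<exists>p k. p \<^bold>\<in> \<N> \<and> k \<^bold>\<in> \<omega> \<and> \<not> has_limit p k \<and> z = \<^bold>\<langle>enc p, k\<^bold>\<rangle>)\<rparr>"

lemma coded_problem_simps [simp]:
  "src coded_problem = \<N>" "src_rep coded_problem = baire_rep" "tgt coded_problem = \<omega>" "tgt_rep coded_problem = nat_rep"
  by (simp_all add: coded_problem_def)

lemma mem_graph_coded:
  "z \<^bold>\<in> graph coded_problem \<longleftrightarrow> (\<exists>p k. p \<^bold>\<in> \<N> \<and> k \<^bold>\<in> \<omega> \<and> \<not> has_limit p k \<and> z = \<^bold>\<langle>enc p, k\<^bold>\<rangle>)"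
proof -
  have d: "defpred (\<lambda>z. \<exists>p k. p \<^bold>\<in> \<N> \<and> k \<^bold>\<in> \<omega> \<and> \<not> has_limit p k \<and> z = \<^bold>\<langle>enc p, k\<^bold>\<rangle>)"
    unfolding defpred_def by (intro definable_intros)
  show ?thesis
    unfolding coded_problem_def problem.simps
    by (rule mem_collect_sub[OF d, of "cart \<N> \<omega>"]) (auto simp: mem_cart)
qed

lemma graph_coded: "p \<^bold>\<in> \<N> \<Longrightarrow> \<^bold>\<langle>enc p, k\<^bold>\<rangle> \<^bold>\<in> graph coded_problem \<longleftrightarrow> k \<^bold>\<in> \<omega> \<and> \<not> has_limit p k"
  unfolding mem_graph_coded using enc_inject by auto

lemma instance_name_coded: "instance_name coded_problem x \<longleftrightarrow> (\<exists>p. p \<^bold>\<in> \<N> \<and> x = enc p)"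
proof
  assume "instance_name coded_problem x"
  then obtain y where "\<^bold>\<langle>x, y\<^bold>\<rangle> \<^bold>\<in> graph coded_problem"
    unfolding baire_nat_instance_name[OF coded_problem_simps(2)] in_dom_def by blast
  then show "\<exists>p. p \<^bold>\<in> \<N> \<and> x = enc p" unfolding mem_graph_coded by auto
next
  assume "\<exists>p. p \<^bold>\<in> \<N> \<and> x = enc p"
  then obtain p where p: "p \<^bold>\<in> \<N>" "x = enc p" by blast
  obtain k where "k \<^bold>\<in> \<omega>" "\<not> has_limit p k"
    using instance_name_Pi02_ACC[of p] p(1)
    unfolding baire_nat_instance_name[OF Pi02_ACC_simps(2)] in_dom_def graph_Pi02_ACC by blast
  then show "instance_name coded_problem x"
    unfolding baire_nat_instance_name[OF coded_problem_simps(2)] in_dom_def p(2)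
    using graph_coded p(1) enc_baire by blast
qed

lemma solution_name_coded:
  "p \<^bold>\<in> \<N> \<Longrightarrow> solution_name coded_problem (enc p) q \<longleftrightarrow> q \<^bold>\<in> \<N> \<and> \<not> has_limit p (q \<^bold>\<cdot> \<^bold>0)"
  unfolding baire_nat_solution_name[OF coded_problem_simps(2,4)] by (auto simp: graph_coded)

lemma baire_nat_coded: "baire_nat_problem coded_problem"
proof -
  have "\<exists>x y. z = \<^bold>\<langle>x, y\<^bold>\<rangle>" if "z \<^bold>\<in> baire_rep" for z
    using that unfolding mem_baire_rep' by blast
  then have "represented_space \<N> baire_rep"
    unfolding represented_space_def partial_maps_def func_def mem_baire_rep by blast
  moreover have "\<exists>x y. z = \<^bold>\<langle>x, y\<^bold>\<rangle>" if "z \<^bold>\<in> nat_rep" for z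
    using that unfolding mem_nat_rep' by blast
  then have "partial_maps nat_rep \<N> \<omega>"
    unfolding partial_maps_def func_def mem_nat_rep using baire_app zero_omega by blast
  moreover have "\<exists>p. \<^bold>\<langle>p, k\<^bold>\<rangle> \<^bold>\<in> nat_rep" if "k \<^bold>\<in> \<omega>" for k
    using that by (intro exI[of _ "const_seq k"]) (simp add: mem_nat_rep)
  ultimately have "represented_space \<N> baire_rep" "represented_space \<omega> nat_rep"
    unfolding represented_space_def by blast+
  moreover have "\<exists>x y. x \<^bold>\<in> \<N> \<and> y \<^bold>\<in> \<omega> \<and> z = \<^bold>\<langle>x, y\<^bold>\<rangle>" if "z \<^bold>\<in> graph coded_problem" for z
    using that enc_baire unfolding mem_graph_coded by blast
  ultimately show ?thesis unfolding baire_nat_problem_def is_problem_def by simp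
qed

lemma Pi02_ACC_le_coded: "\<Pi>\<^sup>0\<^sub>2ACC\<^sub>\<nat> \<le>\<^sub>W\<^sup>* coded_problem"
proof (rule le_W_contI[of enc right])
  show "defop enc" "defop right" by (rule defopI, intro definable_intros)+
  show "conti (instance_name \<Pi>\<^sup>0\<^sub>2ACC\<^sub>\<nat>) enc"
    by (rule conti_cong[OF conti_enc]) (simp_all add: instance_name_Pi02_ACC)
  show "conti (out_dom \<Pi>\<^sup>0\<^sub>2ACC\<^sub>\<nat> coded_problem enc) right"
    by (rule conti_right) (auto simp: out_dom_def instance_name_Pi02_ACC solution_name_coded)
  show "instance_name coded_problem (enc p)" if "instance_name \<Pi>\<^sup>0\<^sub>2ACC\<^sub>\<nat> p" for p
    using that instance_name_coded instance_name_Pi02_ACC by blast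
  show "solution_name \<Pi>\<^sup>0\<^sub>2ACC\<^sub>\<nat> p (right (interleave p q))"
    if "instance_name \<Pi>\<^sup>0\<^sub>2ACC\<^sub>\<nat> p" "solution_name coded_problem (enc p) q" for p q
    using that by (simp add: instance_name_Pi02_ACC solution_name_coded solution_name_Pi02_ACC)
qed

text \<open>Continuity of \<open>K\<close> at the pair of \<open>p\<close> and \<open>q\<close>
  gives one prefix length that serves for both, so the search in the table succeeds.\<close>

lemma ex_answer:
  assumes p: "p \<^bold>\<in> \<N>" and q: "solution_name f (H \<^bold>\<cdot> p) q"
  shows "\<exists>m s. m \<^bold>\<in> \<omega> \<and> codes q m s \<and> answer p (npair m (s \<^bold>\<cdot> m)) (K \<^bold>\<cdot> interleave p q \<^bold>\<cdot> \<^bold>0)"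
proof -
  let ?D = "out_dom \<Pi>\<^sup>0\<^sub>2ACC\<^sub>\<nat> f (\<lambda>p. H \<^bold>\<cdot> p)"
  have dom: "?D (interleave p' q')" if "p' \<^bold>\<in> \<N>" "solution_name f (H \<^bold>\<cdot> p') q'" for p' q'
    using that unfolding out_dom_def instance_name_Pi02_ACC by blast
  have qN: "q \<^bold>\<in> \<N>" using f_solution_baire[OF q] .
  obtain m where m: "m \<^bold>\<in> \<omega>" "\<And>x. ?D x \<Longrightarrow> agree m x (interleave p q) \<Longrightarrow>
      agree (succ \<^bold>0) (K \<^bold>\<cdot> x) (K \<^bold>\<cdot> interleave p q)"
    using contiD(3)[OF K dom[OF p q] succ_omega[OF zero_omega]] by blast
  obtain s where s: "codes q m s" using ex_codes[OF qN m(1)] by blast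
  have so: "s \<^bold>\<cdot> m \<^bold>\<in> \<omega>" using codes_omega[OF s, of m] by simp
  have "K \<^bold>\<cdot> interleave p' q' \<^bold>\<cdot> \<^bold>0 = K \<^bold>\<cdot> interleave p q \<^bold>\<cdot> \<^bold>0"
    if ag: "agree m p' p" and run: "run p' m (s \<^bold>\<cdot> m) q'" for p' q'
  proof -
    obtain s' where r: "p' \<^bold>\<in> \<N>" "solution_name f (H \<^bold>\<cdot> p') q'" "codes q' m s'" "s' \<^bold>\<cdot> m = s \<^bold>\<cdot> m"
      using run unfolding run_def by blast
    have "agree m q' q" by (rule codes_agree[OF m(1) f_solution_baire[OF r(2)] qN r(3) s r(4)])
    then have "agree m (interleave p' q') (interleave p q)" by (rule agree_interleave[OF m(1) ag])
    from m(2)[OF dom[OF r(1,2)] this] show ?thesis by (simp add: agree_def)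
  qed
  moreover have "run p m (s \<^bold>\<cdot> m) q" unfolding run_def using p q s by blast
  ultimately have "answer p (npairo m (s \<^bold>\<cdot> m)) (K \<^bold>\<cdot> interleave p q \<^bold>\<cdot> \<^bold>0)"
    unfolding answer_def using m(1) so agree_refl by blast
  then show ?thesis using m(1) s so by auto
qed

text \<open>The search may stop at another length than the one given by continuity; whichever entry
  is found, it is right, because the actual run is compatible with it.\<close>

lemma answer_correct:
  assumes p: "p \<^bold>\<in> \<N>" and q: "solution_name f (H \<^bold>\<cdot> p) q" and m: "m \<^bold>\<in> \<omega>" and s: "codes q m s"
    and a: "answer p (npair m (s \<^bold>\<cdot> m)) l"
  shows "K \<^bold>\<cdot> interleave p q \<^bold>\<cdot> \<^bold>0 = l"
proof -
  obtain m' c where m': "m' \<^bold>\<in> \<omega>" "c \<^bold>\<in> \<omega>" "npair m (s \<^bold>\<cdot> m) = npairo m' c"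
    "\<And>p' q'. agree m' p' p \<Longrightarrow> run p' m' c q' \<Longrightarrow> K \<^bold>\<cdot> interleave p' q' \<^bold>\<cdot> \<^bold>0 = l"
    using a unfolding answer_def by blast
  have so: "s \<^bold>\<cdot> m \<^bold>\<in> \<omega>" using codes_omega[OF s, of m] by simp
  have "npair m (s \<^bold>\<cdot> m) = npair m' c" using m'(3) npairo_eq[OF m'(1,2)] by simp
  then have "m = m'" "s \<^bold>\<cdot> m = c" using npair_inject[OF m so m'(1,2)] by blast+
  moreover have "run p m (s \<^bold>\<cdot> m) q" unfolding run_def using p q s by blast
  ultimately show ?thesis using m'(4) agree_refl by blast
qed

text \<open>On the pair of \<open>n\<close> and \<open>m\<close>: the code of the prefix of length
  \<open>m\<close> of the answer is paired with \<open>m\<close>, the enriched name is read there,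
  and two projections leave the flag and the output.\<close>

definition rf_entry :: 'v where
  "rf_entry = rf_comp rf_right (rf_comp rf_right (rf_even (rf_pair rf_right rf_code)))"

lemma val_entryI:
  assumes p: "p \<^bold>\<in> \<N>" and q: "q \<^bold>\<in> \<N>" and n: "n \<^bold>\<in> \<omega>" and m: "m \<^bold>\<in> \<omega>" and s: "codes q m s"
  shows "val rf_entry (interleave (enc p) q) (npair n m)
    (npair (flag p (npair m (s \<^bold>\<cdot> m))) (out p (npair m (s \<^bold>\<cdot> m))))"
proof -
  let ?X = "interleave (enc p) q" and ?i = "npair m (s \<^bold>\<cdot> m)"
  have X: "?X \<^bold>\<in> \<N>" using p q by simp
  have nm: "npair n m \<^bold>\<in> \<omega>" using n m by simp
  have so: "s \<^bold>\<cdot> m \<^bold>\<in> \<omega>" using codes_omega[OF s, of m] by simp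
  have i: "?i \<^bold>\<in> \<omega>" using m so by simp
  have o: "H \<^bold>\<cdot> p \<^bold>\<cdot> ?i \<^bold>\<in> \<omega>" "p \<^bold>\<cdot> ?i \<^bold>\<in> \<omega>" "npair (flag p ?i) (out p ?i) \<^bold>\<in> \<omega>"
    using p i flag_omega out_omega by simp_all
  have "val (rf_pair rf_right rf_code) ?X (npair n m) ?i"
    by (rule val_pairI[OF X nm val_rightI[OF X n m] val_codeI[OF enc_baire[OF p] q n m s]])
  then have "val (rf_even (rf_pair rf_right rf_code)) ?X (npair n m) (enc p \<^bold>\<cdot> ?i)"
    by (rule val_evenI[OF enc_baire[OF p] q nm])
  then show ?thesis
    unfolding rf_entry_def enc_app[OF p i]
    using val_compI[OF X nm val_compI[OF X nm _ val_rightI[OF X o(1) npair_omega[OF o(2,3)]]] val_rightI[OF X o(2,3)]]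
    by blast
qed

text \<open>Searches for a length whose flag is 0 and evaluates that entry again, now with the dummy
  0 as first component. The value is the same at every \<open>n\<close>, so the output is a constant
  sequence.\<close>

definition rf_out :: 'v where
  "rf_out = rf_comp (rf_comp rf_right rf_entry) (rf_pair rf_zero (rf_mu (rf_comp rf_left rf_entry)))"

lemma val_outI:
  assumes p: "p \<^bold>\<in> \<N>" and q: "solution_name f (H \<^bold>\<cdot> p) q" and n: "n \<^bold>\<in> \<omega>"
  shows "val rf_out (interleave (enc p) q) n (K \<^bold>\<cdot> interleave p q \<^bold>\<cdot> \<^bold>0)"
proof -
  let ?X = "interleave (enc p) q"
  have qN: "q \<^bold>\<in> \<N>" using f_solution_baire[OF q] .
  have X: "?X \<^bold>\<in> \<N>" using p qN by simp
  \<comment> \<open>Stated with \<open>npairo\<close> so that the property is definable and the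
    least number principle applies.\<close>
  let ?T = "\<lambda>m. \<exists>s. codes q m s \<and> flag p (npairo m (s \<^bold>\<cdot> m)) = \<^bold>0"
  have flag: "flag p i = \<^bold>0 \<longleftrightarrow> (\<exists>l. answer p i l)" for i by (simp add: flag_def)
  have val_flag: "val (rf_comp rf_left rf_entry) ?X (npair k m) (flag p (npair m (s \<^bold>\<cdot> m)))"
    if "k \<^bold>\<in> \<omega>" "m \<^bold>\<in> \<omega>" "codes q m s" for k m s
    by (rule val_compI[OF X npair_omega[OF that(1,2)] val_entryI[OF p qN that] val_leftI[OF X flag_omega out_omega]])
  have code_omega: "s \<^bold>\<cdot> m \<^bold>\<in> \<omega>" if "codes q m s" for m s using codes_omega[OF that, of m] by simp
  obtain m0 s0 where m0: "m0 \<^bold>\<in> \<omega>" "codes q m0 s0" "answer p (npair m0 (s0 \<^bold>\<cdot> m0)) (K \<^bold>\<cdot> interleave p q \<^bold>\<cdot> \<^bold>0)"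
    using ex_answer[OF p q] by blast
  have "flag p (npairo m0 (s0 \<^bold>\<cdot> m0)) = \<^bold>0"
    unfolding flag npairo_eq[OF m0(1) code_omega[OF m0(2)]] using m0(3) by blast
  then have T0: "?T m0" using m0(2) by blast
  have "defpred ?T" unfolding defpred_def by (intro definable_intros)
  from omega_least[OF this m0(1) T0] obtain m where m: "m \<^bold>\<in> \<omega>" "?T m" "\<And>j. j \<^bold>\<in> m \<Longrightarrow> \<not> ?T j" by blast
  then obtain s where s: "codes q m s" "flag p (npairo m (s \<^bold>\<cdot> m)) = \<^bold>0" by blast
  have s0: "flag p (npair m (s \<^bold>\<cdot> m)) = \<^bold>0" using s(2) npairo_eq[OF m(1) code_omega[OF s(1)]] by simp
  \<comment> \<open>Unbounded search also requires defined nonzero values at all earlier lengths.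
    The flag is total and equals 1 where no answer is recorded.\<close>
  have "\<exists>v. val (rf_comp rf_left rf_entry) ?X (npair n j) v \<and> v \<noteq> \<^bold>0" if j: "j \<^bold>\<in> m" for j
  proof -
    have jo: "j \<^bold>\<in> \<omega>" using omega_mem[OF m(1) j] .
    obtain t where t: "codes q j t" using ex_codes[OF qN jo] by blast
    have "flag p (npair j (t \<^bold>\<cdot> j)) \<noteq> \<^bold>0"
      using m(3)[OF j] t npairo_eq[OF jo code_omega[OF t]] by auto
    then show ?thesis using val_flag[OF n jo t] by blast
  qed
  then have mu: "val (rf_mu (rf_comp rf_left rf_entry)) ?X n m"
    unfolding val_rf_mu using X n m(1) val_flag[OF n m(1) s(1)] s0 by simp
  obtain l where l: "answer p (npair m (s \<^bold>\<cdot> m)) l" using s0 unfolding flag by blast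
  have "K \<^bold>\<cdot> interleave p q \<^bold>\<cdot> \<^bold>0 = out p (npair m (s \<^bold>\<cdot> m))"
    using answer_correct[OF p q m(1) s(1) l] out_eq[OF l] by simp
  moreover have "val (rf_comp rf_right rf_entry) ?X (npair \<^bold>0 m) (out p (npair m (s \<^bold>\<cdot> m)))"
    by (rule val_compI[OF X npair_omega[OF zero_omega m(1)] val_entryI[OF p qN zero_omega m(1) s(1)]
          val_rightI[OF X flag_omega out_omega]])
  ultimately show ?thesis
    unfolding rf_out_def by (metis val_compI[OF X n val_pairI[OF X n val_zeroI[OF X n] mu]])
qed

lemma coded_le_f: "coded_problem \<le>\<^sub>W f"
proof -
  \<comment> \<open>The maps of the new reduction are defined on enriched names only: the forward
    one returns the recorded value of \<open>H\<close>, the backward one the first output of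
    \<open>K\<close> as a constant sequence.\<close>
  let ?QH = "\<lambda>z. \<exists>p. p \<^bold>\<in> \<N> \<and> z = \<^bold>\<langle>enc p, H \<^bold>\<cdot> p\<^bold>\<rangle>"
  let ?QK = "\<lambda>z. \<exists>p q. p \<^bold>\<in> \<N> \<and> solution_name f (H \<^bold>\<cdot> p) q \<and>
    z = \<^bold>\<langle>interleave (enc p) q, const_seq (K \<^bold>\<cdot> interleave p q \<^bold>\<cdot> \<^bold>0)\<^bold>\<rangle>"
  have dH: "defpred ?QH" and dK: "defpred ?QK"
    unfolding defpred_def by (intro definable_intros)+
  let ?H = "collect ?QH" and ?K = "collect ?QK"
  have mH: "z \<^bold>\<in> ?H \<longleftrightarrow> ?QH z" for z
    by (rule mem_collect_sub[OF dH, of "cart \<N> \<N>"]) (auto simp: mem_cart)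
  have mK: "z \<^bold>\<in> ?K \<longleftrightarrow> ?QK z" for z
  proof (rule mem_collect_sub[OF dK, of "cart \<N> \<N>"])
    fix z assume "?QK z"
    then obtain p q where pq: "p \<^bold>\<in> \<N>" "solution_name f (H \<^bold>\<cdot> p) q"
      "z = \<^bold>\<langle>interleave (enc p) q, const_seq (K \<^bold>\<cdot> interleave p q \<^bold>\<cdot> \<^bold>0)\<^bold>\<rangle>" by blast
    have "interleave (enc p) q \<^bold>\<in> \<N>" "const_seq (K \<^bold>\<cdot> interleave p q \<^bold>\<cdot> \<^bold>0) \<^bold>\<in> \<N>"
      using pq(1) f_solution_baire[OF pq(2)] K_omega[OF pq(1,2)] by simp_all
    then show "z \<^bold>\<in> cart \<N> \<N>" unfolding pq(3) mem_cart by blast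
  qed
  have int: "p = p' \<and> q = q'"
    if "interleave (enc p) q = interleave (enc p') q'" "p \<^bold>\<in> \<N>" "p' \<^bold>\<in> \<N>" "q \<^bold>\<in> \<N>" "q' \<^bold>\<in> \<N>" for p q p' q'
    using that enc_inject left_interleave right_interleave enc_baire by metis
  have fH: "func ?H" unfolding func_def mH using enc_inject by auto
  have fK: "func ?K" unfolding func_def mK
  proof (intro conjI allI impI)
    fix x y y'
    assume "?QK \<^bold>\<langle>x, y\<^bold>\<rangle> \<and> ?QK \<^bold>\<langle>x, y'\<^bold>\<rangle>"
    then obtain p q p' q' where "p \<^bold>\<in> \<N>" "solution_name f (H \<^bold>\<cdot> p) q" "p' \<^bold>\<in> \<N>" "solution_name f (H \<^bold>\<cdot> p') q'"
      "x = interleave (enc p) q" "y = const_seq (K \<^bold>\<cdot> interleave p q \<^bold>\<cdot> \<^bold>0)"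
      "x = interleave (enc p') q'" "y' = const_seq (K \<^bold>\<cdot> interleave p' q' \<^bold>\<cdot> \<^bold>0)"
      unfolding opair_eq by blast
    then show "y = y'" using int[of p q p' q'] f_solution_baire by simp
  qed blast
  have pH: "partial_maps ?H \<N> \<N>" unfolding partial_maps_def using fH unfolding mH by auto
  have pK: "partial_maps ?K \<N> \<N>"
    unfolding partial_maps_def
  proof (intro conjI[OF fK] allI impI)
    fix x y assume "\<^bold>\<langle>x, y\<^bold>\<rangle> \<^bold>\<in> ?K"
    then obtain p q where "p \<^bold>\<in> \<N>" "solution_name f (H \<^bold>\<cdot> p) q"
      "x = interleave (enc p) q" "y = const_seq (K \<^bold>\<cdot> interleave p q \<^bold>\<cdot> \<^bold>0)"
      unfolding mK opair_eq by blast
    then show "x \<^bold>\<in> \<N> \<and> y \<^bold>\<in> \<N>" using f_solution_baire K_omega by simp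
  qed
  have aH: "?H \<^bold>\<cdot> enc p = H \<^bold>\<cdot> p" "in_dom (enc p) ?H" if "p \<^bold>\<in> \<N>" for p
  proof -
    have "\<^bold>\<langle>enc p, H \<^bold>\<cdot> p\<^bold>\<rangle> \<^bold>\<in> ?H" unfolding mH using that by blast
    then show "?H \<^bold>\<cdot> enc p = H \<^bold>\<cdot> p" "in_dom (enc p) ?H"
      using func_app[OF fH] unfolding in_dom_def by blast+
  qed
  have aK: "?K \<^bold>\<cdot> interleave (enc p) q = const_seq (K \<^bold>\<cdot> interleave p q \<^bold>\<cdot> \<^bold>0)" "in_dom (interleave (enc p) q) ?K"
    if "p \<^bold>\<in> \<N>" "solution_name f (H \<^bold>\<cdot> p) q" for p q
  proof -
    have "\<^bold>\<langle>interleave (enc p) q, const_seq (K \<^bold>\<cdot> interleave p q \<^bold>\<cdot> \<^bold>0)\<^bold>\<rangle> \<^bold>\<in> ?K" unfolding mK using that by blast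
    then show "?K \<^bold>\<cdot> interleave (enc p) q = const_seq (K \<^bold>\<cdot> interleave p q \<^bold>\<cdot> \<^bold>0)" "in_dom (interleave (enc p) q) ?K"
      using func_app[OF fK] unfolding in_dom_def by blast+
  qed
  \<comment> \<open>The forward map is computable because it merely projects each entry of the
    enriched name to its leading component.\<close>
  have "val (rf_comp rf_left rf_oracle) x n (y \<^bold>\<cdot> n)" if xy: "\<^bold>\<langle>x, y\<^bold>\<rangle> \<^bold>\<in> ?H" and n: "n \<^bold>\<in> \<omega>" for x y n
  proof -
    obtain p where p: "p \<^bold>\<in> \<N>" "x = enc p" "y = H \<^bold>\<cdot> p" using xy unfolding mH opair_eq by blast
    have o: "H \<^bold>\<cdot> p \<^bold>\<cdot> n \<^bold>\<in> \<omega>" "npair (p \<^bold>\<cdot> n) (npair (flag p n) (out p n)) \<^bold>\<in> \<omega>"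
      using p(1) n flag_omega out_omega by simp_all
    have "val rf_oracle (enc p) n (npair (H \<^bold>\<cdot> p \<^bold>\<cdot> n) (npair (p \<^bold>\<cdot> n) (npair (flag p n) (out p n))))"
      using val_oracleI[OF enc_baire[OF p(1)] n] unfolding enc_app[OF p(1) n] .
    then show ?thesis
      unfolding p(2,3) by (rule val_compI[OF enc_baire[OF p(1)] n _ val_leftI[OF enc_baire[OF p(1)] o]])
  qed
  moreover have "recursive_functional (rf_comp rf_left rf_oracle)" by (intro recursive_functional_intros)
  ultimately have cH: "computable ?H" unfolding computable_def using pH by blast
  have "val rf_out x n (y \<^bold>\<cdot> n)" if xy: "\<^bold>\<langle>x, y\<^bold>\<rangle> \<^bold>\<in> ?K" and n: "n \<^bold>\<in> \<omega>" for x y n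
  proof -
    obtain p q where p: "p \<^bold>\<in> \<N>" "solution_name f (H \<^bold>\<cdot> p) q" "x = interleave (enc p) q"
      "y = const_seq (K \<^bold>\<cdot> interleave p q \<^bold>\<cdot> \<^bold>0)" using xy unfolding mK opair_eq by blast
    show ?thesis unfolding p(3,4) const_app[OF n] by (rule val_outI[OF p(1,2) n])
  qed
  moreover have "recursive_functional rf_out"
    unfolding rf_out_def rf_entry_def rf_even_def rf_odd_def rf_double_def rf_code_def
    by (intro recursive_functional_intros)
  ultimately have cK: "computable ?K" unfolding computable_def using pK by blast
  have "in_dom x ?H \<and> instance_name f (?H \<^bold>\<cdot> x) \<and> (\<forall>q. solution_name f (?H \<^bold>\<cdot> x) q \<longrightarrow>
      in_dom (interleave x q) ?K \<and> solution_name coded_problem x (?K \<^bold>\<cdot> interleave x q))"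
    if x: "instance_name coded_problem x" for x
  proof -
    obtain p where p: "p \<^bold>\<in> \<N>" "x = enc p" using x instance_name_coded by blast
    have "solution_name coded_problem (enc p) (const_seq (K \<^bold>\<cdot> interleave p q \<^bold>\<cdot> \<^bold>0))"
      if "solution_name f (H \<^bold>\<cdot> p) q" for q
      using sol[OF p(1) that] K_omega[OF p(1) that]
      unfolding solution_name_coded[OF p(1)] solution_name_Pi02_ACC by simp
    then show ?thesis unfolding p(2) aH(1)[OF p(1)] using aH(2) aK inst p(1) by auto
  qed
  then show ?thesis unfolding le_W_def reduces_via_def using cH cK by blast
qed

end

section \<open>The two halves of the dichotomy\<close>

context zf_structure
begin

text \<open>The chain runs from all-or-co-unique choice through \<open>coded_problem\<close> and
  \<open>g\<close> to \<open>C_Nat\<close>. Its middle link is the only use of maximality, and it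
  demands a computable reduction to \<open>f\<close>.\<close>

lemma not_both:
  assumes DC "is_problem f" "is_first_order_part g f" "\<Pi>\<^sup>0\<^sub>2ACC\<^sub>\<nat> \<le>\<^sub>W\<^sup>* f" "g \<le>\<^sub>W\<^sup>* C\<^sub>\<nat>"
  shows False
proof -
  obtain H K where HK: "conti (instance_name \<Pi>\<^sup>0\<^sub>2ACC\<^sub>\<nat>) (\<lambda>p. H \<^bold>\<cdot> p)"
    "conti (out_dom \<Pi>\<^sup>0\<^sub>2ACC\<^sub>\<nat> f (\<lambda>p. H \<^bold>\<cdot> p)) (\<lambda>x. K \<^bold>\<cdot> x)"
    "\<And>p. instance_name \<Pi>\<^sup>0\<^sub>2ACC\<^sub>\<nat> p \<Longrightarrow> instance_name f (H \<^bold>\<cdot> p)"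
    "\<And>p q. instance_name \<Pi>\<^sup>0\<^sub>2ACC\<^sub>\<nat> p \<Longrightarrow> solution_name f (H \<^bold>\<cdot> p) q \<Longrightarrow>
      solution_name \<Pi>\<^sup>0\<^sub>2ACC\<^sub>\<nat> p (K \<^bold>\<cdot> interleave p q)"
    using le_W_contE[OF assms(4)] by blast
  have "conti (\<lambda>p. p \<^bold>\<in> \<N>) (\<lambda>p. H \<^bold>\<cdot> p)"
    by (rule conti_cong[OF HK(1)]) (simp_all add: instance_name_Pi02_ACC)
  then interpret cont_reduction mem f H K
    using assms(2) HK by unfold_locales (simp_all add: instance_name_Pi02_ACC)
  have "coded_problem \<le>\<^sub>W g"
    using assms(3) baire_nat_coded coded_le_f unfolding is_first_order_part_def by blast
  then have "coded_problem \<le>\<^sub>W\<^sup>* g" by (rule le_W_imp_le_W_cont)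
  then have "coded_problem \<le>\<^sub>W\<^sup>* C\<^sub>\<nat>"
    by (rule le_W_cont_trans[OF _ assms(5)]) (simp add: solution_name_C_Nat)
  then have "\<Pi>\<^sup>0\<^sub>2ACC\<^sub>\<nat> \<le>\<^sub>W\<^sup>* C\<^sub>\<nat>"
    by (rule le_W_cont_trans[OF Pi02_ACC_le_coded]) (simp add: solution_name_C_Nat)
  then show False using not_Pi02_ACC_le_C_Nat[OF assms(1)] by blast
qed

text \<open>The game is applied to \<open>g\<close>, whose solutions are naturals; in the second
  case the reduction is prolonged along that of \<open>g\<close> to \<open>f\<close>.\<close>

lemma at_least_one:
  assumes AD "is_problem f" "is_first_order_part g f"
  shows "g \<le>\<^sub>W\<^sup>* C\<^sub>\<nat> \<or> \<Pi>\<^sup>0\<^sub>2ACC\<^sub>\<nat> \<le>\<^sub>W\<^sup>* f"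
proof -
  have g: "src_rep g = baire_rep" "tgt_rep g = nat_rep" and "g \<le>\<^sub>W f"
    using assms(3) unfolding is_first_order_part_def baire_nat_problem_def by blast+
  have "q \<^bold>\<in> \<N>" if "solution_name f p q" for p q
    using that assms(2) unfolding is_problem_def represented_space_def partial_maps_def solution_name_def by blast
  then show ?thesis
    using game_dichotomy[OF assms(1) g] le_W_cont_trans[OF _ le_W_imp_le_W_cont[OF \<open>g \<le>\<^sub>W f\<close>]] by blast
qed

end

theorem theorem30:
  fixes mem :: "'v \<Rightarrow> 'v \<Rightarrow> bool" and f g :: "'v problem"
  assumes "set_structure.ZF mem" and "set_structure.DC mem" and "set_structure.AD mem"
    and "set_structure.is_problem mem f"
    and "set_structure.is_first_order_part mem g f"
  shows "(set_structure.le_W_cont mem g (set_structure.C_Nat mem) \<and>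
            \<not> set_structure.le_W_cont mem (set_structure.Pi02_ACC_Nat mem) f) \<or>
         (\<not> set_structure.le_W_cont mem g (set_structure.C_Nat mem) \<and>
            set_structure.le_W_cont mem (set_structure.Pi02_ACC_Nat mem) f)"
proof -
  interpret zf_structure mem by unfold_locales (rule assms(1))
  show ?thesis using not_both[OF assms(2,4,5)] at_least_one[OF assms(3-5)] by blast
qed

end
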